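(* Let $\epsilon \in \,]0,1/2[$, set $k = n^{(1-2\epsilon)(1-\epsilon)}$ and $\delta = n^{-5\epsilon/4+\epsilon^2/2}$. Hypothesis $(H'_\epsilon)$ implies that there is no polynomial time algorithm which, given a matrix $\Phi$, outputs "yes" whenever $\delta_k(\Phi)\leq\delta$ and "no" whenever $\delta_k(\Phi) \geq n^{-\epsilon}/4$. Moreover this remains true even when inputs are restricted to matrices of size $2n \times 100n$; consequently, since $\delta = o(n^{-\epsilon}/4)$, for matrices of this size no polynomial time algorithm can approximate the RIP parameter of order $k$ within any constant factor (under $(H'_\epsilon)$).
   Context: A vector is $k$-sparse if it has at most $k$ nonzero coordinates. A matrix $\Phi$ satisfies the restricted isometry property (RIP) of order $k$ with parameter $\delta$ if $(1-\delta)\|x\|^2\leq\|\Phi x\|^2\leq(1+\delta)\|x\|^2$ for all $k$-sparse $x$; the RIP parameter of order $k$, $\delta_k(\Phi)$, is the smallest such $\delta \geq 0$. Approximating within a constant factor $\rho\ge1$ means outputting a number in $[\delta_k(\Phi),\rho\,\delta_k(\Phi)]$. $G(n,1/2)$ denotes the uniform distribution on graphs with $n$ vertices. Hypothesis $(H'_\epsilon)$: there is no polynomial time randomized algorithm which, given as input a graph $G$ on $n$ vertices, (i) always outputs "yes" if $G$ contains a clique of size $n^{1/2-\epsilon}$, and (ii) when $G$ is drawn from $G(n,1/2)$, with probability tending to $1$ as $n\to\infty$ over the choice of $G$, outputs "no" with probability at least $3/4$ over its internal coin tosses. Floor and ceiling signs are omitted. *)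

theory Defs
  imports
    "HOL-Probability.Probability"
    "HOL-Library.Log_Nat"
    "HOL-Library.Landau_Symbols"
    "Jordan_Normal_Form.Matrix"
begin

definition sparse_vec :: "nat \<Rightarrow> real vec \<Rightarrow> bool" where
  "sparse_vec k x \<longleftrightarrow> card {i. i < dim_vec x \<and> vec_index x i \<noteq> 0} \<le> k"

definition norm_sq :: "real vec \<Rightarrow> real" where
  "norm_sq x = scalar_prod x x"

definition has_rip :: "real mat \<Rightarrow> nat \<Rightarrow> real \<Rightarrow> bool" where
  "has_rip A k \<delta> \<longleftrightarrow>
     (\<forall>x \<in> carrier_vec (dim_col A). sparse_vec k x \<longrightarrow>
        (1 - \<delta>) * norm_sq x \<le> norm_sq (mult_mat_vec A x) \<and>
        norm_sq (mult_mat_vec A x) \<le> (1 + \<delta>) * norm_sq x)"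

definition rip_param :: "nat \<Rightarrow> real mat \<Rightarrow> real" where
  "rip_param k A = (LEAST \<delta>. 0 \<le> \<delta> \<and> has_rip A k \<delta>)"

text \<open>The minimum in \<^const>\<open>rip_param\<close> exists.\<close>

lemma norm_sq_sum: "norm_sq x = (\<Sum>i<dim_vec x. (vec_index x i)\<^sup>2)"
  by (simp add: norm_sq_def scalar_prod_def power2_eq_square atLeast0LessThan)

lemma norm_sq_nonneg: "0 \<le> norm_sq x"
  by (simp add: norm_sq_sum sum_nonneg)

lemma norm_sq_mult_le:
  assumes "x \<in> carrier_vec (dim_col A)"
  shows "norm_sq (mult_mat_vec A x) \<le>
    (\<Sum>i<dim_row A. \<Sum>j<dim_col A. (index_mat A (i, j))\<^sup>2) * norm_sq x"
proof -
  have dx: "dim_vec x = dim_col A" using assms by auto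
  have "norm_sq (mult_mat_vec A x) =
      (\<Sum>i<dim_row A. (\<Sum>j<dim_col A. index_mat A (i, j) * vec_index x j)\<^sup>2)"
    by (simp add: norm_sq_sum scalar_prod_def atLeast0LessThan dx row_def)
  also have "\<dots> \<le> (\<Sum>i<dim_row A. (\<Sum>j<dim_col A. (index_mat A (i, j))\<^sup>2) * norm_sq x)"
    unfolding norm_sq_sum dx
    by (intro sum_mono Cauchy_Schwarz_ineq_sum)
  finally show ?thesis by (simp add: sum_distrib_right)
qed

lemma rip_param_least:
  shows "0 \<le> rip_param k A" "has_rip A k (rip_param k A)"
    and "0 \<le> \<delta> \<Longrightarrow> has_rip A k \<delta> \<Longrightarrow> rip_param k A \<le> \<delta>"
proof -
  define S where "S = {\<delta>. 0 \<le> \<delta> \<and> has_rip A k \<delta>}"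
  define C where "C = (\<Sum>i<dim_row A. \<Sum>j<dim_col A. (index_mat A (i, j))\<^sup>2)"
  have C0: "0 \<le> C" unfolding C_def by (intro sum_nonneg) auto
  have "1 + C \<in> S" unfolding S_def has_rip_def
  proof (intro CollectI conjI ballI impI)
    show "0 \<le> 1 + C" using C0 by simp
    fix x :: "real vec" assume x: "x \<in> carrier_vec (dim_col A)"
    have N: "0 \<le> norm_sq x" "0 \<le> norm_sq (mult_mat_vec A x)" by (rule norm_sq_nonneg)+
    have "0 \<le> C * norm_sq x" using C0 N by simp
    then show "(1 - (1 + C)) * norm_sq x \<le> norm_sq (mult_mat_vec A x)"
      using N by (simp add: algebra_simps)
    show "norm_sq (mult_mat_vec A x) \<le> (1 + (1 + C)) * norm_sq x"
      using norm_sq_mult_le[OF x] N unfolding C_def[symmetric] by (simp add: algebra_simps)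
  qed
  then have ne: "S \<noteq> {}" by auto
  have bdd: "bdd_below S" unfolding S_def by (auto intro: bdd_belowI)
  have Inf0: "0 \<le> Inf S" by (rule cInf_greatest[OF ne]) (simp add: S_def)
  have "has_rip A k (Inf S)" unfolding has_rip_def
  proof (intro ballI impI)
    fix x :: "real vec" assume x: "x \<in> carrier_vec (dim_col A)" "sparse_vec k x"
    define p q where "p = norm_sq x" and "q = norm_sq (mult_mat_vec A x)"
    have p: "0 \<le> p" unfolding p_def by (rule norm_sq_nonneg)
    have *: "(1 - d) * p \<le> q \<and> q \<le> (1 + d) * p" if "d \<in> S" for d
      using that x unfolding S_def has_rip_def p_def q_def by auto
    have "(1 - Inf S) * p \<le> q \<and> q \<le> (1 + Inf S) * p"
    proof (cases "p = 0")
      case True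
      then show ?thesis using * ne by auto
    next
      case False
      with p have p: "0 < p" by simp
      have "1 - q / p \<le> Inf S"
        by (rule cInf_greatest[OF ne]) (use * p in \<open>auto simp: field_simps\<close>)
      moreover have "q / p - 1 \<le> Inf S"
        by (rule cInf_greatest[OF ne]) (use * p in \<open>auto simp: field_simps\<close>)
      ultimately show ?thesis using p by (auto simp: field_simps)
    qed
    then show "(1 - Inf S) * norm_sq x \<le> norm_sq (mult_mat_vec A x) \<and>
        norm_sq (mult_mat_vec A x) \<le> (1 + Inf S) * norm_sq x"
      unfolding p_def q_def .
  qed
  have "rip_param k A = Inf S" unfolding rip_param_def
  proof (rule Least_equality)
    show "0 \<le> Inf S \<and> has_rip A k (Inf S)" using Inf0 \<open>has_rip A k (Inf S)\<close> by blast
    show "Inf S \<le> d" if "0 \<le> d \<and> has_rip A k d" for d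
      using that by (intro cInf_lower bdd) (simp add: S_def)
  qed
  with \<open>has_rip A k (Inf S)\<close> Inf0
  show "0 \<le> rip_param k A" "has_rip A k (rip_param k A)" by auto
  show "0 \<le> \<delta> \<Longrightarrow> has_rip A k \<delta> \<Longrightarrow> rip_param k A \<le> \<delta>"
    unfolding \<open>rip_param k A = Inf S\<close> by (auto intro!: cInf_lower bdd simp: S_def)
qed

text \<open>
  Algorithms are programs for a random access machine with integer cells, charged by the
  logarithmic cost criterion, which is polynomially equivalent to Turing machine time.
  The memory is split into arrays, each indexed by the integers; a program only names
  finitely many arrays, and a scalar variable is an array used at a single index.
\<close>

type_synonym mem = "nat \<Rightarrow> int \<Rightarrow> int"

datatype expr =
    Const int
  | Read nat expr
  | Add expr expr
  | Sub expr expr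
  | Mul expr expr
  | Div expr expr

datatype prog =
    Write nat expr expr
  | Flip nat expr
  | Seq prog prog
  | If expr prog prog
  | While expr prog

fun val :: "expr \<Rightarrow> mem \<Rightarrow> int" where
  "val (Const z) s = z"
| "val (Read a e) s = s a (val e s)"
| "val (Add e f) s = val e s + val f s"
| "val (Sub e f) s = val e s - val f s"
| "val (Mul e f) s = val e s * val f s"
| "val (Div e f) s = val e s div val f s"

definition bits :: "int \<Rightarrow> nat" where
  "bits z = floorlog 2 (nat \<bar>z\<bar>)"

text \<open>
  Every evaluated subexpression, in particular every address used, is charged its bit length.
\<close>

fun cost :: "expr \<Rightarrow> mem \<Rightarrow> nat" where
  "cost (Const z) s = 1 + bits z"
| "cost (Read a e) s = 1 + cost e s + bits (val (Read a e) s)"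
| "cost (Add e f) s = 1 + cost e s + cost f s + bits (val (Add e f) s)"
| "cost (Sub e f) s = 1 + cost e s + cost f s + bits (val (Sub e f) s)"
| "cost (Mul e f) s = 1 + cost e s + cost f s + bits (val (Mul e f) s)"
| "cost (Div e f) s = 1 + cost e s + cost f s + bits (val (Div e f) s)"

definition store :: "mem \<Rightarrow> nat \<Rightarrow> int \<Rightarrow> int \<Rightarrow> mem" where
  "store s a i v = s(a := (s a)(i := v))"

text \<open>
  \<open>exec c s w t s'\<close>: started in memory \<open>s\<close>, the program \<open>c\<close> halts in memory \<open>s'\<close> at total
  cost \<open>t\<close>, and \<open>w\<close> lists exactly the outcomes of the coin tosses made on the way.
  A guard counts as true iff its value is positive.
\<close>

inductive exec :: "prog \<Rightarrow> mem \<Rightarrow> bool list \<Rightarrow> nat \<Rightarrow> mem \<Rightarrow> bool" where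
  Write: "exec (Write a i e) s [] (1 + cost i s + cost e s) (store s a (val i s) (val e s))"
| Flip: "exec (Flip a i) s [b] (1 + cost i s) (store s a (val i s) (of_bool b))"
| Seq: "exec c s v t s' \<Longrightarrow> exec d s' w u s'' \<Longrightarrow> exec (Seq c d) s (v @ w) (t + u) s''"
| IfTrue: "0 < val e s \<Longrightarrow> exec c s w t s' \<Longrightarrow> exec (If e c d) s w (1 + cost e s + t) s'"
| IfFalse: "\<not> 0 < val e s \<Longrightarrow> exec d s w t s' \<Longrightarrow> exec (If e c d) s w (1 + cost e s + t) s'"
| WhileFalse: "\<not> 0 < val e s \<Longrightarrow> exec (While e c) s [] (1 + cost e s) s"
| WhileTrue: "0 < val e s \<Longrightarrow> exec c s v t s' \<Longrightarrow> exec (While e c) s' w u s'' \<Longrightarrow>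
    exec (While e c) s (v @ w) (1 + cost e s + t + u) s''"

text \<open>
  The run is determined by the coin tosses, and the sets of coin sequences of halting runs
  are prefix-free.
\<close>

inductive_cases exec_WriteE: "exec (Write a i e) s w t s'"
inductive_cases exec_FlipE: "exec (Flip a i) s w t s'"
inductive_cases exec_SeqE: "exec (Seq c d) s w t s'"
inductive_cases exec_IfE: "exec (If e c d) s w t s'"
inductive_cases exec_WhileE: "exec (While e c) s w t s'"

lemma exec_determ:
  "exec c s v t s' \<Longrightarrow> exec c s w u s'' \<Longrightarrow> v @ x = w @ y \<Longrightarrow> v = w \<and> t = u \<and> s' = s''"
proof (induction arbitrary: w u s'' x y rule: exec.induct)
  case (Write a i e s)
  then show ?case by (auto elim: exec_WriteE)
next
  case (Flip a i s b)
  then show ?case by (auto elim: exec_FlipE)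
next
  case (Seq c s v t s' d v' t' s2)
  from Seq.prems(1) obtain w1 w2 u1 u2 r where
    r: "exec c s w1 u1 r" "exec d r w2 u2 s''" "w = w1 @ w2" "u = u1 + u2"
    by (auto elim: exec_SeqE)
  have 1: "v = w1 \<and> t = u1 \<and> s' = r"
    using Seq.IH(1)[OF r(1), of "v' @ x" "w2 @ y"] Seq.prems(2) r by simp
  then show ?case using Seq.IH(2)[of w2 u2 s'' x y] Seq.prems(2) r by simp
next
  case (IfTrue e s c v t s' d)
  from IfTrue.prems(1) IfTrue.hyps(1) obtain u1 where
    r: "exec c s w u1 s''" "u = 1 + cost e s + u1"
    by (auto elim: exec_IfE)
  show ?case using IfTrue.IH[OF r(1) IfTrue.prems(2)] r by simp
next
  case (IfFalse e s d v t s' c)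
  from IfFalse.prems(1) IfFalse.hyps(1) obtain u1 where
    r: "exec d s w u1 s''" "u = 1 + cost e s + u1"
    by (auto elim: exec_IfE)
  show ?case using IfFalse.IH[OF r(1) IfFalse.prems(2)] r by simp
next
  case (WhileFalse e s c)
  then show ?case by (auto elim: exec_WhileE)
next
  case (WhileTrue e s c v t s' v' t' s2)
  from WhileTrue.prems(1) WhileTrue.hyps(1) obtain w1 w2 u1 u2 r where
    r: "exec c s w1 u1 r" "exec (While e c) r w2 u2 s''" "w = w1 @ w2"
      "u = 1 + cost e s + u1 + u2"
    by (auto elim: exec_WhileE)
  have 1: "v = w1 \<and> t = u1 \<and> s' = r"
    using WhileTrue.IH(1)[OF r(1), of "v' @ x" "w2 @ y"] WhileTrue.prems(2) r by simp
  then show ?case using WhileTrue.IH(2)[of w2 u2 s'' x y] WhileTrue.prems(2) r by simp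
qed

fun deterministic :: "prog \<Rightarrow> bool" where
  "deterministic (Write a i e) \<longleftrightarrow> True"
| "deterministic (Flip a i) \<longleftrightarrow> False"
| "deterministic (Seq c d) \<longleftrightarrow> deterministic c \<and> deterministic d"
| "deterministic (If e c d) \<longleftrightarrow> deterministic c \<and> deterministic d"
| "deterministic (While e c) \<longleftrightarrow> deterministic c"

text \<open>
  The input is a list of integers, placed in array 0 from index 0 on; all other cells are 0.
  Output is left in array 1: a decision in its cell 0 (1 for ``yes'', 0 for ``no''), a rational
  number as numerator and denominator in cells 0 and 1.
\<close>

definition init :: "int list \<Rightarrow> mem" where
  "init x = (\<lambda>a i. if a = 0 \<and> 0 \<le> i \<and> nat i < length x then x ! nat i else 0)"

definition input_size :: "int list \<Rightarrow> nat" where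
  "input_size x = (\<Sum>z\<leftarrow>x. 1 + bits z)"

text \<open>Worst case over inputs and over coin tosses; \<open>\<omega>\<close> is an infinite sequence of coin tosses.\<close>

definition polytime_on :: "int list set \<Rightarrow> prog \<Rightarrow> bool" where
  "polytime_on X c \<longleftrightarrow> (\<exists>p :: nat poly. \<forall>x \<in> X. \<forall>\<omega> :: nat \<Rightarrow> bool.
     \<exists>m t s. exec c (init x) (map \<omega> [0..<m]) t s \<and> t \<le> poly p (input_size x))"

definition yes :: "mem \<Rightarrow> bool" where
  "yes s \<longleftrightarrow> s 1 0 = 1"

definition no :: "mem \<Rightarrow> bool" where
  "no s \<longleftrightarrow> s 1 0 = 0"

definition outputs_rational :: "mem \<Rightarrow> rat \<Rightarrow> bool" where
  "outputs_rational s q \<longleftrightarrow> s 1 1 \<noteq> 0 \<and> q = of_int (s 1 0) / of_int (s 1 1)"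

text \<open>\<open>c\<close> halts on input \<open>x\<close> with a memory satisfying \<open>Q\<close>, whatever the coin tosses.\<close>

definition always :: "prog \<Rightarrow> int list \<Rightarrow> (mem \<Rightarrow> bool) \<Rightarrow> bool" where
  "always c x Q \<longleftrightarrow> (\<forall>\<omega> :: nat \<Rightarrow> bool. \<exists>m t s. exec c (init x) (map \<omega> [0..<m]) t s \<and> Q s)"

text \<open>
  A halting run that tosses the coins \<open>w\<close> has probability \<open>(1/2) ^ length w\<close>.
\<close>

definition prob_output :: "prog \<Rightarrow> int list \<Rightarrow> (mem \<Rightarrow> bool) \<Rightarrow> real" where
  "prob_output c x Q =
     infsum (\<lambda>w. (1 / 2) ^ length w) {w. \<exists>t s. exec c (init x) w t s \<and> Q s}"

text \<open>Simple graphs on the vertices \<open>0, \<dots>, n - 1\<close>, given by their edge sets.\<close>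

definition graphs :: "nat \<Rightarrow> nat set set set" where
  "graphs n = Pow {{u, v} | u v. u < n \<and> v < n \<and> u \<noteq> v}"

definition random_graph :: "nat \<Rightarrow> nat set set pmf" where
  "random_graph n = pmf_of_set (graphs n)"

definition has_clique :: "nat \<Rightarrow> nat set set \<Rightarrow> nat \<Rightarrow> bool" where
  "has_clique n E m \<longleftrightarrow>
     (\<exists>K \<subseteq> {..<n}. card K = m \<and> (\<forall>u \<in> K. \<forall>v \<in> K. u \<noteq> v \<longrightarrow> {u, v} \<in> E))"

definition enc_graph :: "nat \<Rightarrow> nat set set \<Rightarrow> int list" where
  "enc_graph n E = int n # [of_bool ({i, j} \<in> E). i \<leftarrow> [0..<n], j \<leftarrow> [0..<n]]"

definition clique_size :: "real \<Rightarrow> nat \<Rightarrow> nat" where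
  "clique_size \<epsilon> n = nat \<lceil>real n powr (1 / 2 - \<epsilon>)\<rceil>"

definition solves_hidden_clique :: "real \<Rightarrow> prog \<Rightarrow> bool" where
  "solves_hidden_clique \<epsilon> c \<longleftrightarrow>
     polytime_on {enc_graph n E | n E. E \<in> graphs n} c \<and>
     (\<forall>n. \<forall>E \<in> graphs n. has_clique n E (clique_size \<epsilon> n) \<longrightarrow> always c (enc_graph n E) yes) \<and>
     (\<lambda>n. measure_pmf.prob (random_graph n) {E. prob_output c (enc_graph n E) no \<ge> 3 / 4})
       \<longlonglongrightarrow> 1"

definition hidden_clique_hypothesis :: "real \<Rightarrow> bool" where
  "hidden_clique_hypothesis \<epsilon> \<longleftrightarrow> \<not> (\<exists>c. solves_hidden_clique \<epsilon> c)"

text \<open>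
  Inputs are rational matrices, with entries in lowest terms, together with the parameter \<open>n\<close>
  that determines the order and the thresholds.
\<close>

definition enc_mat :: "nat \<Rightarrow> rat mat \<Rightarrow> int list" where
  "enc_mat n A = int n # int (dim_row A) # int (dim_col A) #
     concat [[fst (quotient_of (index_mat A (i, j))), snd (quotient_of (index_mat A (i, j)))].
       i \<leftarrow> [0..<dim_row A], j \<leftarrow> [0..<dim_col A]]"

definition rip_of :: "nat \<Rightarrow> rat mat \<Rightarrow> real" where
  "rip_of k A = rip_param k (map_mat of_rat A)"

definition rip_order :: "real \<Rightarrow> nat \<Rightarrow> nat" where
  "rip_order \<epsilon> n = nat \<lfloor>real n powr ((1 - 2 * \<epsilon>) * (1 - \<epsilon>))\<rfloor>"

definition rip_small :: "real \<Rightarrow> nat \<Rightarrow> real" where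
  "rip_small \<epsilon> n = real n powr (- 5 * \<epsilon> / 4 + \<epsilon>\<^sup>2 / 2)"

definition rip_large :: "real \<Rightarrow> nat \<Rightarrow> real" where
  "rip_large \<epsilon> n = real n powr (- \<epsilon>) / 4"

text \<open>
  \<open>D n\<close> is the set of matrices admitted as inputs for the parameter \<open>n\<close>. Correctness is asked
  for large \<open>n\<close> only: for small \<open>n\<close> one has \<open>rip_large \<epsilon> n \<le> rip_small \<epsilon> n\<close>, and the two
  requirements may contradict each other.
\<close>

definition separates_rip :: "real \<Rightarrow> (nat \<Rightarrow> rat mat set) \<Rightarrow> prog \<Rightarrow> bool" where
  "separates_rip \<epsilon> D c \<longleftrightarrow>
     deterministic c \<and> polytime_on {enc_mat n A | n A. A \<in> D n} c \<and>
     (\<forall>\<^sub>F n in sequentially. \<forall>A \<in> D n.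
        (rip_of (rip_order \<epsilon> n) A \<le> rip_small \<epsilon> n \<longrightarrow> always c (enc_mat n A) yes) \<and>
        (rip_of (rip_order \<epsilon> n) A \<ge> rip_large \<epsilon> n \<longrightarrow> always c (enc_mat n A) no))"

definition approximates_rip :: "real \<Rightarrow> real \<Rightarrow> (nat \<Rightarrow> rat mat set) \<Rightarrow> prog \<Rightarrow> bool" where
  "approximates_rip \<epsilon> \<rho> D c \<longleftrightarrow>
     deterministic c \<and> polytime_on {enc_mat n A | n A. A \<in> D n} c \<and>
     (\<forall>\<^sub>F n in sequentially. \<forall>A \<in> D n.
        always c (enc_mat n A) (\<lambda>s. \<exists>q. outputs_rational s q \<and>
          of_rat q \<in> {rip_of (rip_order \<epsilon> n) A .. \<rho> * rip_of (rip_order \<epsilon> n) A}))"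

end

theory Submission
  imports Defs "HOL-Library.Discrete_Functions" "HOL-Real_Asymp.Real_Asymp"
begin

text \<open>
  A graph on \<open>n\<close> vertices is turned into two matrices \<open>\<Phi>\<^sub>+\<close> and \<open>\<Phi>\<^sub>-\<close>. Every pair of vertices at cyclic
  distance \<open>d \<le> h = (n - 1) div 2\<close> is used once, for the entry \<open>\<plusminus> 1 / (30 v)\<close> in row \<open>i\<close> and column
  \<open>i + d\<close>, whose sign is the adjacency bit, flipped in \<open>\<Phi>\<^sub>-\<close>. The diagonal is \<open>4 / 5\<close>, and since
  \<open>324 v\<^sup>2\<close> is nearly \<open>h\<close>, the columns have nearly unit length. The remaining \<open>99 n\<close> columns are
  filled with a \<open>v\<^sup>2 \<times> 99 n\<close> matrix of signs that reuses the same adjacency bits.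

  If the graph has a clique \<open>K\<close> with indicator vector \<open>x\<close>, the terms that are quadratic in the
  adjacency bits cancel in \<open>\<parallel>\<Phi>\<^sub>+ x\<parallel>\<^sup>2 - \<parallel>\<Phi>\<^sub>- x\<parallel>\<^sup>2\<close>, which is therefore large whatever the rest of the
  graph looks like, so one of the two matrices has a large RIP parameter. If the graph is random,
  both parameters are small with high probability: for a fixed vector, \<open>\<parallel>\<Phi> x\<parallel>\<^sup>2\<close> concentrates by an
  exponential moment bound, and a union bound over a grid of sparse vectors costs only a factor
  \<open>n\<^bsup>O(k)\<^esup>\<close>. As \<open>324 v\<^sup>2\<close> differs from \<open>h\<close> by \<open>O(v)\<close>, the error in the normalisation is \<open>O(n\<^bsup>-1/2\<^esup>)\<close>, below
  the lower threshold. So a program that separates the two cases, run on both matrices, solves the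
  hidden clique problem without tossing coins.

  An approximation within a constant factor separates the two thresholds by comparison with \<open>n\<^bsup>-a/b\<^esup>\<close>
  for a rational \<open>a / b\<close> strictly between the two exponents.
\<close>

subsection \<open>Programs and their costs\<close>

text \<open>The diagonal makes a clique visible: its cross term with the sign block is linear in the
  adjacency bits, and every pair inside the clique that is used adds to it with sign +. Relative to
  the norm this amounts to order |K| / v, hence n powr (- \<epsilon>). The quadratic term could hide
  it, but negating all signs flips the linear term only.

  The upper bound has to beat a union bound over about n^(5 k) vectors with a failure exponent of
  order \<delta>^2 n. This fixes the balance of k and \<delta>: \<delta>^2 n is k, up to rounding,
  times n powr (\<epsilon> * (1 / 2 - \<epsilon>)). Independence of the signs within a block is
  essential, which is why a pair is used at most once there.

  Entries must be rational, whence the triple 3, 4, 5: beside the diagonal 4/5 the signs of a column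
  should contribute (3/5)^2, which is h / (30 v)^2 when h = (18 v)^2.\<close>

lemma bits_le_iff: "bits z \<le> m \<longleftrightarrow> \<bar>z\<bar> < 2 ^ m"
proof -
  have "bits z \<le> m \<longleftrightarrow> nat \<bar>z\<bar> < 2 ^ m"
    unfolding bits_def by (auto simp: floorlog_le_iff)
  also have "\<dots> \<longleftrightarrow> \<bar>z\<bar> < 2 ^ m"
    by (simp add: nat_less_iff)
  finally show ?thesis .
qed

lemma abs_less_bits: "\<bar>z\<bar> < 2 ^ bits z"
  using bits_le_iff by blast

lemma bits_le_abs: "bits z \<le> nat \<bar>z\<bar>"
proof -
  have "\<bar>z\<bar> < 2 ^ nat \<bar>z\<bar>"
    by (metis abs_ge_zero int_nat_eq nat_less_iff of_nat_less_two_power of_nat_numeral of_nat_power)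
  then show ?thesis by (simp add: bits_le_iff)
qed

lemma bits_add: "bits (x + y) \<le> 1 + bits x + bits y"
proof -
  have "\<bar>x + y\<bar> < 2 ^ bits x + 2 ^ bits y"
    using abs_less_bits[of x] abs_less_bits[of y] by linarith
  also have "\<dots> \<le> 2 ^ (bits x + bits y) + 2 ^ (bits x + bits y)"
    by (intro add_mono power_increasing) auto
  finally show ?thesis by (simp add: bits_le_iff)
qed

lemma bits_uminus [simp]: "bits (- x) = bits x"
  by (simp add: bits_def)

lemma bits_diff: "bits (x - y) \<le> 1 + bits x + bits y"
  using bits_add[of x "- y"] by simp

lemma bits_mult: "bits (x * y) \<le> bits x + bits y"
  using abs_less_bits[of x] abs_less_bits[of y]
  by (auto simp: bits_le_iff abs_mult power_add intro!: mult_strict_mono)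

lemma abs_div_le: "\<bar>x div y\<bar> \<le> \<bar>x\<bar>" for x y :: int
proof (cases "y = 0")
  case False
  show ?thesis
  proof (cases "y > 0")
    case True
    then show ?thesis
      by (smt (verit, best) div_by_1 div_neg_pos_less0 pos_imp_zdiv_nonneg_iff zdiv_mono2 zdiv_mono2_neg)
  next
    case False
    with \<open>y \<noteq> 0\<close> have y: "- y > 0" by simp
    have *: "\<bar>x div z\<bar> \<le> \<bar>x\<bar>" if "z > 0" for x z :: int
      using that
      by (smt (verit, best) div_by_1 div_neg_pos_less0 pos_imp_zdiv_nonneg_iff zdiv_mono2 zdiv_mono2_neg)
    have "x div y = (- x) div (- y)" by simp
    then show ?thesis using *[OF y, of "- x"] by simp
  qed
qed simp

lemma bits_div: "bits (x div y) \<le> bits x"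
  using abs_div_le[of x y] abs_less_bits[of x] by (simp add: bits_le_iff)

lemma bits_val_le_cost: "bits (val e s) \<le> cost e s"
  by (cases e) auto

text \<open>For a fixed expression the cost is at most linear in the bit length B of the cells, and
  this is a slope that suffices. The factor 2 pays for each operand twice: for its evaluation and
  for its share in the bit length of the result.\<close>

fun weight :: "expr \<Rightarrow> nat" where
  "weight (Const z) = 1 + bits z"
| "weight (Read a e) = 2 + weight e"
| "weight (Add e f) = 2 + 2 * weight e + 2 * weight f"
| "weight (Sub e f) = 2 + 2 * weight e + 2 * weight f"
| "weight (Mul e f) = 2 + 2 * weight e + 2 * weight f"
| "weight (Div e f) = 2 + 2 * weight e + 2 * weight f"

text \<open>The clause \<open>1 \<le> B\<close> lets constant charges be absorbed into multiples of
  B.\<close>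

definition cells_within :: "nat \<Rightarrow> mem \<Rightarrow> bool" where
  "cells_within B s \<longleftrightarrow> 1 \<le> B \<and> (\<forall>a i. bits (s a i) \<le> B)"

lemma cost_le_weight:
  assumes "cells_within B s"
  shows "cost e s \<le> weight e * B"
proof -
  have B: "1 \<le> B" "bits (s a i) \<le> B" for a i using assms by (auto simp: cells_within_def)
  have binary: "1 + cost e s + cost f s + bits z \<le> (2 + 2 * weight e + 2 * weight f) * B"
    if "cost e s \<le> weight e * B" "cost f s \<le> weight f * B" "bits z \<le> 1 + bits (val e s) + bits (val f s)"
    for e f z
    using that B(1) bits_val_le_cost[of e s] bits_val_le_cost[of f s] by (simp add: algebra_simps)
  show ?thesis
  proof (induction e)
    case (Const z)
    have "(1 + bits z) * 1 \<le> (1 + bits z) * B" using B by (intro mult_left_mono) auto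
    then show ?case by simp
  next
    case (Read a e)
    then show ?case using B(1) B(2)[of a "val e s"] by (simp add: algebra_simps)
  next
    case (Add e f)
    then show ?case using binary[OF _ _ bits_add] by (simp only: cost.simps weight.simps val.simps)
  next
    case (Sub e f)
    then show ?case using binary[OF _ _ bits_diff] by (simp only: cost.simps weight.simps val.simps)
  next
    case (Mul e f)
    moreover have "bits (val e s * val f s) \<le> 1 + bits (val e s) + bits (val f s)"
      using bits_mult[of "val e s" "val f s"] by simp
    ultimately show ?case using binary by (simp only: cost.simps weight.simps val.simps)
  next
    case (Div e f)
    moreover have "bits (val e s div val f s) \<le> 1 + bits (val e s) + bits (val f s)"
      using bits_div[of "val e s" "val f s"] by simp
    ultimately show ?case using binary by (simp only: cost.simps weight.simps val.simps)
  qed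
qed

text \<open>A value is charged its bit length before it is stored, so cells grow no faster than time
  passes. This controls the memory left behind by a program of which only the running time is
  known.\<close>

lemma exec_bits: "exec c s w t s' \<Longrightarrow> bits (s' a i) \<le> bits (s a i) + t"
proof (induction arbitrary: a i rule: exec.induct)
  case (Write b j e s)
  then show ?case using bits_val_le_cost[of e s] by (auto simp: store_def)
next
  case (Flip b j s x)
  have "bits (of_bool x) \<le> 1" by (simp add: bits_le_iff)
  then show ?case by (auto simp: store_def)
next
  case (Seq c s v t s' d w u s'')
  show ?case using Seq.IH(1)[of a i] Seq.IH(2)[of a i] by simp
next
  case (WhileTrue e s c v t s' w u s'')
  show ?case using WhileTrue.IH(1)[of a i] WhileTrue.IH(2)[of a i] by simp
next
  case (IfTrue e s c w t s' d)
  show ?case using IfTrue.IH[of a i] by simp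
next
  case (IfFalse e s d w t s' c)
  show ?case using IfFalse.IH[of a i] by simp
qed simp

lemma exec_deterministic: "exec c s w t s' \<Longrightarrow> deterministic c \<Longrightarrow> w = []"
  by (induction rule: exec.induct) auto

section \<open>Renaming the arrays of a program\<close>

fun ren_expr :: "(nat \<Rightarrow> nat) \<Rightarrow> expr \<Rightarrow> expr" where
  "ren_expr f (Const z) = Const z"
| "ren_expr f (Read a e) = Read (f a) (ren_expr f e)"
| "ren_expr f (Add e e') = Add (ren_expr f e) (ren_expr f e')"
| "ren_expr f (Sub e e') = Sub (ren_expr f e) (ren_expr f e')"
| "ren_expr f (Mul e e') = Mul (ren_expr f e) (ren_expr f e')"
| "ren_expr f (Div e e') = Div (ren_expr f e) (ren_expr f e')"

fun ren :: "(nat \<Rightarrow> nat) \<Rightarrow> prog \<Rightarrow> prog" where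
  "ren f (Write a i e) = Write (f a) (ren_expr f i) (ren_expr f e)"
| "ren f (Flip a i) = Flip (f a) (ren_expr f i)"
| "ren f (Seq c d) = Seq (ren f c) (ren f d)"
| "ren f (If e c d) = If (ren_expr f e) (ren f c) (ren f d)"
| "ren f (While e c) = While (ren_expr f e) (ren f c)"

lemma val_ren: "val (ren_expr f e) s = val e (s \<circ> f)"
  by (induction e) auto

lemma cost_ren: "cost (ren_expr f e) s = cost e (s \<circ> f)"
  by (induction e) (auto simp: val_ren o_def)

lemma deterministic_ren [simp]: "deterministic (ren f c) = deterministic c"
  by (induction c) auto

lemma store_comp: "inj f \<Longrightarrow> store s (f a) i v \<circ> f = store (s \<circ> f) a i v"
  by (auto simp: store_def fun_eq_iff inj_eq)

text \<open>Addresses within an array are charged, names of arrays are not, so the simulation has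
  exactly the same cost. Since arrays outside the range of f survive, several programs can share one
  memory.\<close>

lemma exec_ren:
  assumes "exec c r w t r'" "inj f" "s \<circ> f = r"
  shows "\<exists>s'. exec (ren f c) s w t s' \<and> s' \<circ> f = r' \<and> (\<forall>b. b \<notin> range f \<longrightarrow> s' b = s b)"
  using assms(1,3)
proof (induction arbitrary: s rule: exec.induct)
  case (Write a i e r)
  have "exec (ren f (Write a i e)) s [] (1 + cost i r + cost e r) (store s (f a) (val i r) (val e r))"
    using exec.Write[of "f a" "ren_expr f i" "ren_expr f e" s] Write by (simp add: val_ren cost_ren)
  moreover have "store s (f a) (val i r) (val e r) \<circ> f = store r a (val i r) (val e r)"
    using store_comp[OF assms(2)] Write by metis
  moreover have "store s (f a) (val i r) (val e r) b = s b" if "b \<notin> range f" for b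
    using that by (auto simp: store_def)
  ultimately show ?case by blast
next
  case (Flip a i r b)
  have "exec (ren f (Flip a i)) s [b] (1 + cost i r) (store s (f a) (val i r) (of_bool b))"
    using exec.Flip[of "f a" "ren_expr f i" s b] Flip by (simp add: val_ren cost_ren)
  moreover have "store s (f a) (val i r) (of_bool b) \<circ> f = store r a (val i r) (of_bool b)"
    using store_comp[OF assms(2)] Flip by metis
  moreover have "store s (f a) (val i r) (of_bool b) x = s x" if "x \<notin> range f" for x
    using that by (auto simp: store_def)
  ultimately show ?case by blast
next
  case (Seq c r v t r' d w u r'')
  from Seq.IH(1)[OF Seq.prems] obtain s' where
    s': "exec (ren f c) s v t s'" "s' \<circ> f = r'" "\<forall>b. b \<notin> range f \<longrightarrow> s' b = s b" by blast
  from Seq.IH(2)[OF s'(2)] obtain s'' where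
    "exec (ren f d) s' w u s''" "s'' \<circ> f = r''" "\<forall>b. b \<notin> range f \<longrightarrow> s'' b = s' b" by blast
  with s' show ?case by (intro exI[of _ s'']) (auto intro: exec.Seq)
next
  case (IfTrue e r c w t r' d)
  from IfTrue.IH[OF IfTrue.prems] obtain s' where
    "exec (ren f c) s w t s'" "s' \<circ> f = r'" "\<forall>b. b \<notin> range f \<longrightarrow> s' b = s b" by blast
  then show ?case using IfTrue.hyps IfTrue.prems
      exec.IfTrue[of "ren_expr f e" s "ren f c" w t s' "ren f d"]
    by (intro exI[of _ s']) (auto simp: val_ren cost_ren o_def)
next
  case (IfFalse e r d w t r' c)
  from IfFalse.IH[OF IfFalse.prems] obtain s' where
    "exec (ren f d) s w t s'" "s' \<circ> f = r'" "\<forall>b. b \<notin> range f \<longrightarrow> s' b = s b" by blast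
  then show ?case using IfFalse.hyps IfFalse.prems
      exec.IfFalse[of "ren_expr f e" s "ren f d" w t s' "ren f c"]
    by (intro exI[of _ s']) (auto simp: val_ren cost_ren o_def)
next
  case (WhileFalse e r c)
  then show ?case using exec.WhileFalse[of "ren_expr f e" s "ren f c"]
    by (intro exI[of _ s]) (auto simp: val_ren cost_ren o_def)
next
  case (WhileTrue e r c v t r' w u r'')
  from WhileTrue.IH(1)[OF WhileTrue.prems] obtain s' where
    s': "exec (ren f c) s v t s'" "s' \<circ> f = r'" "\<forall>b. b \<notin> range f \<longrightarrow> s' b = s b" by blast
  from WhileTrue.IH(2)[OF s'(2)] obtain s'' where
    s'': "exec (ren f (While e c)) s' w u s''" "s'' \<circ> f = r''" "\<forall>b. b \<notin> range f \<longrightarrow> s'' b = s' b"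
    by blast
  have "exec (ren f (While e c)) s (v @ w) (1 + cost e r + t + u) s''"
    using exec.WhileTrue[of "ren_expr f e" s "ren f c" v t s' w u s''] s' s'' WhileTrue.hyps
      WhileTrue.prems by (simp add: val_ren cost_ren)
  with s' s'' show ?case by (intro exI[of _ s'']) auto
qed

section \<open>Time bounds for runs without coin tosses\<close>

definition runs :: "prog \<Rightarrow> mem \<Rightarrow> nat \<Rightarrow> (mem \<Rightarrow> bool) \<Rightarrow> bool" where
  "runs c s T Q \<longleftrightarrow> (\<exists>t s'. exec c s [] t s' \<and> t \<le> T \<and> Q s')"

text \<open>A loop is counted as a single pass; the number of iterations enters the time bounds as a
  separate factor.\<close>

fun pweight :: "prog \<Rightarrow> nat" where
  "pweight (Write a i e) = 1 + weight i + weight e"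
| "pweight (Flip a i) = 1 + weight i"
| "pweight (Seq c d) = pweight c + pweight d"
| "pweight (If e c d) = 1 + weight e + pweight c + pweight d"
| "pweight (While e c) = 1 + weight e + pweight c"

lemma runs_mono: "runs c s T Q \<Longrightarrow> T \<le> U \<Longrightarrow> (\<And>s'. Q s' \<Longrightarrow> R s') \<Longrightarrow> runs c s U R"
  unfolding runs_def by (meson le_trans)

lemma runs_Seq:
  assumes "runs c s T (\<lambda>s'. runs d s' U Q)"
  shows "runs (Seq c d) s (T + U) Q"
proof -
  from assms obtain t s' u s'' where "exec c s [] t s'" "t \<le> T" "exec d s' [] u s''" "u \<le> U" "Q s''"
    unfolding runs_def by blast
  then show ?thesis unfolding runs_def using exec.Seq[of c s "[]" t s' d "[]" u s'']
    by (intro exI[of _ "t + u"] exI[of _ s'']) auto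
qed

lemma runs_Write_weight:
  assumes "cells_within B s" "Q (store s a (val i s) (val e s))"
  shows "runs (Write a i e) s (pweight (Write a i e) * B) Q"
proof -
  have "1 \<le> B" using assms(1) by (simp add: cells_within_def)
  then have "1 + cost i s + cost e s \<le> pweight (Write a i e) * B"
    using cost_le_weight[OF assms(1), of i] cost_le_weight[OF assms(1), of e]
    by (simp add: algebra_simps)
  then show ?thesis unfolding runs_def using exec.Write assms(2) by blast
qed

lemma runs_Seq_weight:
  assumes "runs c s (pweight c * B) (\<lambda>s'. runs d s' (pweight d * B) Q)"
  shows "runs (Seq c d) s (pweight (Seq c d) * B) Q"
  using runs_Seq[OF assms] by (simp add: algebra_simps)

lemma runs_If:
  assumes "0 < val e s \<Longrightarrow> runs c s T Q" "\<not> 0 < val e s \<Longrightarrow> runs d s T Q"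
  shows "runs (If e c d) s (1 + cost e s + T) Q"
proof (cases "0 < val e s")
  case True
  with assms obtain t s' where "exec c s [] t s'" "t \<le> T" "Q s'" unfolding runs_def by blast
  then show ?thesis unfolding runs_def using exec.IfTrue[OF True, of c "[]" t s' d]
    by (intro exI[of _ "1 + cost e s + t"] exI[of _ s']) auto
next
  case False
  with assms obtain t s' where "exec d s [] t s'" "t \<le> T" "Q s'" unfolding runs_def by blast
  then show ?thesis unfolding runs_def using exec.IfFalse[OF False, of d "[]" t s' c]
    by (intro exI[of _ "1 + cost e s + t"] exI[of _ s']) auto
qed

lemma runs_If_weight:
  assumes "cells_within B s" "0 < val e s \<Longrightarrow> runs c s (pweight c * B) Q"
    "\<not> 0 < val e s \<Longrightarrow> runs d s (pweight d * B) Q"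
  shows "runs (If e c d) s (pweight (If e c d) * B) Q"
proof -
  have "1 \<le> B" using assms(1) by (simp add: cells_within_def)
  then have "1 + cost e s + (pweight c * B + pweight d * B) \<le> pweight (If e c d) * B"
    using cost_le_weight[OF assms(1), of e] by (simp add: algebra_simps)
  moreover have "runs (If e c d) s (1 + cost e s + (pweight c * B + pweight d * B)) Q"
    by (rule runs_If) (auto intro: runs_mono assms(2,3))
  ultimately show ?thesis by (auto intro: runs_mono)
qed

text \<open>The invariant is indexed by the number of completed iterations, which is known in
  advance for all loops of the reduction. The guard is evaluated once more than the body.\<close>

lemma runs_While:
  assumes start: "I 0 s"
    and step: "\<And>i s. i < m \<Longrightarrow> I i s \<Longrightarrow> 0 < val g s \<and> runs c s T (I (Suc i))"
    and stop: "\<And>s. I m s \<Longrightarrow> \<not> 0 < val g s"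
    and guard: "\<And>i s. i \<le> m \<Longrightarrow> I i s \<Longrightarrow> cost g s \<le> G"
  shows "runs (While g c) s ((m + 1) * (1 + G) + m * T) (I m)"
proof -
  have "runs (While g c) s ((k + 1) * (1 + G) + k * T) (I m)" if "I (m - k) s" "k \<le> m" for k s
    using that
  proof (induction k arbitrary: s)
    case 0
    have "exec (While g c) s [] (1 + cost g s) s" using stop[of s] 0 exec.WhileFalse[of g s c] by simp
    moreover have "1 + cost g s \<le> 1 + G" using guard[of m s] 0 by simp
    ultimately show ?case unfolding runs_def using 0 by auto
  next
    case (Suc k)
    have *: "0 < val g s" "runs c s T (I (m - k))"
      using step[of "m - Suc k" s] Suc.prems by (auto simp: Suc_diff_Suc)
    then obtain t s' where s': "exec c s [] t s'" "t \<le> T" "I (m - k) s'" unfolding runs_def by blast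
    from Suc.IH[OF s'(3)] Suc.prems obtain u s'' where
      s'': "exec (While g c) s' [] u s''" "u \<le> (k + 1) * (1 + G) + k * T" "I m s''"
      unfolding runs_def by auto
    have "exec (While g c) s [] (1 + cost g s + t + u) s''"
      using exec.WhileTrue[OF *(1) s'(1) s''(1)] by simp
    moreover have "cost g s \<le> G" using guard[OF _ Suc.prems(1)] by simp
    then have "1 + cost g s + t + u \<le> (Suc k + 1) * (1 + G) + Suc k * T"
      using s'(2) s''(2) by (simp add: algebra_simps)
    ultimately show ?case unfolding runs_def using s'' by blast
  qed
  from this[of m s] start show ?thesis by simp
qed

subsection \<open>The reduction as a program\<close>

text \<open>For n > 0 the largest h with 2 h < n. Distances up to h never produce a pair of vertices
  twice; for even n this excludes the antipodal distance n / 2, which would.\<close>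

definition half :: "nat \<Rightarrow> nat" where
  "half n = (n - 1) div 2"

definition scale :: "nat \<Rightarrow> nat" where
  "scale n = floor_sqrt (half n div 324)"

abbreviation "rscale n \<equiv> real (scale n)"

lemma scale_le: "324 * (scale n)\<^sup>2 \<le> half n"
proof -
  have "(scale n)\<^sup>2 \<le> half n div 324" unfolding scale_def by (rule floor_sqrt_power2_le)
  then show ?thesis by linarith
qed

lemma half_less_scale: "half n < 324 * (Suc (scale n))\<^sup>2"
proof -
  have "half n div 324 < (Suc (scale n))\<^sup>2" unfolding scale_def by (rule Suc_floor_sqrt_power2_gt)
  then show ?thesis by linarith
qed

lemma scale_pos: "649 \<le> n \<Longrightarrow> 0 < scale n"
  unfolding scale_def half_def by simp

lemma scale_le_self: "30 * scale n \<le> n"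
proof -
  have "30 * scale n \<le> 324 * (scale n)\<^sup>2" by (cases "scale n") (auto simp: power2_eq_square)
  also have "\<dots> \<le> n" using scale_le[of n] by (auto simp: half_def)
  finally show ?thesis .
qed

definition bit_sign :: "nat set set \<Rightarrow> nat \<Rightarrow> nat \<Rightarrow> int" where
  "bit_sign E i j = 2 * of_bool ({i, j} \<in> E) - 1"

text \<open>The result is a pair of numerator and denominator. In the lower right block, with p = r
  - n and q = c - n, the sign belongs to the vertex q mod n and the distance 1 + 99 p + q div n. As
  q div n < 99 and these distances are at most h, distinct positions get distinct pairs of
  vertices.\<close>

definition entry :: "nat \<Rightarrow> nat set set \<Rightarrow> int \<Rightarrow> nat \<Rightarrow> nat \<Rightarrow> int \<times> int" where
  "entry n E g r c =
    (if r < n then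
       if c < n then
         if (c + n - r) mod n = 0 then (4, 5)
         else if (c + n - r) mod n \<le> half n then (g * bit_sign E r c, 30 * int (scale n))
         else (0, 1)
       else (0, 1)
     else if c < n then (0, 1)
     else if r - n < (scale n)\<^sup>2 then
       (bit_sign E ((c - n) mod n) (((c - n) mod n + 1 + 99 * (r - n) + (c - n) div n) mod n), int (scale n))
     else (0, 1))"

definition rip_mat :: "nat \<Rightarrow> nat set set \<Rightarrow> int \<Rightarrow> rat mat" where
  "rip_mat n E g = mat (2 * n) (100 * n) (\<lambda>(r, c). Fract (fst (entry n E g r c)) (snd (entry n E g r c)))"

lemma bit_sign_cases: "bit_sign E i j = 1 \<or> bit_sign E i j = - 1"
  by (simp add: bit_sign_def)

lemma entry_cases:
  assumes "Z (4, 5)" "Z (0, 1)" "\<And>i j. Z (g * bit_sign E i j, 30 * int (scale n))"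
    "\<And>i j. Z (bit_sign E i j, int (scale n))"
  shows "Z (entry n E g r c)"
  using assms by (simp add: entry_def)

text \<open>The program writes the pairs as they are, so they must already have the normal form that
  \<open>enc_mat\<close> prescribes: positive denominator, lowest terms.\<close>

lemma quotient_of_entry:
  assumes "0 < scale n" "g = 1 \<or> g = - 1"
  shows "quotient_of (Fract (fst (entry n E g r c)) (snd (entry n E g r c))) = entry n E g r c"
proof -
  have "coprime (g * bit_sign E i j) z" "coprime (bit_sign E i j) z" for i j z
    using assms(2) bit_sign_cases[of E i j] by auto
  moreover have "coprime (4 :: int) 5" using coprime_add_one_right[of "4 :: int"] by simp
  ultimately show ?thesis
    using assms(1)
    by (intro entry_cases[where Z = "\<lambda>e. quotient_of (Fract (fst e) (snd e)) = e"])
      (simp_all add: quotient_of_Fract)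
qed

lemma concat_rectangle:
  "concat (map (\<lambda>i. map (f i) [0..<W]) [0..<H]) = map (\<lambda>k. f (k div W) (k mod W)) [0..<H * W]"
proof (induction H)
  case (Suc H)
  have "[0..<Suc H * W] = [0..<H * W] @ map (\<lambda>j. H * W + j) [0..<W]"
    using upt_add_eq_append[of 0 "H * W" W] map_add_upt[of "H * W" W] by (simp add: add.commute)
  moreover have "f ((H * W + j) div W) ((H * W + j) mod W) = f H j" if "j < W" for j
    using that by simp
  ultimately show ?case using Suc by simp
qed simp

lemma concat_pairs:
  "concat (map (\<lambda>k. [p k, q k]) [0..<m]) = map (\<lambda>k. if even k then p (k div 2) else q (k div 2)) [0..<2 * m]"
  by (induction m) auto

lemma enc_graph_cell:
  assumes "i < n" "j < n"
  shows "init (enc_graph n E) 0 (1 + (int i * int n + int j)) = of_bool ({i, j} \<in> E)"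
proof -
  have lt: "i * n + j < n * n"
  proof -
    have "i * n + j < Suc i * n" using assms(2) by simp
    also have "\<dots> \<le> n * n" using assms(1) by (intro mult_le_mono1) simp
    finally show ?thesis .
  qed
  have enc: "enc_graph n E = int n # map (\<lambda>k. of_bool ({k div n, k mod n} \<in> E)) [0..<n * n]"
    unfolding enc_graph_def using concat_rectangle[of "\<lambda>i j. of_bool ({i, j} \<in> E)" n n] by simp
  have "nat (1 + (int i * int n + int j)) = Suc (i * n + j)"
    by (simp add: nat_eq_iff)
  moreover have "(i * n + j) div n = i" "(i * n + j) mod n = j" using assms by auto
  ultimately show ?thesis unfolding init_def enc using lt by simp
qed

lemma enc_graph_head: "init (enc_graph n E) 0 0 = int n"
  by (simp add: init_def enc_graph_def)

lemma enc_graph_bits: "bits (init (enc_graph n E) a i) \<le> 1 + n"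
proof -
  have "init (enc_graph n E) a i \<in> insert 0 (set (enc_graph n E))"
    unfolding init_def by (auto simp del: nth_mem intro!: nth_mem)
  moreover have "bits x \<le> 1 + n" if "x \<in> insert 0 (set (enc_graph n E))" for x
    using that bits_le_abs[of x] unfolding enc_graph_def by (auto simp: split: if_splits)
  ultimately show ?thesis by blast
qed

lemma enc_rip_mat:
  assumes "0 < scale n" "g = 1 \<or> g = - 1"
  shows "enc_mat n (rip_mat n E g) = int n # int (2 * n) # int (100 * n) #
    map (\<lambda>k. if even k then fst (entry n E g (k div 2 div (100 * n)) (k div 2 mod (100 * n)))
      else snd (entry n E g (k div 2 div (100 * n)) (k div 2 mod (100 * n)))) [0..<400 * n\<^sup>2]"
proof -
  define e where "e = entry n E g"
  have d: "dim_row (rip_mat n E g) = 2 * n" "dim_col (rip_mat n E g) = 100 * n"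
    unfolding rip_mat_def by auto
  have "concat (map (\<lambda>i. map (\<lambda>j. [fst (quotient_of (rip_mat n E g $$ (i, j))), snd (quotient_of (rip_mat n E g $$ (i, j)))])
      [0..<100 * n]) [0..<2 * n])
    = concat (map (\<lambda>i. map (\<lambda>j. [fst (e i j), snd (e i j)]) [0..<100 * n]) [0..<2 * n])"
    by (intro arg_cong[where f = concat] map_cong refl)
       (simp add: rip_mat_def quotient_of_entry[OF assms] e_def)
  also have "\<dots> = map (\<lambda>k. [fst (e (k div (100 * n)) (k mod (100 * n))), snd (e (k div (100 * n)) (k mod (100 * n)))])
      [0..<2 * n * (100 * n)]"
    by (rule concat_rectangle)
  finally show ?thesis
    unfolding enc_mat_def d e_def
    by (simp add: concat_pairs power2_eq_square)
qed

text \<open>Array 4 holds the scale and a loop counter. The two copies of the given program use the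
  arrays congruent to 2 and to 0 modulo 3, starting at arrays 2 and 3.\<close>

abbreviation "nE \<equiv> Read 0 (Const 0)"
abbreviation "vE \<equiv> Read 4 (Const 0)"
abbreviation "kE \<equiv> Read 4 (Const 1)"
abbreviation "modE x y \<equiv> Sub x (Mul (Div x y) y)"

definition "halfE = Div (Sub nE (Const 1)) (Const 2)"
definition "rowE = Div kE (Mul (Const 100) nE)"
definition "colE = modE kE (Mul (Const 100) nE)"
definition "gapE = modE (Sub (Add colE nE) rowE) nE"
definition "startE = modE (Sub colE nE) nE"
definition "endE = modE (Add (Add (Add startE (Const 1)) (Mul (Const 99) (Sub rowE nE))) (Div (Sub colE nE) nE)) nE"
definition "signE i j = Sub (Mul (Const 2) (Read 0 (Add (Const 1) (Add (Mul i nE) j)))) (Const 1)"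

definition put :: "nat \<Rightarrow> expr \<Rightarrow> expr \<Rightarrow> prog" where
  "put b x y = Seq (Write b (Add (Const 3) (Mul (Const 2) kE)) x) (Write b (Add (Const 4) (Mul (Const 2) kE)) y)"

text \<open>Guards only test positivity: x \<le> y becomes 0 < y + 1 - x, and the diagonal, where
  the gap is 0, is the else branch of the test on the gap.\<close>

definition put_entry :: "nat \<Rightarrow> int \<Rightarrow> prog" where
  "put_entry b g =
    If (Sub nE rowE)
      (If (Sub nE colE)
        (If gapE
          (If (Sub (Add halfE (Const 1)) gapE)
            (put b (Mul (Const g) (signE rowE colE)) (Mul (Const 30) vE))
            (put b (Const 0) (Const 1)))
          (put b (Const 4) (Const 5)))
        (put b (Const 0) (Const 1)))
      (If (Sub nE colE)
        (put b (Const 0) (Const 1))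
        (If (Sub (Mul vE vE) (Sub rowE nE))
          (put b (signE startE endE) vE)
          (put b (Const 0) (Const 1))))"

text \<open>Bounds both the bit length of the cells and the number of loop iterations. Bit lengths
  are estimated by absolute values; so crude a polynomial bound suffices because the graph itself
  occupies n^2 cells.\<close>

definition entryB :: "nat \<Rightarrow> nat" where
  "entryB n = 200 * n\<^sup>2 + n + 5"

definition graph_mem :: "nat \<Rightarrow> nat set set \<Rightarrow> nat \<Rightarrow> mem \<Rightarrow> bool" where
  "graph_mem n E k s \<longleftrightarrow> s 0 = init (enc_graph n E) 0 \<and>
    s 4 = (\<lambda>i. if i = 0 then int (scale n) else if i = 1 then int k else 0) \<and>
    cells_within (entryB n) s"

text \<open>The second value is evaluated after the first has been stored in array b, which is why y
  must be insensitive to changes of that array.\<close>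

lemma runs_put:
  assumes "cells_within B s" "b \<noteq> 4" "s 4 1 = int k" "e = (val x s, val y s)"
    "\<And>i z. val y (store s b i z) = val y s" "bits (val x s) \<le> B"
  shows "runs (put b x y) s (pweight (put b x y) * B)
    (\<lambda>s'. s' = store (store s b (3 + 2 * int k) (fst e)) b (4 + 2 * int k) (snd e))"
  unfolding put_def
proof (rule runs_Seq_weight, rule runs_Write_weight[OF assms(1)], rule runs_Write_weight)
  show "cells_within B (store s b (val (Add (Const 3) (Mul (Const 2) kE)) s) (val x s))"
    using assms(1,6) by (auto simp: cells_within_def store_def)
  have "store s b i z 4 1 = int k" for i z using assms(2,3) by (simp add: store_def)
  then show "store (store s b (val (Add (Const 3) (Mul (Const 2) kE)) s) (val x s)) b
     (val (Add (Const 4) (Mul (Const 2) kE)) (store s b (val (Add (Const 3) (Mul (Const 2) kE)) s) (val x s)))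
     (val y (store s b (val (Add (Const 3) (Mul (Const 2) kE)) s) (val x s))) =
    store (store s b (3 + 2 * int k) (fst e)) b (4 + 2 * int k) (snd e)"
    using assms(3,4,5) by simp
qed

lemma runs_put_entry:
  assumes s: "graph_mem n E k s" and k: "k < 200 * n\<^sup>2" and b: "b \<noteq> 0" "b \<noteq> 4"
    and g: "g = 1 \<or> g = - 1"
  shows "runs (put_entry b g) s (pweight (put_entry b g) * entryB n)
    (\<lambda>s'. s' = store (store s b (3 + 2 * int k) (fst (entry n E g (k div (100 * n)) (k mod (100 * n)))))
      b (4 + 2 * int k) (snd (entry n E g (k div (100 * n)) (k mod (100 * n)))))"
proof -
  define r c where "r = k div (100 * n)" and "c = k mod (100 * n)"
  have s0: "s 0 = init (enc_graph n E) 0" and s4: "s 4 0 = int (scale n)" "s 4 1 = int k"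
    and cw: "cells_within (entryB n) s" using s by (auto simp: graph_mem_def)
  have n: "0 < n" using k by (cases n) auto
  have vn: "val nE s = int n" by (simp add: s0 enc_graph_head)
  have vr: "val rowE s = int r" using vn s4 by (simp add: rowE_def r_def zdiv_int)
  have vc: "val colE s = int c" using vn s4 by (simp add: colE_def c_def zmod_int minus_div_mult_eq_mod)
  have vh: "val halfE s = int (half n)" using vn n by (simp add: halfE_def half_def zdiv_int of_nat_diff)
  have vgap: "val gapE s = int ((c + n - r) mod n)" if "r < n"
    using vn vr vc that by (simp add: gapE_def minus_div_mult_eq_mod zmod_int of_nat_diff)
  have vsign: "val (signE i j) s = bit_sign E a a'" if "val i s = int a" "val j s = int a'" "a < n" "a' < n"
    for i j a a'
    using that vn enc_graph_cell[of a n a' E] by (simp add: signE_def s0 bit_sign_def)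
  have vstart: "val startE s = int ((c - n) mod n)" if "n \<le> c"
    using vn vc that by (simp add: startE_def minus_div_mult_eq_mod zmod_int of_nat_diff)
  have vend: "val endE s = int (((c - n) mod n + 1 + 99 * (r - n) + (c - n) div n) mod n)"
    if "n \<le> c" "n \<le> r"
  proof -
    define q where "q = (c - n) mod n"
    have "val endE s = (val startE s + 1 + 99 * (int r - int n) + (int c - int n) div int n) mod int n"
      by (simp only: endE_def val.simps minus_div_mult_eq_mod vr vc vn[unfolded val.simps])
    also have "val startE s = int q" using vstart[OF that(1)] by (simp only: q_def)
    also have "int q + 1 + 99 * (int r - int n) + (int c - int n) div int n
        = int (q + 1 + 99 * (r - n) + (c - n) div n)"
      using that by (simp add: zdiv_int of_nat_diff)
    finally show ?thesis unfolding q_def zmod_int .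
  qed
  have y: "val (Const z) (store s b i u) = val (Const z) s" "val vE (store s b i u) = val vE s"
    "val (Mul (Const z) vE) (store s b i u) = val (Mul (Const z) vE) s" for z i u
    using b by (auto simp: store_def)
  have bit: "bits z \<le> entryB n" if "\<bar>z\<bar> \<le> 5" for z
    using bits_le_abs[of z] that unfolding entryB_def by linarith
  have gs: "\<bar>g * bit_sign E i j\<bar> \<le> 5" "\<bar>bit_sign E i j\<bar> \<le> 5" for i j
    using g bit_sign_cases[of E i j] by auto
  note P = runs_put[OF cw b(2) s4(2)]
  show ?thesis
    unfolding put_entry_def r_def[symmetric] c_def[symmetric]
  proof (intro runs_If_weight[OF cw] P y bit)
    assume "0 < val (Sub nE rowE) s"
    then have r: "r < n" using vn vr by simp
    {
      assume "0 < val (Sub nE colE) s"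
      then have c: "c < n" using vn vc by simp
      {
        assume "0 < val gapE s"
        then have gap: "(c + n - r) mod n \<noteq> 0" using vgap[OF r] by simp
        {
          assume "0 < val (Sub (Add halfE (Const 1)) gapE) s"
          then have "(c + n - r) mod n \<le> half n" using vgap[OF r] vh by simp
          then show "entry n E g r c = (val (Mul (Const g) (signE rowE colE)) s, val (Mul (Const 30) vE) s)"
            using r c gap s4 vsign[OF vr vc r c] by (simp add: entry_def)
          show "\<bar>val (Mul (Const g) (signE rowE colE)) s\<bar> \<le> 5"
            using vsign[OF vr vc r c] gs by simp
        next
          assume "\<not> 0 < val (Sub (Add halfE (Const 1)) gapE) s"
          then have "\<not> (c + n - r) mod n \<le> half n" using vgap[OF r] vh by simp
          then show "entry n E g r c = (val (Const 0) s, val (Const 1) s)"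
            using r c gap by (simp add: entry_def)
        }
      next
        assume "\<not> 0 < val gapE s"
        then have gap: "(c + n - r) mod n = 0" using vgap[OF r] by simp
        then show "entry n E g r c = (val (Const 4) s, val (Const 5) s)"
          using r c gap by (simp add: entry_def)
      }
    next
      assume "\<not> 0 < val (Sub nE colE) s"
      then have c: "\<not> c < n" using vn vc by simp
      then show "entry n E g r c = (val (Const 0) s, val (Const 1) s)" using r by (simp add: entry_def)
    }
  next
    assume "\<not> 0 < val (Sub nE rowE) s"
    then have r: "\<not> r < n" using vn vr by simp
    {
      assume "0 < val (Sub nE colE) s"
      then have c: "c < n" using vn vc by simp
      then show "entry n E g r c = (val (Const 0) s, val (Const 1) s)" using r by (simp add: entry_def)
    next
      assume "\<not> 0 < val (Sub nE colE) s"
      then have c: "\<not> c < n" using vn vc by simp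
      have sg: "val (signE startE endE) s =
        bit_sign E ((c - n) mod n) (((c - n) mod n + 1 + 99 * (r - n) + (c - n) div n) mod n)"
        using vsign[OF vstart vend] r c n by simp
      {
        assume "0 < val (Sub (Mul vE vE) (Sub rowE nE)) s"
        then have "int (r - n) < int ((scale n)\<^sup>2)" using vn vr s4 r by (simp add: power2_eq_square of_nat_diff)
        then have "r - n < (scale n)\<^sup>2" by (simp only: of_nat_less_iff)
        then show "entry n E g r c = (val (signE startE endE) s, val vE s)"
          using r c s4 sg by (simp add: entry_def)
        show "\<bar>val (signE startE endE) s\<bar> \<le> 5" using sg gs by simp
      next
        assume "\<not> 0 < val (Sub (Mul vE vE) (Sub rowE nE)) s"
        then have "\<not> int (r - n) < int ((scale n)\<^sup>2)" using vn vr s4 r by (simp add: power2_eq_square of_nat_diff)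
        then have "\<not> r - n < (scale n)\<^sup>2" using of_nat_less_iff by blast
        then show "entry n E g r c = (val (Const 0) s, val (Const 1) s)" using r c by (simp add: entry_def)
      }
    }
  qed simp_all
qed

text \<open>The counter is reset because both matrices are written with the same scratch
  array.\<close>

definition fill :: "nat \<Rightarrow> int \<Rightarrow> prog" where
  "fill b g =
    Seq (Write 4 (Const 1) (Const 0))
      (Seq (Write b (Const 0) nE)
        (Seq (Write b (Const 1) (Mul (Const 2) nE))
          (Seq (Write b (Const 2) (Mul (Const 100) nE))
            (While (Sub (Mul (Const 200) (Mul nE nE)) kE)
              (Seq (put_entry b g) (Write 4 (Const 1) (Add kE (Const 1))))))))"

text \<open>The array after k entries: 3 header cells, then 2 cells per entry. Negative addresses
  pass the test, as \<open>nat i\<close> is 0 there, but \<open>init\<close> vanishes at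
  them.\<close>

definition mat_mem :: "nat \<Rightarrow> nat set set \<Rightarrow> int \<Rightarrow> nat \<Rightarrow> int \<Rightarrow> int" where
  "mat_mem n E g k i = (if nat i < 3 + 2 * k then init (enc_mat n (rip_mat n E g)) 0 i else 0)"

lemma nth_tail3: "(a # b # c # xs) ! (3 + m) = xs ! m"
  by (simp add: numeral_3_eq_3)

lemma mat_mem_step:
  assumes "0 < scale n" "g = 1 \<or> g = - 1" "k < 200 * n\<^sup>2"
  shows "mat_mem n E g (Suc k) = (mat_mem n E g k)
    (3 + 2 * int k := fst (entry n E g (k div (100 * n)) (k mod (100 * n))),
     4 + 2 * int k := snd (entry n E g (k div (100 * n)) (k mod (100 * n))))"
proof
  fix i :: int
  have len: "length (enc_mat n (rip_mat n E g)) = 3 + 400 * n\<^sup>2" by (simp add: enc_rip_mat[OF assms(1,2)])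
  consider "i < 0" | "0 \<le> i" "nat i < 3 + 2 * k" | "i = 3 + 2 * int k" | "i = 4 + 2 * int k" | "0 \<le> i" "5 + 2 * k \<le> nat i"
    by linarith
  then show "mat_mem n E g (Suc k) i = ((mat_mem n E g k)
    (3 + 2 * int k := fst (entry n E g (k div (100 * n)) (k mod (100 * n))),
     4 + 2 * int k := snd (entry n E g (k div (100 * n)) (k mod (100 * n))))) i"
  proof cases
    case 3
    have "enc_mat n (rip_mat n E g) ! (3 + 2 * k) = fst (entry n E g (k div (100 * n)) (k mod (100 * n)))"
      unfolding enc_rip_mat[OF assms(1,2)] nth_tail3 using assms(3) by simp
    moreover have "nat i = 3 + 2 * k" using 3 by simp
    ultimately show ?thesis using 3 assms(3) by (simp add: mat_mem_def init_def len)
  next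
    case 4
    have "enc_mat n (rip_mat n E g) ! (3 + Suc (2 * k)) = snd (entry n E g (k div (100 * n)) (k mod (100 * n)))"
      unfolding enc_rip_mat[OF assms(1,2)] nth_tail3 using assms(3) by simp
    moreover have "nat i = 3 + Suc (2 * k)" using 4 by simp
    ultimately show ?thesis using 4 assms(3) by (simp add: mat_mem_def init_def len)
  qed (auto simp: mat_mem_def init_def)
qed

lemma mat_mem_0:
  assumes "0 < scale n" "g = 1 \<or> g = - 1"
  shows "mat_mem n E g 0 = (\<lambda>_. 0)(0 := int n, 1 := 2 * int n, 2 := 100 * int n)"
proof
  fix i :: int
  consider "i < 0" | "i = 0" | "i = 1" | "i = 2" | "3 \<le> i" by linarith
  then show "mat_mem n E g 0 i = ((\<lambda>_. 0)(0 := int n, 1 := 2 * int n, 2 := 100 * int n)) i"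
    by cases (auto simp: mat_mem_def init_def enc_rip_mat[OF assms])
qed

lemma mat_mem_last:
  assumes "0 < scale n" "g = 1 \<or> g = - 1"
  shows "mat_mem n E g (200 * n\<^sup>2) = init (enc_mat n (rip_mat n E g)) 0"
  by (rule ext) (auto simp: mat_mem_def init_def enc_rip_mat[OF assms])

lemma entry_bits:
  assumes "g = 1 \<or> g = - 1"
  shows "bits (fst (entry n E g r c)) \<le> entryB n" "bits (snd (entry n E g r c)) \<le> entryB n"
proof -
  have "30 * int (scale n) \<le> int n" using scale_le_self[of n] by simp
  moreover have "\<bar>bit_sign E i j\<bar> \<le> int (n + 5)" "\<bar>g * bit_sign E i j\<bar> \<le> int (n + 5)" for i j
    using assms bit_sign_cases[of E i j] by auto
  ultimately have "\<bar>fst (entry n E g r c)\<bar> \<le> int (n + 5) \<and> \<bar>snd (entry n E g r c)\<bar> \<le> int (n + 5)"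
    by (intro entry_cases[where Z = "\<lambda>e. \<bar>fst e\<bar> \<le> int (n + 5) \<and> \<bar>snd e\<bar> \<le> int (n + 5)"])
      simp_all
  then show "bits (fst (entry n E g r c)) \<le> entryB n" "bits (snd (entry n E g r c)) \<le> entryB n"
    using bits_le_abs[of "fst (entry n E g r c)"] bits_le_abs[of "snd (entry n E g r c)"]
    unfolding entryB_def by linarith+
qed

lemma entryB_bits: "\<bar>z\<bar> \<le> 200 * (int n)\<^sup>2 + int n + 5 \<Longrightarrow> bits z \<le> entryB n"
proof -
  assume z: "\<bar>z\<bar> \<le> 200 * (int n)\<^sup>2 + int n + 5"
  have "nat \<bar>z\<bar> \<le> entryB n" using z unfolding entryB_def
    by (simp add: nat_le_iff)
  then show ?thesis using bits_le_abs[of z] by linarith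
qed

lemma cells_within_store:
  "cells_within B s \<Longrightarrow> bits z \<le> B \<Longrightarrow> cells_within B (store s a i z)"
  by (auto simp: cells_within_def store_def)

definition filled :: "nat \<Rightarrow> nat set set \<Rightarrow> nat \<Rightarrow> int \<Rightarrow> mem \<Rightarrow> mem \<Rightarrow> bool" where
  "filled n E b g s s' \<longleftrightarrow>
    s' 4 = (\<lambda>i. if i = 0 then int (scale n) else if i = 1 then int (200 * n\<^sup>2) else 0) \<and>
    s' b = init (enc_mat n (rip_mat n E g)) 0 \<and> (\<forall>a. a \<noteq> 4 \<longrightarrow> a \<noteq> b \<longrightarrow> s' a = s a) \<and>
    cells_within (entryB n) s'"

text \<open>One factor \<open>entryB n\<close> of the time bound is for the number of iterations,
  the other for the cost of a single one.\<close>

lemma runs_fill: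
  assumes g: "g = 1 \<or> g = - 1" and b: "b \<noteq> 0" "b \<noteq> 4" and v: "0 < scale n"
    and s: "s 0 = init (enc_graph n E) 0" "s 4 = (\<lambda>i. if i = 0 then int (scale n) else if i = 1 then z else 0)"
      "s b = (\<lambda>_. 0)" "cells_within (entryB n) s"
  shows "runs (fill b g) s (pweight (fill b g) * (entryB n)\<^sup>2)
    (filled n E b g s)"
proof -
  define m where "m = 200 * n\<^sup>2"
  define B where "B = entryB n"
  define Inv where "Inv k s' \<longleftrightarrow> graph_mem n E k s' \<and> s' b = mat_mem n E g k \<and>
    (\<forall>a. a \<noteq> 4 \<longrightarrow> a \<noteq> b \<longrightarrow> s' a = s a)" for k s'
  define guard where "guard = Sub (Mul (Const 200) (Mul nE nE)) kE"
  define next_k where "next_k = Write 4 (Const 1) (Add kE (Const 1))"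
  define loop where "loop = While guard (Seq (put_entry b g) next_k)"
  have cw: "cells_within B s" using s(4) by (simp add: B_def)
  have small: "bits 0 \<le> B" "bits (int n) \<le> B" "bits (2 * int n) \<le> B" "bits (100 * int n) \<le> B"
    unfolding B_def by (rule entryB_bits; simp add: power2_eq_square; cases n; simp add: algebra_simps)+
  have mB: "m + 1 \<le> B" and B1: "1 \<le> B" unfolding m_def B_def entryB_def by auto
  have guard_val: "val guard s' = int m - int k" if "Inv k s'" for k s'
    using that enc_graph_head[of n E] by (simp add: guard_def Inv_def graph_mem_def m_def power2_eq_square)
  have loop: "runs loop s' ((m + 1) * (1 + weight guard * B) + m * (pweight (Seq (put_entry b g) next_k) * B)) (Inv m)"
    if "Inv 0 s'" for s'
    unfolding loop_def
  proof (rule runs_While[where I = Inv and m = m, OF that])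
    show "\<not> 0 < val guard s'" if "Inv m s'" for s' using guard_val[OF that] by simp
    show "cost guard s' \<le> weight guard * B" if "Inv i s'" for i s'
      using that by (intro cost_le_weight) (simp add: Inv_def graph_mem_def B_def)
    fix k s' assume k: "k < m" and I: "Inv k s'"
    have gm: "graph_mem n E k s'" using I by (simp add: Inv_def)
    define e where "e = entry n E g (k div (100 * n)) (k mod (100 * n))"
    show "0 < val guard s' \<and> runs (Seq (put_entry b g) next_k) s' (pweight (Seq (put_entry b g) next_k) * B) (Inv (Suc k))"
    proof
      show "0 < val guard s'" using guard_val[OF I] k by simp
      show "runs (Seq (put_entry b g) next_k) s' (pweight (Seq (put_entry b g) next_k) * B) (Inv (Suc k))"
        unfolding B_def
      proof (rule runs_Seq_weight, rule runs_mono[OF runs_put_entry[OF gm _ b g]])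
        fix s'' assume s'': "s'' = store (store s' b (3 + 2 * int k) (fst (entry n E g (k div (100 * n)) (k mod (100 * n)))))
          b (4 + 2 * int k) (snd (entry n E g (k div (100 * n)) (k mod (100 * n))))"
        have cw': "cells_within (entryB n) s''"
          unfolding s'' using gm by (intro cells_within_store entry_bits[OF g]) (simp add: graph_mem_def)
        have k'': "s'' 4 1 = int k" "s'' 4 0 = int (scale n)" using gm b by (auto simp: s'' store_def graph_mem_def)
        show "runs next_k s'' (pweight next_k * entryB n) (Inv (Suc k))"
          unfolding next_k_def
        proof (rule runs_Write_weight[OF cw'])
          have "bits (int k + 1) \<le> entryB n" using k unfolding m_def
            by (intro entryB_bits) (simp flip: of_nat_power of_nat_mult)
          then have cwt: "cells_within (entryB n) (store s'' 4 1 (int k + 1))"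
            by (intro cells_within_store cw')
          have sb: "s'' b = mat_mem n E g (Suc k)"
            unfolding s'' mat_mem_step[OF v g k[unfolded m_def]] using I by (simp add: store_def Inv_def)
          have sa: "s'' a = s' a" if "a \<noteq> b" for a using that by (simp add: s'' store_def)
          have "store s'' 4 1 (int k + 1) a = s' a" if "a \<noteq> 4" "a \<noteq> b" for a
            using that sa by (simp add: store_def)
          moreover have "store s'' 4 1 (int k + 1) b = mat_mem n E g (Suc k)"
            using b sb by (simp add: store_def)
          moreover have "store s'' 4 1 (int k + 1) 4 = (\<lambda>i. if i = 0 then int (scale n) else if i = 1 then int (Suc k) else 0)"
            using I b sa[of 4] by (auto simp: store_def Inv_def graph_mem_def)
          moreover have "val (Const 1) s'' = 1" "val (Add kE (Const 1)) s'' = int k + 1" using k'' by simp_all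
          ultimately show "Inv (Suc k) (store s'' 4 (val (Const 1) s'') (val (Add kE (Const 1)) s''))"
            using I b cwt s(1) unfolding Inv_def graph_mem_def by simp
        qed
      qed (use k in \<open>simp_all add: m_def\<close>)
    qed
  qed
  define s1 where "s1 = store s 4 1 0"
  define s2 where "s2 = store s1 b 0 (int n)"
  define s3 where "s3 = store s2 b 1 (2 * int n)"
  define s4 where "s4 = store s3 b 2 (100 * int n)"
  have c1: "cells_within B s1" unfolding s1_def by (intro cells_within_store cw small)
  have c2: "cells_within B s2" unfolding s2_def by (intro cells_within_store c1 small)
  have c3: "cells_within B s3" unfolding s3_def by (intro cells_within_store c2 small)
  have c4: "cells_within B s4" unfolding s4_def by (intro cells_within_store c3 small)
  have v1: "s1 0 0 = int n" "s2 0 0 = int n" "s3 0 0 = int n"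
    using b s(1) by (auto simp: s1_def s2_def s3_def store_def enc_graph_head)
  have I0: "Inv 0 s4"
  proof -
    have "s4 a = s a" if "a \<noteq> 4" "a \<noteq> b" for a
      using that by (simp add: s1_def s2_def s3_def s4_def store_def)
    moreover have "s4 4 = (\<lambda>i. if i = 0 then int (scale n) else if i = 1 then int 0 else 0)"
      using b s(2) by (simp add: s1_def s2_def s3_def s4_def store_def fun_eq_iff)
    moreover have "s4 b = mat_mem n E g 0"
      using b s(3) by (simp add: s1_def s2_def s3_def s4_def store_def mat_mem_0[OF v g])
    ultimately show ?thesis
      using b s(1) c4 unfolding Inv_def graph_mem_def B_def by simp
  qed
  define T where "T = (m + 1) * (1 + weight guard * B) + m * (pweight (Seq (put_entry b g) next_k) * B)"
  define w where "w = pweight (Write 4 (Const 1) (Const 0)) + (pweight (Write b (Const 0) nE) +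
    (pweight (Write b (Const 1) (Mul (Const 2) nE)) + pweight (Write b (Const 2) (Mul (Const 100) nE))))"
  have "runs (fill b g) s (pweight (Write 4 (Const 1) (Const 0)) * B + (pweight (Write b (Const 0) nE) * B +
     (pweight (Write b (Const 1) (Mul (Const 2) nE)) * B + (pweight (Write b (Const 2) (Mul (Const 100) nE)) * B + T))))
     (Inv m)"
    unfolding fill_def guard_def[symmetric] next_k_def[symmetric] loop_def[symmetric]
    apply (rule runs_Seq, rule runs_Write_weight[OF cw])
    apply (rule runs_Seq, simp only: val.simps s1_def[symmetric], rule runs_Write_weight[OF c1])
    apply (rule runs_Seq, simp only: val.simps v1 s2_def[symmetric], rule runs_Write_weight[OF c2])
    apply (rule runs_Seq, simp only: val.simps v1 s3_def[symmetric], rule runs_Write_weight[OF c3])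
    apply (simp only: val.simps v1 s4_def[symmetric], unfold T_def, rule loop[OF I0])
    done
  then show ?thesis
  proof (rule runs_mono)
    have pw: "pweight (fill b g) = w + (1 + weight guard + pweight (Seq (put_entry b g) next_k))"
      unfolding fill_def w_def guard_def next_k_def by simp
    have "w * B \<le> w * B\<^sup>2" using B1 by (simp add: power2_eq_square)
    moreover have "T \<le> B * (B + weight guard * B) + B * (pweight (Seq (put_entry b g) next_k) * B)"
      unfolding T_def using mB B1 by (intro add_mono mult_le_mono) auto
    then have "T \<le> (1 + weight guard + pweight (Seq (put_entry b g) next_k)) * B\<^sup>2"
      by (simp add: algebra_simps power2_eq_square)
    ultimately have "w * B + T \<le> w * B\<^sup>2 + (1 + weight guard + pweight (Seq (put_entry b g) next_k)) * B\<^sup>2"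
      by (rule add_mono)
    then show "pweight (Write 4 (Const 1) (Const 0)) * B + (pweight (Write b (Const 0) nE) * B +
     (pweight (Write b (Const 1) (Mul (Const 2) nE)) * B + (pweight (Write b (Const 2) (Mul (Const 100) nE)) * B + T)))
     \<le> pweight (fill b g) * (entryB n)\<^sup>2"
      unfolding pw B_def[symmetric] w_def distrib_right by (simp only: add.assoc)
    fix s' assume I: "Inv m s'"
    show "filled n E b g s s'"
      using I unfolding filled_def Inv_def graph_mem_def m_def mat_mem_last[OF v g] by blast
  qed
qed

text \<open>A linear search for the square root: the guard is positive as long as 324 (v + 1)^2
  \<le> h. This is fast enough since n is at most the size of the input.\<close>

definition root_guard :: expr where
  "root_guard = Sub (Add halfE (Const 1)) (Mul (Const 324) (Mul (Add vE (Const 1)) (Add vE (Const 1))))"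

definition root_loop :: prog where
  "root_loop = While root_guard (Write 4 (Const 0) (Add vE (Const 1)))"

lemma runs_root_loop:
  assumes n: "0 < n" and s: "s 0 = init (enc_graph n E) 0" "s 4 = (\<lambda>_. 0)" "cells_within (entryB n) s"
  shows "runs root_loop s (pweight root_loop * (entryB n)\<^sup>2)
    (\<lambda>s'. s' 4 = (\<lambda>i. if i = 0 then int (scale n) else 0) \<and>
      (\<forall>a. a \<noteq> 4 \<longrightarrow> s' a = s a) \<and> cells_within (entryB n) s')"
proof -
  define m where "m = scale n"
  define B where "B = entryB n"
  define Inv where "Inv k s' \<longleftrightarrow> s' 4 = (\<lambda>i. if i = 0 then int k else 0) \<and> (\<forall>a. a \<noteq> 4 \<longrightarrow> s' a = s a) \<and>
    cells_within B s'" for k s'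
  define step where "step = Write 4 (Const 0) (Add vE (Const 1))"
  have guard_val: "val root_guard s' = int (half n) + 1 - 324 * (int (Suc k))\<^sup>2" if "Inv k s'" for k s'
  proof -
    have "s' 0 0 = int n" "s' 4 0 = int k" using that s(1) by (auto simp: Inv_def enc_graph_head)
    then show ?thesis using n
      by (simp add: root_guard_def halfE_def half_def zdiv_int of_nat_diff power2_eq_square add.commute)
  qed
  have pos_iff: "0 < val root_guard s' \<longleftrightarrow> 324 * (Suc k)\<^sup>2 \<le> half n" if "Inv k s'" for k s'
  proof -
    have "324 * (int (Suc k))\<^sup>2 = int (324 * (Suc k)\<^sup>2)" by simp
    then have "0 < val root_guard s' \<longleftrightarrow> int (324 * (Suc k)\<^sup>2) \<le> int (half n)"
      unfolding guard_val[OF that] by presburger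
    then show ?thesis by (simp only: of_nat_le_iff)
  qed
  have mB: "m + 1 \<le> B" "1 \<le> B" using scale_le_self[of n] unfolding m_def B_def entryB_def by auto
  have "runs root_loop s ((m + 1) * (1 + weight root_guard * B) + m * (pweight step * B)) (Inv m)"
    unfolding root_loop_def step_def[symmetric]
  proof (rule runs_While[where I = Inv and m = m])
    show "Inv 0 s" using s by (auto simp: Inv_def B_def)
    show "\<not> 0 < val root_guard s'" if "Inv m s'" for s'
      using pos_iff[OF that] half_less_scale[of n] by (simp add: m_def)
    show "cost root_guard s' \<le> weight root_guard * B" if "Inv i s'" for i s'
      using that by (intro cost_le_weight) (simp add: Inv_def)
    fix k s' assume k: "k < m" and I: "Inv k s'"
    have "(Suc k)\<^sup>2 \<le> (scale n)\<^sup>2" using k unfolding m_def by (intro power_mono) auto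
    then have "324 * (Suc k)\<^sup>2 \<le> half n" by (intro order.trans[OF mult_le_mono2 scale_le])
    then have "0 < val root_guard s'" using pos_iff[OF I] by blast
    moreover have "runs step s' (pweight step * B) (Inv (Suc k))"
      unfolding step_def
    proof (rule runs_Write_weight)
      show cw: "cells_within B s'" using I by (simp add: Inv_def)
      have "bits (int k + 1) \<le> B" using k mB bits_le_abs[of "int k + 1"] by linarith
      then have "cells_within B (store s' 4 0 (int k + 1))" by (intro cells_within_store cw)
      moreover have "val (Const 0) s' = 0" "val (Add vE (Const 1)) s' = int k + 1"
        using I by (simp_all add: Inv_def)
      moreover have "store s' 4 0 (int k + 1) 4 = (\<lambda>i. if i = 0 then int (Suc k) else 0)"
        using I by (auto simp: Inv_def store_def)
      moreover have "store s' 4 0 (int k + 1) a = s a" if "a \<noteq> 4" for a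
        using I that by (simp add: Inv_def store_def)
      ultimately show "Inv (Suc k) (store s' 4 (val (Const 0) s') (val (Add vE (Const 1)) s'))"
        unfolding Inv_def by simp
    qed
    ultimately show "0 < val root_guard s' \<and> runs step s' (pweight step * B) (Inv (Suc k))" ..
  qed
  then show ?thesis
  proof (rule runs_mono)
    have "(m + 1) * (1 + weight root_guard * B) + m * (pweight step * B)
      \<le> B * (B + weight root_guard * B) + B * (pweight step * B)"
      using mB by (intro add_mono mult_le_mono) auto
    also have "\<dots> = pweight root_loop * B\<^sup>2"
      unfolding root_loop_def step_def[symmetric] pweight.simps(5)
      by (simp add: algebra_simps power2_eq_square)
    finally show "(m + 1) * (1 + weight root_guard * B) + m * (pweight step * B)
      \<le> pweight root_loop * (entryB n)\<^sup>2" unfolding B_def .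
  qed (auto simp: Inv_def m_def B_def)
qed

text \<open>The given program finds its input in array 2 or 3, where the matrices are written.
  Arrays 0, 1 and 4, which hold the graph, the answer and the scratch variables, lie outside both
  ranges.\<close>

definition first_copy :: "nat \<Rightarrow> nat" where "first_copy a = 3 * a + 2"
definition second_copy :: "nat \<Rightarrow> nat" where "second_copy a = 3 * a + 3"

lemma copies:
  "inj first_copy" "inj second_copy"
  "second_copy a \<notin> range first_copy" "first_copy a \<notin> range second_copy"
proof -
  show "inj first_copy" "inj second_copy" by (auto simp: inj_def first_copy_def second_copy_def)
  have ne: "3 * x + 3 \<noteq> 3 * y + 2" for x y :: nat by presburger
  show "second_copy a \<notin> range first_copy" using ne[of a]
    by (simp add: first_copy_def second_copy_def image_iff)
  show "first_copy a \<notin> range second_copy" using ne[of _ a, symmetric]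
    by (simp add: first_copy_def second_copy_def image_iff)
qed

text \<open>The answers are inverted: the given program says yes to a small RIP parameter, which
  speaks against a clique. A single matrix with a large parameter is enough to report a
  clique.\<close>

definition verdict :: prog where
  "verdict = If (Read (first_copy 1) (Const 0))
     (If (Read (second_copy 1) (Const 0)) (Write 1 (Const 0) (Const 0)) (Write 1 (Const 0) (Const 1)))
     (Write 1 (Const 0) (Const 1))"

text \<open>The given program is trusted from n0 on only. Answering yes below n0 is safe: cliques
  must be reported for every n, while the requirement on random graphs is a limit.\<close>

definition clique_prog :: "nat \<Rightarrow> prog \<Rightarrow> prog" where
  "clique_prog n0 c =
    If (Sub (Add nE (Const 1)) (Const (int n0)))
      (Seq root_loop (Seq (fill 2 1) (Seq (fill 3 (- 1))
        (Seq (ren first_copy c) (Seq (ren second_copy c) verdict)))))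
      (Write 1 (Const 0) (Const 1))"

lemma deterministic_clique_prog: "deterministic c \<Longrightarrow> deterministic (clique_prog n0 c)"
  by (simp add: clique_prog_def root_loop_def fill_def put_entry_def put_def verdict_def)

lemma cells_within_init: "cells_within (entryB n) (init (enc_graph n E))"
proof -
  have "bits (init (enc_graph n E) a i) \<le> entryB n" for a i
    using enc_graph_bits[of n E a i] by (simp add: entryB_def)
  then show ?thesis by (simp add: cells_within_def entryB_def)
qed

lemma runs_verdict:
  assumes "cells_within B s"
  shows "runs verdict s (pweight verdict * B)
    (\<lambda>s'. s' 1 0 = (if 0 < s (first_copy 1) 0 \<and> 0 < s (second_copy 1) 0 then 0 else 1))"
  unfolding verdict_def
proof (rule runs_If_weight[OF assms], goal_cases)
  case 1
  then show ?case
    by (intro runs_If_weight[OF assms]; intro runs_Write_weight[OF assms]; simp add: store_def)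
next
  case 2
  then show ?case by (intro runs_Write_weight[OF assms]) (simp add: store_def)
qed

lemma runs_clique_prog_small:
  assumes "n < n0"
  shows "runs (clique_prog n0 c) (init (enc_graph n E)) (pweight (clique_prog n0 c) * entryB n) yes"
  unfolding clique_prog_def
proof (rule runs_If_weight[OF cells_within_init])
  assume "0 < val (Sub (Add nE (Const 1)) (Const (int n0))) (init (enc_graph n E))"
  then show "runs (Seq root_loop (Seq (fill 2 1) (Seq (fill 3 (- 1))
        (Seq (ren first_copy c) (Seq (ren second_copy c) verdict))))) (init (enc_graph n E)) 
     (pweight (Seq root_loop (Seq (fill 2 1) (Seq (fill 3 (- 1))
        (Seq (ren first_copy c) (Seq (ren second_copy c) verdict))))) * entryB n) yes"
    using assms by (simp add: enc_graph_head)
next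
  show "runs (Write 1 (Const 0) (Const 1)) (init (enc_graph n E))
     (pweight (Write 1 (Const 0) (Const 1)) * entryB n) yes"
    by (rule runs_Write_weight[OF cells_within_init]) (simp add: yes_def store_def)
qed

text \<open>The times t1 and t2 enter twice: as time spent in the two copies, and as bit length of
  the cells that the final comparison may have to read.\<close>

lemma runs_clique_prog:
  assumes n: "n0 \<le> n" "0 < scale n"
    and c1: "exec c (init (enc_mat n (rip_mat n E 1))) [] t1 r1"
    and c2: "exec c (init (enc_mat n (rip_mat n E (- 1)))) [] t2 r2"
  shows "runs (clique_prog n0 c) (init (enc_graph n E))
    (pweight (clique_prog n0 c) * ((entryB n)\<^sup>2 + (t1 + t2)) + (t1 + t2))
    (\<lambda>s. s 1 0 = (if 0 < r1 1 0 \<and> 0 < r2 1 0 then 0 else 1))"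
proof -
  define x1 x2 where "x1 = enc_mat n (rip_mat n E 1)" and "x2 = enc_mat n (rip_mat n E (- 1))"
  note c1 = c1[folded x1_def] and c2 = c2[folded x2_def]
  define s where "s = init (enc_graph n E)"
  define B where "B = entryB n"
  define Z where "Z s \<longleftrightarrow> s 1 0 = (if 0 < r1 1 0 \<and> 0 < r2 1 0 then 0 else 1)" for s :: mem
  define copies_run where "copies_run = Seq (ren first_copy c) (Seq (ren second_copy c) verdict)"
  have n0: "0 < n" using n(2) by (cases n) (auto simp: scale_def half_def)
  have B1: "1 \<le> B" by (simp add: B_def entryB_def)
  have s_zero: "s a = (\<lambda>_. 0)" if "a \<noteq> 0" for a using that by (simp add: s_def init_def)
  \<comment> \<open>Seen through either renaming, this is an initial memory: the matrix is in array
    0 and all other arrays are still empty.\<close>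
  have final: "runs (copies_run) s3
      (t1 + (t2 + pweight verdict * (B + t1 + t2))) Z"
    if s3: "cells_within B s3" "s3 2 = init x1 0"
      "s3 3 = init x2 0"
      "\<And>a. a \<noteq> 0 \<Longrightarrow> a \<noteq> 2 \<Longrightarrow> a \<noteq> 3 \<Longrightarrow> a \<noteq> 4 \<Longrightarrow> s3 a = (\<lambda>_. 0)" for s3
  proof -
    have arr: "first_copy a \<noteq> 0" "first_copy a \<noteq> 3" "first_copy a \<noteq> 4" "second_copy a \<noteq> 0" "second_copy a \<noteq> 2" "second_copy a \<noteq> 4" for a
      unfolding first_copy_def second_copy_def by presburger+
    have i1: "s3 \<circ> first_copy = init x1"
    proof
      fix a show "(s3 \<circ> first_copy) a = init x1 a"
      proof (cases "a = 0")
        case True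
        have "first_copy 0 = 2" by (simp add: first_copy_def)
        then show ?thesis unfolding True o_def using s3(2) by (simp only:)
      next
        case False
        then have "first_copy a \<noteq> 2" by (simp add: first_copy_def)
        then show ?thesis using False s3(4)[of "first_copy a"] arr[of a] by (simp add: init_def)
      qed
    qed
    have i2: "s3 \<circ> second_copy = init x2"
    proof
      fix a show "(s3 \<circ> second_copy) a = init x2 a"
      proof (cases "a = 0")
        case True
        have "second_copy 0 = 3" by (simp add: second_copy_def)
        then show ?thesis unfolding True o_def using s3(3) by (simp only:)
      next
        case False
        then have "second_copy a \<noteq> 3" by (simp add: second_copy_def)
        then show ?thesis using False s3(4)[of "second_copy a"] arr[of a] by (simp add: init_def)
      qed
    qed
    from exec_ren[OF c1 copies(1) i1] obtain u where u: "exec (ren first_copy c) s3 [] t1 u"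
      "u \<circ> first_copy = r1" "\<And>b. b \<notin> range first_copy \<Longrightarrow> u b = s3 b" by blast
    \<comment> \<open>The first copy has not touched the arrays of the second.\<close>
    have "u \<circ> second_copy = s3 \<circ> second_copy" using u(3) copies(3) by (auto simp: fun_eq_iff)
    then have "u \<circ> second_copy = init x2" using i2 by simp
    from exec_ren[OF c2 copies(2) this] obtain w where w: "exec (ren second_copy c) u [] t2 w"
      "w \<circ> second_copy = r2" "\<And>b. b \<notin> range second_copy \<Longrightarrow> w b = u b" by blast
    have "cells_within (B + t1 + t2) w"
      unfolding cells_within_def
    proof (intro conjI allI)
      fix a i
      show "bits (w a i) \<le> B + t1 + t2"
        using exec_bits[OF u(1), of a i] exec_bits[OF w(1), of a i] s3(1) unfolding cells_within_def
        by (smt (verit, best) add_le_mono1 le_trans)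
    qed (use B1 in simp)
    from runs_verdict[OF this] have "runs verdict w (pweight verdict * (B + t1 + t2)) Z"
    proof (rule runs_mono)
      have "w (first_copy 1) = r1 1" using w(3)[OF copies(4), of 1] u(2) by (auto simp: fun_eq_iff)
      moreover have "w (second_copy 1) = r2 1" using w(2) by auto
      ultimately show "Z s'" if "s' 1 0 = (if 0 < w (first_copy 1) 0 \<and> 0 < w (second_copy 1) 0 then 0 else 1)" for s'
        using that unfolding Z_def by simp
    qed simp
    then have "runs (Seq (ren second_copy c) verdict) u (t2 + pweight verdict * (B + t1 + t2)) Z"
      using w(1) by (intro runs_Seq) (auto simp: runs_def)
    then show ?thesis using u(1) unfolding copies_run_def by (intro runs_Seq) (auto simp: runs_def)
  qed
  define T3 where "T3 = t1 + (t2 + pweight verdict * (B + t1 + t2))"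
  have r3: "runs (Seq (fill 3 (- 1)) (copies_run)) s2
      (pweight (fill 3 (- 1)) * B\<^sup>2 + T3) Z"
    if s2: "s2 4 = (\<lambda>i. if i = 0 then int (scale n) else if i = 1 then z else 0)"
      "s2 2 = init x1 0"
      "\<And>a. a \<noteq> 4 \<Longrightarrow> a \<noteq> 2 \<Longrightarrow> s2 a = s a" "cells_within B s2" for s2 z
  proof (rule runs_Seq, rule runs_mono)
    show "runs (fill 3 (- 1)) s2 (pweight (fill 3 (- 1)) * (entryB n)\<^sup>2)
      (filled n E 3 (- 1) s2)"
      by (rule runs_fill) (use s2 n s_zero in \<open>auto simp: s_def B_def\<close>)
    show "runs (copies_run) s' T3 Z"
      if "filled n E 3 (- 1) s2 s'" for s'
      unfolding T3_def by (rule final) (use that s2 s_zero in \<open>auto simp: B_def filled_def x1_def x2_def\<close>)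
  qed (simp add: B_def)
  have r2: "runs (Seq (fill 2 1) (Seq (fill 3 (- 1)) (copies_run))) s1
      (pweight (fill 2 1) * B\<^sup>2 + (pweight (fill 3 (- 1)) * B\<^sup>2 + T3)) Z"
    if s1: "s1 4 = (\<lambda>i. if i = 0 then int (scale n) else 0)"
      "\<And>a. a \<noteq> 4 \<Longrightarrow> s1 a = s a" "cells_within B s1" for s1
  proof (rule runs_Seq, rule runs_mono)
    show "runs (fill 2 1) s1 (pweight (fill 2 1) * (entryB n)\<^sup>2)
      (filled n E 2 1 s1)"
      by (rule runs_fill[where z = 0]) (use s1 n s_zero in \<open>auto simp: s_def B_def fun_eq_iff\<close>)
    show "runs (Seq (fill 3 (- 1)) (copies_run)) s'
      (pweight (fill 3 (- 1)) * B\<^sup>2 + T3) Z"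
      if "filled n E 2 1 s1 s'" for s'
      by (rule r3[where z = "int (200 * n\<^sup>2)"]) (use that s1 in \<open>auto simp: B_def filled_def x1_def x2_def\<close>)
  qed (simp add: B_def)
  define T2 where "T2 = pweight (fill 2 1) * B\<^sup>2 + (pweight (fill 3 (- 1)) * B\<^sup>2 + T3)"
  define rest where "rest = Seq (fill 2 1) (Seq (fill 3 (- 1)) (copies_run))"
  have r1: "runs (Seq root_loop rest) s (pweight root_loop * B\<^sup>2 + T2) Z"
  proof (rule runs_Seq, rule runs_mono)
    show "runs root_loop s (pweight root_loop * (entryB n)\<^sup>2)
      (\<lambda>s'. s' 4 = (\<lambda>i. if i = 0 then int (scale n) else 0) \<and>
      (\<forall>a. a \<noteq> 4 \<longrightarrow> s' a = s a) \<and> cells_within (entryB n) s')"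
    proof (rule runs_root_loop[OF n0])
      show "s 0 = init (enc_graph n E) 0" by (simp add: s_def)
      show "s 4 = (\<lambda>_. 0)" by (rule s_zero) simp
      show "cells_within (entryB n) s" unfolding s_def by (rule cells_within_init)
    qed
    show "runs rest s' T2 Z"
      if "s' 4 = (\<lambda>i. if i = 0 then int (scale n) else 0) \<and>
      (\<forall>a. a \<noteq> 4 \<longrightarrow> s' a = s a) \<and> cells_within (entryB n) s'" for s'
      unfolding T2_def rest_def using that by (intro r2) (simp_all only: B_def, blast)
  qed (simp add: B_def)
  define g where "g = Sub (Add nE (Const 1)) (Const (int n0))"
  have "0 < val g s" using n(1) by (simp add: g_def s_def enc_graph_head)
  then have "runs (clique_prog n0 c) s (1 + cost g s + (pweight root_loop * B\<^sup>2 + T2)) Z"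
    unfolding clique_prog_def g_def[symmetric] copies_run_def[symmetric] rest_def[symmetric] using r1 by (intro runs_If) auto
  then show ?thesis unfolding s_def[symmetric] Z_def[symmetric]
  proof (rule runs_mono)
    have g: "1 + cost g s \<le> (1 + weight g) * B"
      using cost_le_weight[of B s g] cells_within_init[of n E] B1 by (simp add: s_def B_def)
    have B2: "B \<le> B\<^sup>2" using B1 by (simp add: power2_eq_square)
    define K where "K = pweight (clique_prog n0 c)"
    have K: "1 + weight g + pweight root_loop + pweight (fill 2 1) + pweight (fill 3 (- 1)) + pweight verdict \<le> K"
      unfolding K_def clique_prog_def g_def[symmetric] pweight.simps(3,4) by linarith
    have "1 + cost g s + (pweight root_loop * B\<^sup>2 + T2)
      \<le> (1 + weight g) * B\<^sup>2 + (pweight root_loop * B\<^sup>2 + (pweight (fill 2 1) * B\<^sup>2 +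
         (pweight (fill 3 (- 1)) * B\<^sup>2 + (t1 + (t2 + pweight verdict * (B\<^sup>2 + (t1 + t2)))))))"
    proof -
      have "1 + cost g s \<le> (1 + weight g) * B\<^sup>2"
        using g mult_le_mono2[OF B2, of "1 + weight g"] by linarith
      moreover have "pweight verdict * (B + t1 + t2) \<le> pweight verdict * (B\<^sup>2 + (t1 + t2))"
        using B2 by (intro mult_le_mono2) simp
      ultimately show ?thesis unfolding T2_def T3_def by linarith
    qed
    also have "\<dots> \<le> (1 + weight g + pweight root_loop + pweight (fill 2 1) + pweight (fill 3 (- 1)) + pweight verdict)
       * (B\<^sup>2 + (t1 + t2)) + (t1 + t2)"
      unfolding distrib_left distrib_right by linarith
    also have "\<dots> \<le> K * (B\<^sup>2 + (t1 + t2)) + (t1 + t2)"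
      using K by (intro add_mono mult_le_mono) auto
    finally show "1 + cost g s + (pweight root_loop * B\<^sup>2 + T2)
      \<le> K * ((entryB n)\<^sup>2 + (t1 + t2)) + (t1 + t2)" unfolding B_def .
  qed
qed

subsection \<open>Deviations of quadratic forms in random signs\<close>

lemma tanh_le_self:
  fixes x :: real
  assumes "0 \<le> x"
  shows "tanh x \<le> x"
proof -
  have "(\<lambda>t. t - tanh t) 0 \<le> (\<lambda>t. t - tanh t) x"
  proof (rule DERIV_nonneg_imp_nondecreasing[OF assms])
    fix t :: real
    have "((\<lambda>t. t - tanh t) has_real_derivative 1 - (1 - tanh t ^ 2)) (at t)"
      by (auto intro!: derivative_eq_intros)
    then show "\<exists>y. ((\<lambda>t. t - tanh t) has_real_derivative y) (at t) \<and> 0 \<le> y"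
      by (intro exI conjI) auto
  qed
  then show ?thesis by simp
qed

text \<open>The moment generating function of a random sign is sub-Gaussian: t^2 / 2 - ln (cosh t)
  vanishes at 0 and has derivative t - tanh t.\<close>

lemma cosh_le_exp_half_square: "cosh x \<le> exp (x\<^sup>2 / 2)" for x :: real
proof -
  have *: "cosh x \<le> exp (x\<^sup>2 / 2)" if "0 \<le> x" for x :: real
  proof -
    have "(\<lambda>t. t\<^sup>2 / 2 - ln (cosh t)) 0 \<le> (\<lambda>t. t\<^sup>2 / 2 - ln (cosh t)) x"
    proof (rule DERIV_nonneg_imp_nondecreasing[OF that])
      fix t :: real assume "0 \<le> t"
      have "((\<lambda>t. t\<^sup>2 / 2 - ln (cosh t)) has_real_derivative t - sinh t / cosh t) (at t)"
        by (auto intro!: derivative_eq_intros simp: cosh_real_pos)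
      then show "\<exists>y. ((\<lambda>t. t\<^sup>2 / 2 - ln (cosh t)) has_real_derivative y) (at t) \<and> 0 \<le> y"
        using tanh_le_self[OF \<open>0 \<le> t\<close>] by (intro exI conjI) (auto simp: tanh_def)
    qed
    then have "ln (cosh x) \<le> x\<^sup>2 / 2" by simp
    then have "exp (ln (cosh x)) \<le> exp (x\<^sup>2 / 2)" by (simp only: exp_le_cancel_iff)
    then show ?thesis using cosh_real_pos[of x] by (simp only: exp_ln)
  qed
  show ?thesis using *[of "\<bar>x\<bar>"] by (cases "0 \<le> x") auto
qed

lemma exp_add_exp_minus_le: "exp x + exp (- x) \<le> 2 * exp (x\<^sup>2 / 2)" for x :: real
  using cosh_le_exp_half_square[of x] by (simp add: cosh_field_def)

definition sign_in :: "'e set \<Rightarrow> 'e \<Rightarrow> real" where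
  "sign_in E e = (if e \<in> E then 1 else - 1)"

text \<open>Written as a sum over all of P with zero terms, instead of a sum over a fibre of
  \<open>rowof\<close>, so that an induction on P adds one summand at a time.\<close>

definition row_sum :: "'e set \<Rightarrow> ('e \<Rightarrow> 'i) \<Rightarrow> ('e \<Rightarrow> real) \<Rightarrow> 'i \<Rightarrow> real" where
  "row_sum P rowof f i = (\<Sum>e\<in>P. if rowof e = i then f e else 0)"

lemma row_sum_insert:
  "finite P \<Longrightarrow> x \<notin> P \<Longrightarrow>
    row_sum (insert x P) rowof f i = (if rowof x = i then f x else 0) + row_sum P rowof f i"
  by (simp add: row_sum_def)

text \<open>Expectations over a uniformly random E are written as unnormalised sums over
  \<open>Pow P\<close>; in these terms this conditions on whether x belongs to E.\<close>

lemma sum_Pow_insert: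
  assumes "finite P" "x \<notin> P"
  shows "(\<Sum>E\<in>Pow (insert x P). f E) = (\<Sum>E\<in>Pow P. f E) + (\<Sum>E\<in>Pow P. f (insert x E))"
proof -
  have "inj_on (insert x) (Pow P)" using assms by (auto simp: inj_on_def)
  moreover have "Pow P \<inter> insert x ` Pow P = {}" using assms by auto
  ultimately show ?thesis
    using assms by (simp add: Pow_insert sum.union_disjoint sum.reindex)
qed

text \<open>Here l + 8 l^2 r is the coefficient m reached after edges of total squared weight r in
  the row. The condition |l| r \<le> 1 / 8 yields |m| \<le> 2 |l|, so the sub-Gaussian term 2 m^2
  a^2 z^2 is at most 8 l^2 a^2 z^2, and raising the coefficient by 8 l^2 z^2 pays for it.\<close>

lemma square_mgf_step:
  fixes l a r z :: real
  assumes "\<bar>l\<bar> * r \<le> 1 / 8" "0 \<le> r"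
  shows "(l + 8 * l\<^sup>2 * r) * (a\<^sup>2 + z\<^sup>2 + r) + (2 * (l + 8 * l\<^sup>2 * r) * a * z)\<^sup>2 / 2
    \<le> (l + 8 * l\<^sup>2 * (r + z\<^sup>2)) * (a\<^sup>2 + (r + z\<^sup>2))"
proof -
  define m where "m = l + 8 * l\<^sup>2 * r"
  have "8 * l\<^sup>2 * r = 8 * \<bar>l\<bar> * (\<bar>l\<bar> * r)" by (simp add: power2_eq_square)
  also have "\<dots> \<le> 8 * \<bar>l\<bar> * (1 / 8)" by (intro mult_left_mono assms) auto
  finally have "8 * l\<^sup>2 * r \<le> \<bar>l\<bar>" by simp
  moreover have "0 \<le> 8 * l\<^sup>2 * r" using assms(2) by simp
  ultimately have "\<bar>m\<bar> \<le> 2 * \<bar>l\<bar>" unfolding m_def by linarith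
  then have "m\<^sup>2 \<le> 4 * l\<^sup>2" using abs_le_square_iff[of m "2 * l"] by (simp add: power_mult_distrib abs_mult)
  then have "2 * m\<^sup>2 * (a\<^sup>2 * z\<^sup>2) \<le> 2 * (4 * l\<^sup>2) * (a\<^sup>2 * z\<^sup>2)"
    by (intro mult_right_mono) auto
  also have "\<dots> \<le> 8 * l\<^sup>2 * z\<^sup>2 * (a\<^sup>2 + (r + z\<^sup>2))"
    using assms(2) by (simp add: algebra_simps)
  finally have "2 * m\<^sup>2 * (a\<^sup>2 * z\<^sup>2) \<le> 8 * l\<^sup>2 * z\<^sup>2 * (a\<^sup>2 + (r + z\<^sup>2))" .
  moreover have "(2 * m * a * z)\<^sup>2 / 2 = 2 * m\<^sup>2 * (a\<^sup>2 * z\<^sup>2)"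
    by (simp add: power_mult_distrib)
  moreover have "(l + 8 * l\<^sup>2 * (r + z\<^sup>2)) * (a\<^sup>2 + (r + z\<^sup>2)) =
      m * (a\<^sup>2 + z\<^sup>2 + r) + 8 * l\<^sup>2 * z\<^sup>2 * (a\<^sup>2 + (r + z\<^sup>2))"
    unfolding m_def by (simp add: algebra_simps)
  ultimately show ?thesis unfolding m_def[symmetric] by linarith
qed

text \<open>The edges are averaged out one at a time: averaging the sign of an edge of weight \<open>z\<close> in
  \<open>exp (m (a \<pm> z)\<^sup>2)\<close> raises the coefficient \<open>m\<close> of \<open>a\<^sup>2\<close> to at most \<open>m + 2 m\<^sup>2 z\<^sup>2\<close>.\<close>

lemma square_mgf:
  fixes z :: "'e \<Rightarrow> real" and rowof :: "'e \<Rightarrow> 'i" and a :: "'i \<Rightarrow> real"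
  assumes "finite P" "finite I"
    and "\<And>i. i \<in> I \<Longrightarrow> \<bar>l\<bar> * row_sum P rowof (\<lambda>e. (z e)\<^sup>2) i \<le> 1 / 8"
  shows "(\<Sum>E\<in>Pow P. exp (l * (\<Sum>i\<in>I. (a i + row_sum P rowof (\<lambda>e. sign_in E e * z e) i)\<^sup>2)))
    \<le> 2 ^ card P * exp (\<Sum>i\<in>I. (l + 8 * l\<^sup>2 * row_sum P rowof (\<lambda>e. (z e)\<^sup>2) i) *
        ((a i)\<^sup>2 + row_sum P rowof (\<lambda>e. (z e)\<^sup>2) i))"
  using assms(1,3)
proof (induction P arbitrary: a rule: finite_induct)
  case empty
  show ?case by (simp add: row_sum_def sum_distrib_left)
next
  case (insert x P)
  define \<rho> where "\<rho> = row_sum P rowof (\<lambda>e. (z e)\<^sup>2)"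
  define F where "F a E = exp (l * (\<Sum>i\<in>I. (a i + row_sum P rowof (\<lambda>e. sign_in E e * z e) i)\<^sup>2))" for a E
  define G where "G a = (\<Sum>i\<in>I. (l + 8 * l\<^sup>2 * \<rho> i) * ((a i)\<^sup>2 + \<rho> i))" for a
  define r where "r = rowof x"
  define R where "R = (\<Sum>i\<in>I. (l + 8 * l\<^sup>2 * ((if r = i then (z x)\<^sup>2 else 0) + \<rho> i)) *
        ((a i)\<^sup>2 + ((if r = i then (z x)\<^sup>2 else 0) + \<rho> i)))"
  have \<rho>0: "0 \<le> \<rho> i" for i unfolding \<rho>_def row_sum_def by (intro sum_nonneg) auto
  have \<rho>': "row_sum (insert x P) rowof (\<lambda>e. (z e)\<^sup>2) i = (if r = i then (z x)\<^sup>2 else 0) + \<rho> i" for i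
    using insert.hyps by (simp add: row_sum_insert \<rho>_def r_def)
  have \<rho>l: "\<bar>l\<bar> * \<rho> i \<le> 1 / 8" if "i \<in> I" for i
  proof -
    have "\<bar>l\<bar> * \<rho> i \<le> \<bar>l\<bar> * ((if r = i then (z x)\<^sup>2 else 0) + \<rho> i)"
      by (intro mult_left_mono) auto
    then show ?thesis using insert.prems[OF that] unfolding \<rho>' by linarith
  qed
  have IH: "(\<Sum>E\<in>Pow P. F a E) \<le> 2 ^ card P * exp (G a)" for a
    using insert.IH[of a] \<rho>l unfolding F_def G_def \<rho>_def by blast
  \<comment> \<open>Fixing the sign of x shifts the offset of its row by plus or minus
    \<open>z x\<close>; for this reason the induction runs over arbitrary offsets a.\<close>
  have sums: "(\<Sum>E\<in>Pow (insert x P). exp (l * (\<Sum>i\<in>I. (a i + row_sum (insert x P) rowof (\<lambda>e. sign_in E e * z e) i)\<^sup>2)))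
    = (\<Sum>E\<in>Pow P. F (a(r := a r - z x)) E) + (\<Sum>E\<in>Pow P. F (a(r := a r + z x)) E)"
  proof -
    have 1: "row_sum P rowof (\<lambda>e. sign_in (insert x E) e * z e) i = row_sum P rowof (\<lambda>e. sign_in E e * z e) i" for E i
      unfolding row_sum_def using insert.hyps by (intro sum.cong) (auto simp: sign_in_def)
    have 2: "a i + row_sum (insert x P) rowof (\<lambda>e. sign_in E e * z e) i
        = (a(r := a r - z x)) i + row_sum P rowof (\<lambda>e. sign_in E e * z e) i" if "x \<notin> E" for E i
      using that insert.hyps by (simp add: row_sum_insert sign_in_def r_def)
    have 3: "a i + row_sum (insert x P) rowof (\<lambda>e. sign_in (insert x E) e * z e) i
        = (a(r := a r + z x)) i + row_sum P rowof (\<lambda>e. sign_in E e * z e) i" for E i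
      unfolding row_sum_insert[OF insert.hyps] 1 by (simp add: sign_in_def r_def)
    have "x \<notin> E" if "E \<in> Pow P" for E using that insert.hyps by auto
    then show ?thesis
      unfolding sum_Pow_insert[OF insert.hyps] F_def 3
      by (intro arg_cong2[where f = "(+)"] sum.cong refl) (simp add: 2)
  qed
  have le: "exp (G (a(r := a r - z x))) + exp (G (a(r := a r + z x)))
     \<le> 2 * exp R"
  proof (cases "r \<in> I")
    case False
    then have "G (a(r := u)) = G a" for u unfolding G_def by (intro sum.cong) auto
    moreover have "R = G a"
      unfolding R_def G_def using False by (intro sum.cong) auto
    ultimately show ?thesis by simp
  next
    case True
    define m where "m = l + 8 * l\<^sup>2 * \<rho> r"
    define rest where "rest = (\<Sum>i\<in>I - {r}. (l + 8 * l\<^sup>2 * \<rho> i) * ((a i)\<^sup>2 + \<rho> i))"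
    have G: "G (a(r := u)) = m * (u\<^sup>2 + \<rho> r) + rest" for u
      unfolding G_def rest_def m_def using assms(2) True
      by (simp add: sum.remove[of I r])
    have R: "R
      = (l + 8 * l\<^sup>2 * (\<rho> r + (z x)\<^sup>2)) * ((a r)\<^sup>2 + (\<rho> r + (z x)\<^sup>2)) + rest"
      unfolding R_def rest_def using assms(2) True
      by (simp add: sum.remove[of I r] add.commute cong: if_cong) (intro sum.cong, auto)
    \<comment> \<open>The two exponents differ only in the sign of the cross term, which leaves
      twice a hyperbolic cosine.\<close>
    have "exp (G (a(r := a r - z x))) + exp (G (a(r := a r + z x)))
      = exp (m * ((a r)\<^sup>2 + (z x)\<^sup>2 + \<rho> r) + rest) *
          (exp (2 * m * a r * z x) + exp (- (2 * m * a r * z x)))"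
      unfolding G by (simp add: algebra_simps power2_eq_square flip: exp_add)
    also have "\<dots> \<le> exp (m * ((a r)\<^sup>2 + (z x)\<^sup>2 + \<rho> r) + rest) * (2 * exp ((2 * m * a r * z x)\<^sup>2 / 2))"
      by (intro mult_left_mono exp_add_exp_minus_le) auto
    also have "\<dots> = 2 * exp (m * ((a r)\<^sup>2 + (z x)\<^sup>2 + \<rho> r) + (2 * m * a r * z x)\<^sup>2 / 2 + rest)"
      by (simp add: exp_add)
    also have "\<dots> \<le> 2 * exp ((l + 8 * l\<^sup>2 * (\<rho> r + (z x)\<^sup>2)) * ((a r)\<^sup>2 + (\<rho> r + (z x)\<^sup>2)) + rest)"
      using square_mgf_step[OF \<rho>l[OF True] \<rho>0, of "a r" "z x"] unfolding m_def by simp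
    finally show ?thesis unfolding R .
  qed
  have "(\<Sum>E\<in>Pow P. F (a(r := a r - z x)) E) + (\<Sum>E\<in>Pow P. F (a(r := a r + z x)) E)
    \<le> 2 ^ card P * (exp (G (a(r := a r - z x))) + exp (G (a(r := a r + z x))))"
    using IH[of "a(r := a r - z x)"] IH[of "a(r := a r + z x)"] by (simp add: algebra_simps)
  also have "\<dots> \<le> 2 ^ card P * (2 * exp R)"
    by (intro mult_left_mono le) auto
  finally show ?case unfolding sums \<rho>' R_def[symmetric] using insert.hyps by (simp add: mult.assoc)
qed

text \<open>A two-sided Chernoff bound. As every row has weight at most 1, the coefficients in the
  moment bound are at most l + 8 l^2, so the exponent exceeds l times the mean by at most 8 l^2
  W.\<close>

lemma square_tail:
  fixes z :: "'e \<Rightarrow> real" and rowof :: "'e \<Rightarrow> 'i" and a :: "'i \<Rightarrow> real"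
  assumes "finite P" "finite I"
    and \<rho>: "\<And>i. i \<in> I \<Longrightarrow> row_sum P rowof (\<lambda>e. (z e)\<^sup>2) i \<le> 1"
    and W: "(\<Sum>i\<in>I. (a i)\<^sup>2 + row_sum P rowof (\<lambda>e. (z e)\<^sup>2) i) \<le> W"
    and s: "0 < s" "s \<le> 2 * W"
  shows "real (card {E \<in> Pow P. s \<le> \<bar>(\<Sum>i\<in>I. (a i + row_sum P rowof (\<lambda>e. sign_in E e * z e) i)\<^sup>2)
      - (\<Sum>i\<in>I. (a i)\<^sup>2 + row_sum P rowof (\<lambda>e. (z e)\<^sup>2) i)\<bar>})
    \<le> 2 * 2 ^ card P * exp (- (s\<^sup>2 / (32 * W)))"
proof -
  define \<rho> where "\<rho> = row_sum P rowof (\<lambda>e. (z e)\<^sup>2)"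
  define X where "X E = (\<Sum>i\<in>I. (a i + row_sum P rowof (\<lambda>e. sign_in E e * z e) i)\<^sup>2)" for E
  define m where "m = (\<Sum>i\<in>I. (a i)\<^sup>2 + \<rho> i)"
  \<comment> \<open>The minimiser of 8 l^2 W - l s; the assumption s \<le> 2 W makes it at most 1 /
    8, as the moment bound requires.\<close>
  define l where "l = s / (16 * W)"
  have W0: "0 < W" using s by linarith
  have l: "0 < l" "l \<le> 1 / 8" using s W0 unfolding l_def by (auto simp: field_simps)
  have \<rho>0: "0 \<le> \<rho> i" for i unfolding \<rho>_def row_sum_def by (intro sum_nonneg) auto
  have mgf: "(\<Sum>E\<in>Pow P. exp (k * (X E - m))) \<le> 2 ^ card P * exp (8 * l\<^sup>2 * W)"
    if k: "\<bar>k\<bar> = l" for k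
  proof -
    have "(\<Sum>E\<in>Pow P. exp (k * (X E - m))) = exp (- (k * m)) * (\<Sum>E\<in>Pow P. exp (k * X E))"
      by (simp add: sum_distrib_left algebra_simps flip: exp_add)
    also have "(\<Sum>E\<in>Pow P. exp (k * X E)) \<le>
      2 ^ card P * exp (\<Sum>i\<in>I. (k + 8 * k\<^sup>2 * \<rho> i) * ((a i)\<^sup>2 + \<rho> i))"
      unfolding X_def \<rho>_def
    proof (rule square_mgf[OF assms(1,2)])
      fix i assume "i \<in> I"
      then have "\<rho> i \<le> 1" using assms(3) unfolding \<rho>_def by blast
      then have "\<bar>k\<bar> * \<rho> i \<le> \<bar>k\<bar> * 1" by (intro mult_left_mono) auto
      then show "\<bar>k\<bar> * row_sum P rowof (\<lambda>e. (z e)\<^sup>2) i \<le> 1 / 8"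
        using k l unfolding \<rho>_def by linarith
    qed
    also have "(\<Sum>i\<in>I. (k + 8 * k\<^sup>2 * \<rho> i) * ((a i)\<^sup>2 + \<rho> i)) \<le> (\<Sum>i\<in>I. (k + 8 * k\<^sup>2) * ((a i)\<^sup>2 + \<rho> i))"
    proof (intro sum_mono mult_right_mono add_left_mono)
      fix i assume "i \<in> I"
      then have "\<rho> i \<le> 1" using assms(3) unfolding \<rho>_def by blast
      then show "8 * k\<^sup>2 * \<rho> i \<le> 8 * k\<^sup>2"
        using mult_left_mono[of "\<rho> i" 1 "8 * k\<^sup>2"] by simp
    qed (use \<rho>0 in auto)
    also have "\<dots> = (k + 8 * k\<^sup>2) * m" by (simp add: m_def sum_distrib_left)
    also have "\<dots> \<le> k * m + 8 * l\<^sup>2 * W"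
    proof -
      have "k\<^sup>2 = l\<^sup>2" using k by auto
      moreover have "8 * l\<^sup>2 * m \<le> 8 * l\<^sup>2 * W"
        using W unfolding m_def \<rho>_def by (intro mult_left_mono) auto
      ultimately show ?thesis by (simp add: algebra_simps)
    qed
    finally have "(\<Sum>E\<in>Pow P. exp (k * (X E - m)))
        \<le> exp (- (k * m)) * (2 ^ card P * exp (k * m + 8 * l\<^sup>2 * W))" by simp
    also have "\<dots> = 2 ^ card P * exp (8 * l\<^sup>2 * W)" by (simp add: exp_add exp_minus)
    finally show ?thesis .
  qed
  have "real (card {E \<in> Pow P. s \<le> \<bar>X E - m\<bar>}) = (\<Sum>E\<in>{E \<in> Pow P. s \<le> \<bar>X E - m\<bar>}. 1)" by simp
  also have "\<dots> \<le> (\<Sum>E\<in>{E \<in> Pow P. s \<le> \<bar>X E - m\<bar>}.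
      exp (- (l * s)) * (exp (l * (X E - m)) + exp ((- l) * (X E - m))))"
  proof (intro sum_mono)
    fix E assume "E \<in> {E \<in> Pow P. s \<le> \<bar>X E - m\<bar>}"
    then have "s \<le> X E - m \<or> s \<le> - (X E - m)" by auto
    then have "l * s \<le> l * (X E - m) \<or> l * s \<le> l * (- (X E - m))"
      using l by (simp add: mult_le_cancel_left_pos)
    then have "exp (l * s) \<le> exp (l * (X E - m)) \<or> exp (l * s) \<le> exp ((- l) * (X E - m))"
      by (simp add: algebra_simps)
    then have "exp (l * s) \<le> exp (l * (X E - m)) + exp ((- l) * (X E - m))"
      by (smt (verit) exp_gt_zero)
    then have "exp (- (l * s)) * exp (l * s) \<le> exp (- (l * s)) * (exp (l * (X E - m)) + exp ((- l) * (X E - m)))"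
      by (intro mult_left_mono) auto
    then show "1 \<le> exp (- (l * s)) * (exp (l * (X E - m)) + exp ((- l) * (X E - m)))"
      by (simp flip: exp_add)
  qed
  also have "\<dots> \<le> (\<Sum>E\<in>Pow P. exp (- (l * s)) * (exp (l * (X E - m)) + exp ((- l) * (X E - m))))"
    using assms(1) by (intro sum_mono2) auto
  also have "\<dots> = exp (- (l * s)) * ((\<Sum>E\<in>Pow P. exp (l * (X E - m))) + (\<Sum>E\<in>Pow P. exp ((- l) * (X E - m))))"
    by (simp add: sum_distrib_left sum.distrib distrib_left)
  also have "\<dots> \<le> exp (- (l * s)) * (2 ^ card P * exp (8 * l\<^sup>2 * W) + 2 ^ card P * exp (8 * l\<^sup>2 * W))"
    using l by (intro mult_left_mono add_mono mgf) auto
  also have "\<dots> = 2 * 2 ^ card P * exp (8 * l\<^sup>2 * W - l * s)"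
    by (simp add: exp_diff exp_minus field_simps)
  also have "8 * l\<^sup>2 * W - l * s = - (s\<^sup>2 / (32 * W))"
    using W0 unfolding l_def by (simp add: field_simps power2_eq_square)
  finally show ?thesis unfolding X_def m_def \<rho>_def .
qed

section \<open>Uniform deviation bounds over sparse vectors\<close>

definition sparse_on :: "nat \<Rightarrow> nat \<Rightarrow> (nat \<Rightarrow> real) \<Rightarrow> bool" where
  "sparse_on J k x \<longleftrightarrow> card {j. j < J \<and> x j \<noteq> 0} \<le> k"

definition grid :: "nat \<Rightarrow> nat \<Rightarrow> nat \<Rightarrow> (nat \<Rightarrow> real) set" where
  "grid J k M = {\<lambda>j. of_int (w j) / real M | w :: nat \<Rightarrow> int.
     {j. w j \<noteq> 0} \<subseteq> {..<J} \<and> card {j. w j \<noteq> 0} \<le> k \<and> (\<forall>j. \<bar>w j\<bar> \<le> int M)}"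

text \<open>A grid vector is determined by a list of k pairs of a position and a value, from a set
  of size J (2 M + 1).\<close>

lemma grid_card:
  assumes "0 < J"
  shows "finite (grid J k M)" "card (grid J k M) \<le> (J * (2 * M + 1)) ^ k"
proof -
  define A where "A = {..<J} \<times> {- int M..int M}"
  define L where "L = {xs. set xs \<subseteq> A \<and> length xs = k}"
  define dec where "dec xs = (\<lambda>j. case map_of xs j of None \<Rightarrow> 0 | Some z \<Rightarrow> of_int z / real M)"
    for xs :: "(nat \<times> int) list"
  have "finite A" unfolding A_def by simp
  have cA: "card A = J * (2 * M + 1)" 
  proof -
    have "nat (2 * int M + 1) = 2 * M + 1" by simp
    then show ?thesis unfolding A_def by (simp add: card_cartesian_product)
  qed
  have L: "finite L" "card L = (J * (2 * M + 1)) ^ k"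
    unfolding L_def using finite_lists_length_eq[OF \<open>finite A\<close>] card_lists_length_eq[OF \<open>finite A\<close>] cA
    by auto
  have sub: "grid J k M \<subseteq> dec ` L"
  proof
    fix y assume "y \<in> grid J k M"
    then obtain w :: "nat \<Rightarrow> int" where w: "y = (\<lambda>j. of_int (w j) / real M)"
      "{j. w j \<noteq> 0} \<subseteq> {..<J}" "card {j. w j \<noteq> 0} \<le> k" "\<And>j. \<bar>w j\<bar> \<le> int M"
      unfolding grid_def by auto
    have fin: "finite {j. w j \<noteq> 0}" using w(2) finite_subset by blast
    then obtain ps where ps: "set ps = {j. w j \<noteq> 0}" "distinct ps"
      using finite_distinct_list by blast
    then have lp: "length ps \<le> k" using w(3) by (metis distinct_card)
    \<comment> \<open>Padding with index 0, admissible as 0 < J, only adds copies of the pair (0, w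
      0), so the decoded vector does not change.\<close>
    define qs where "qs = ps @ replicate (k - length ps) 0"
    define xs where "xs = map (\<lambda>j. (j, w j)) qs"
    have qs: "length qs = k" "set qs \<subseteq> {..<J}" "{j. w j \<noteq> 0} \<subseteq> set qs"
      unfolding qs_def using lp ps w(2) assms by auto
    have "xs \<in> L" unfolding L_def xs_def A_def using qs w(4) by (auto simp: abs_le_iff minus_le_iff)
    moreover have "dec xs = y"
    proof
      fix j
      have "map_of xs j = (if j \<in> set qs then Some (w j) else None)"
        unfolding xs_def by (simp add: map_of_map_restrict restrict_map_def)
      then show "dec xs j = y j" unfolding dec_def w(1) using qs(3) by auto
    qed
    ultimately show "y \<in> dec ` L" by blast
  qed
  show "finite (grid J k M)" using sub L(1) finite_surj by blast
  have "card (grid J k M) \<le> card L" using sub L(1) by (rule surj_card_le[rotated])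
  then show "card (grid J k M) \<le> (J * (2 * M + 1)) ^ k" using L by simp
qed

text \<open>Rounding towards zero never increases a modulus and fixes 0, so a rounded vector keeps
  norm at most 1 and stays sparse.\<close>

definition trunc :: "nat \<Rightarrow> real \<Rightarrow> int" where
  "trunc M t = (if 0 \<le> t then \<lfloor>real M * t\<rfloor> else - \<lfloor>real M * (- t)\<rfloor>)"

lemma trunc:
  assumes "0 < M" "\<bar>t\<bar> \<le> 1"
  shows "\<bar>t - of_int (trunc M t) / real M\<bar> \<le> 1 / real M" "\<bar>of_int (trunc M t) / real M\<bar> \<le> \<bar>t\<bar>"
    "\<bar>trunc M t\<bar> \<le> int M" "t = 0 \<Longrightarrow> trunc M t = 0"
proof -
  have *: "\<bar>u - of_int \<lfloor>real M * u\<rfloor> / real M\<bar> \<le> 1 / real M \<and> \<bar>of_int \<lfloor>real M * u\<rfloor> / real M\<bar> \<le> \<bar>u\<bar>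
    \<and> \<bar>\<lfloor>real M * u\<rfloor>\<bar> \<le> int M" if u: "0 \<le> u" "u \<le> 1" for u
  proof -
    have f: "of_int \<lfloor>real M * u\<rfloor> \<le> real M * u" "real M * u < of_int \<lfloor>real M * u\<rfloor> + 1" "0 \<le> \<lfloor>real M * u\<rfloor>"
      using u by (auto simp: le_floor_iff)
    have "real M * u \<le> real M" using u by (simp add: mult_left_le)
    then have "of_int \<lfloor>real M * u\<rfloor> \<le> real_of_int (int M)" using f(1) by linarith
    then have 3: "\<lfloor>real M * u\<rfloor> \<le> int M" by linarith
    have "\<bar>real M * u - of_int \<lfloor>real M * u\<rfloor>\<bar> \<le> 1" using f by linarith
    moreover have "u - of_int \<lfloor>real M * u\<rfloor> / real M = (real M * u - of_int \<lfloor>real M * u\<rfloor>) / real M"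
      using assms(1) by (simp add: field_simps)
    ultimately have 1: "\<bar>u - of_int \<lfloor>real M * u\<rfloor> / real M\<bar> \<le> 1 / real M"
      using assms(1) by (simp add: divide_right_mono)
    have 2: "of_int \<lfloor>real M * u\<rfloor> / real M \<le> u"
      using f assms(1) by (simp add: field_simps)
    show ?thesis using 1 2 3 f(3) u by simp
  qed
  show "\<bar>t - of_int (trunc M t) / real M\<bar> \<le> 1 / real M" "\<bar>of_int (trunc M t) / real M\<bar> \<le> \<bar>t\<bar>"
    "\<bar>trunc M t\<bar> \<le> int M"
    using *[of t] *[of "- t"] assms(2) unfolding trunc_def by (auto simp: abs_minus_commute)
qed (simp add: trunc_def)

text \<open>Row \<open>i\<close> of the matrix applied to \<open>x\<close> is \<open>D x\<^sub>i\<close> plus the signed sum of the entries \<open>x\<^sub>j\<close>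
  over the edges of that row; every column meets exactly \<open>h\<close> edges.\<close>

locale sign_matrix =
  fixes I :: "nat set" and J :: nat and P :: "'p set" and line column :: "'p \<Rightarrow> nat"
    and edge :: "'p \<Rightarrow> 'e" and Q :: "'e set" and D :: real and h :: nat
  assumes finI: "finite I" and J0: "0 < J" and finP: "finite P" and finQ: "finite Q"
    and edge_inj: "inj_on edge P" and edge_in: "edge ` P \<subseteq> Q"
    and line_in: "line ` P \<subseteq> I" and column_in: "column ` P \<subseteq> {..<J}"
    and line_column_inj: "inj_on (\<lambda>p. (line p, column p)) P"
    and column_degree: "\<And>j. j < J \<Longrightarrow> card {p \<in> P. column p = j} = h"
    and diagonal: "I = {..<J} \<or> D = 0" and D0: "0 \<le> D"
begin

definition entry_sum :: "'e set \<Rightarrow> (nat \<Rightarrow> real) \<Rightarrow> nat \<Rightarrow> real" where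
  "entry_sum E x i = D * x i + row_sum P line (\<lambda>p. sign_in E (edge p) * x (column p)) i"

definition norm2 :: "(nat \<Rightarrow> real) \<Rightarrow> real" where
  "norm2 x = (\<Sum>j<J. (x j)\<^sup>2)"

definition deviation :: "'e set \<Rightarrow> (nat \<Rightarrow> real) \<Rightarrow> real" where
  "deviation E x = (\<Sum>i\<in>I. (entry_sum E x i)\<^sup>2) - (D\<^sup>2 + real h) * norm2 x"

lemma row_sum_restrict: "row_sum P line f i = (\<Sum>p\<in>{p \<in> P. line p = i}. f p)"
  unfolding row_sum_def using finP by (simp add: sum.inter_filter)

lemma column_inj: "inj_on column {p \<in> P. line p = i}"
  using line_column_inj by (auto simp: inj_on_def)

text \<open>Within a row the edges meet different columns. Applied to squares this bounds the row
  weights of a vector of norm at most 1 by 1, as the tail bound demands.\<close>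

lemma row_sum_le:
  assumes "\<And>j. j < J \<Longrightarrow> 0 \<le> f j"
  shows "row_sum P line (\<lambda>p. f (column p)) i \<le> (\<Sum>j<J. f j)"
proof -
  have "row_sum P line (\<lambda>p. f (column p)) i = (\<Sum>j\<in>column ` {p \<in> P. line p = i}. f j)"
    unfolding row_sum_restrict sum.reindex[OF column_inj] by simp
  also have "\<dots> \<le> (\<Sum>j<J. f j)"
    using column_in assms by (intro sum_mono2) auto
  finally show ?thesis .
qed

lemma sum_row_sum: "(\<Sum>i\<in>I. row_sum P line (\<lambda>p. f (column p)) i) = real h * (\<Sum>j<J. f j)"
  for f :: "nat \<Rightarrow> real"
proof -
  have "(\<Sum>i\<in>I. row_sum P line (\<lambda>p. f (column p)) i) = (\<Sum>p\<in>P. f (column p))"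
    unfolding row_sum_restrict using sum.group[OF finP finI line_in] by fast
  also have "\<dots> = (\<Sum>j<J. \<Sum>p\<in>{p \<in> P. column p = j}. f (column p))"
    using sum.group[OF finP _ column_in, of "\<lambda>p. f (column p)"] by simp
  also have "\<dots> = (\<Sum>j<J. real h * f j)"
    by (intro sum.cong refl) (auto simp: column_degree)
  finally show ?thesis by (simp add: sum_distrib_left)
qed

lemma sum_diagonal: "(\<Sum>i\<in>I. (D * x i)\<^sup>2) = D\<^sup>2 * norm2 x"
  using diagonal by (auto simp: norm2_def power_mult_distrib sum_distrib_left)

text \<open>The left side is the expectation of the squared norm of the image: cross terms with
  independent signs average to zero and only squares remain.\<close>

lemma mean: "(\<Sum>i\<in>I. (D * x i)\<^sup>2 + row_sum P line (\<lambda>p. (x (column p))\<^sup>2) i) = (D\<^sup>2 + real h) * norm2 x"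
  unfolding sum.distrib sum_diagonal using sum_row_sum[of "\<lambda>j. (x j)\<^sup>2"]
  by (simp add: norm2_def algebra_simps)

lemma deviation_tail:
  assumes "norm2 x \<le> 1" "D\<^sup>2 + real h \<le> W" "0 < s" "s \<le> 2 * W"
  shows "real (card {E \<in> Pow Q. s \<le> \<bar>deviation E x\<bar>}) \<le> 2 * 2 ^ card Q * exp (- (s\<^sup>2 / (32 * W)))"
proof -
  define \<pi> where "\<pi> = inv_into P edge"
  \<comment> \<open>The tail bound is indexed by the random bits Q instead of the positions P: a bit
    that carries no entry gets weight 0, every other one inherits the coordinate of its unique
    position.\<close>
  define z where "z e = (if e \<in> edge ` P then x (column (\<pi> e)) else 0)" for e
  have \<pi>: "\<pi> (edge p) = p" if "p \<in> P" for p unfolding \<pi>_def using that edge_inj by simp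
  have transfer: "row_sum Q (line \<circ> \<pi>) f i = row_sum P line (\<lambda>p. f (edge p)) i"
    if "\<And>e. e \<notin> edge ` P \<Longrightarrow> f e = 0" for f i
  proof -
    have "row_sum Q (line \<circ> \<pi>) f i = (\<Sum>e\<in>edge ` P. if (line \<circ> \<pi>) e = i then f e else 0)"
      unfolding row_sum_def using that edge_in finQ by (intro sum.mono_neutral_right) auto
    also have "\<dots> = row_sum P line (\<lambda>p. f (edge p)) i"
      unfolding row_sum_def sum.reindex[OF edge_inj] by (intro sum.cong) (auto simp: \<pi>)
    finally show ?thesis .
  qed
  have *: "row_sum P line (\<lambda>p. g (edge p) (z (edge p))) i = row_sum P line (\<lambda>p. g (edge p) (x (column p))) i" for g i
    unfolding row_sum_def by (intro sum.cong) (auto simp: z_def \<pi>)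
  have sq: "row_sum Q (line \<circ> \<pi>) (\<lambda>e. (z e)\<^sup>2) i = row_sum P line (\<lambda>p. (x (column p))\<^sup>2) i" for i
    using transfer[of "\<lambda>e. (z e)\<^sup>2"] *[of "\<lambda>e t. t\<^sup>2"] by (simp add: z_def)
  have sg: "row_sum Q (line \<circ> \<pi>) (\<lambda>e. sign_in E e * z e) i
      = row_sum P line (\<lambda>p. sign_in E (edge p) * x (column p)) i" for E i
    using transfer[of "\<lambda>e. sign_in E e * z e"] *[of "\<lambda>e t. sign_in E e * t"] by (simp add: z_def)
  have "real (card {E \<in> Pow Q. s \<le> \<bar>(\<Sum>i\<in>I. (D * x i + row_sum Q (line \<circ> \<pi>) (\<lambda>e. sign_in E e * z e) i)\<^sup>2)
      - (\<Sum>i\<in>I. (D * x i)\<^sup>2 + row_sum Q (line \<circ> \<pi>) (\<lambda>e. (z e)\<^sup>2) i)\<bar>})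
    \<le> 2 * 2 ^ card Q * exp (- (s\<^sup>2 / (32 * W)))"
  proof (rule square_tail[OF finQ finI])
    show "row_sum Q (line \<circ> \<pi>) (\<lambda>e. (z e)\<^sup>2) i \<le> 1" for i
      unfolding sq using row_sum_le[of "\<lambda>j. (x j)\<^sup>2" i] assms(1) unfolding norm2_def by simp
    have "(D\<^sup>2 + real h) * norm2 x \<le> D\<^sup>2 + real h"
      using assms(1) by (simp add: mult_left_le)
    then show "(\<Sum>i\<in>I. (D * x i)\<^sup>2 + row_sum Q (line \<circ> \<pi>) (\<lambda>e. (z e)\<^sup>2) i) \<le> W"
      unfolding sq mean using assms(2) by linarith
  qed (use assms in auto)
  then show ?thesis unfolding sq sg mean deviation_def entry_sum_def .
qed

lemma norm2_scale: "norm2 (\<lambda>j. c * x j) = c\<^sup>2 * norm2 x"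
  by (simp add: norm2_def power_mult_distrib sum_distrib_left)

lemma deviation_scale: "deviation E (\<lambda>j. c * x j) = c\<^sup>2 * deviation E x"
proof -
  have "entry_sum E (\<lambda>j. c * x j) i = c * entry_sum E x i" for i
    unfolding entry_sum_def row_sum_restrict by (simp add: distrib_left sum_distrib_left mult.left_commute)
  then show ?thesis
    by (simp add: deviation_def norm2_scale power_mult_distrib sum_distrib_left algebra_simps)
qed

lemma entry_sum_le:
  assumes "\<And>j. j < J \<Longrightarrow> \<bar>x j\<bar> \<le> c" "0 \<le> c" "i \<in> I"
  shows "\<bar>entry_sum E x i\<bar> \<le> (D + real J) * c"
proof -
  have "\<bar>row_sum P line (\<lambda>p. sign_in E (edge p) * x (column p)) i\<bar>
    \<le> row_sum P line (\<lambda>p. \<bar>x (column p)\<bar>) i"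
    unfolding row_sum_restrict by (rule order.trans[OF sum_abs]) (auto simp: sign_in_def abs_mult intro!: sum_mono)
  also have "\<dots> \<le> (\<Sum>j<J. \<bar>x j\<bar>)" using row_sum_le[of "\<lambda>j. \<bar>x j\<bar>"] by simp
  also have "\<dots> \<le> (\<Sum>j<J. c)" using assms by (intro sum_mono) auto
  finally have 1: "\<bar>row_sum P line (\<lambda>p. sign_in E (edge p) * x (column p)) i\<bar> \<le> real J * c" by simp
  have "\<bar>D * x i\<bar> \<le> D * c"
    using diagonal
  proof
    assume "I = {..<J}"
    then show ?thesis using D0 assms by (simp add: abs_mult mult_left_mono)
  qed simp
  with 1 show ?thesis unfolding entry_sum_def distrib_right by linarith
qed

lemma entry_sum_diff: "entry_sum E (\<lambda>j. x j - y j) i = entry_sum E x i - entry_sum E y i"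
  unfolding entry_sum_def row_sum_restrict by (simp add: algebra_simps sum_subtractf)

text \<open>A Lipschitz constant in the maximum norm. A crude one will do, because the mesh of the
  grid enters the union bound only through k times its logarithm.\<close>

lemma deviation_close:
  assumes x: "\<And>j. j < J \<Longrightarrow> \<bar>x j\<bar> \<le> 1" and y: "\<And>j. j < J \<Longrightarrow> \<bar>y j\<bar> \<le> 1"
    and xy: "\<And>j. j < J \<Longrightarrow> \<bar>x j - y j\<bar> \<le> c" and c: "0 \<le> c"
  shows "\<bar>deviation E x - deviation E y\<bar>
    \<le> (2 * real (card I) * (D + real J)\<^sup>2 + 2 * (D\<^sup>2 + real h) * real J) * c"
proof -
  have sq: "\<bar>u\<^sup>2 - v\<^sup>2\<bar> \<le> (2 * b) * d" if "\<bar>u\<bar> \<le> b" "\<bar>v\<bar> \<le> b" "\<bar>u - v\<bar> \<le> d" for u v b d :: real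
  proof -
    have "\<bar>u\<^sup>2 - v\<^sup>2\<bar> = \<bar>u + v\<bar> * \<bar>u - v\<bar>" by (simp add: power2_eq_square algebra_simps flip: abs_mult)
    also have "\<dots> \<le> (2 * b) * d" using that by (intro mult_mono) auto
    finally show ?thesis .
  qed
  have "\<bar>(\<Sum>i\<in>I. (entry_sum E x i)\<^sup>2) - (\<Sum>i\<in>I. (entry_sum E y i)\<^sup>2)\<bar>
    \<le> (\<Sum>i\<in>I. \<bar>(entry_sum E x i)\<^sup>2 - (entry_sum E y i)\<^sup>2\<bar>)"
    unfolding sum_subtractf[symmetric] by (rule sum_abs)
  also have "\<dots> \<le> (\<Sum>i\<in>I. (2 * (D + real J)) * ((D + real J) * c))"
  proof (intro sum_mono sq)
    fix i assume i: "i \<in> I"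
    show "\<bar>entry_sum E x i\<bar> \<le> D + real J" using entry_sum_le[of x 1, OF x _ i] by simp
    show "\<bar>entry_sum E y i\<bar> \<le> D + real J" using entry_sum_le[of y 1, OF y _ i] by simp
    show "\<bar>entry_sum E x i - entry_sum E y i\<bar> \<le> (D + real J) * c"
      using entry_sum_le[of "\<lambda>j. x j - y j" c, OF xy c i] by (simp add: entry_sum_diff)
  qed
  finally have 1: "\<bar>(\<Sum>i\<in>I. (entry_sum E x i)\<^sup>2) - (\<Sum>i\<in>I. (entry_sum E y i)\<^sup>2)\<bar>
    \<le> 2 * real (card I) * (D + real J)\<^sup>2 * c" by (simp add: power2_eq_square algebra_simps)
  have "\<bar>norm2 x - norm2 y\<bar> \<le> (\<Sum>j<J. \<bar>(x j)\<^sup>2 - (y j)\<^sup>2\<bar>)"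
    unfolding norm2_def sum_subtractf[symmetric] by (rule sum_abs)
  also have "\<dots> \<le> (\<Sum>j<J. (2 * 1) * c)" using x y xy by (intro sum_mono sq) auto
  finally have "\<bar>norm2 x - norm2 y\<bar> \<le> 2 * real J * c" by simp
  then have "(D\<^sup>2 + real h) * \<bar>norm2 x - norm2 y\<bar> \<le> (D\<^sup>2 + real h) * (2 * real J * c)"
    by (intro mult_left_mono) auto
  then have 2: "\<bar>(D\<^sup>2 + real h) * norm2 x - (D\<^sup>2 + real h) * norm2 y\<bar> \<le> 2 * (D\<^sup>2 + real h) * real J * c"
    unfolding right_diff_distrib[symmetric] abs_mult by (simp add: mult_ac)
  show ?thesis using 1 2 unfolding deviation_def unfolding distrib_right by linarith
qed

text \<open>Both sides are homogeneous of degree 2, so x may be normalised. Rounding the unit vector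
  to the grid changes the deviation by at most 1, whence s + 1.\<close>

lemma deviation_grid:
  assumes grid: "\<And>y. y \<in> grid J k M \<Longrightarrow> norm2 y \<le> 1 \<Longrightarrow> \<bar>deviation E y\<bar> < s"
    and M: "2 * real (card I) * (D + real J)\<^sup>2 + 2 * (D\<^sup>2 + real h) * real J \<le> real M" "0 < M"
    and x: "sparse_on J k x"
  shows "\<bar>deviation E x\<bar> \<le> (s + 1) * norm2 x"
proof (cases "norm2 x = 0")
  case True
  then have "x j = 0" if "j < J" for j using that by (auto simp: norm2_def sum_nonneg_eq_0_iff)
  then have "entry_sum E x i = 0" if "i \<in> I" for i using entry_sum_le[of x 0 i E] that by simp
  then show ?thesis using True by (simp add: deviation_def)
next
  case False
  define r where "r = sqrt (norm2 x)"
  have "0 \<le> norm2 x" unfolding norm2_def by (simp add: sum_nonneg)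
  with False have r: "0 < r" "r\<^sup>2 = norm2 x" unfolding r_def by auto
  define u where "u = (\<lambda>j. inverse r * x j)"
  have "norm2 u = (inverse r)\<^sup>2 * norm2 x" unfolding u_def by (rule norm2_scale)
  also have "\<dots> = (inverse r * r)\<^sup>2" unfolding power_mult_distrib r(2) ..
  finally have nu: "norm2 u = 1" using r(1) by simp
  have u1: "\<bar>u j\<bar> \<le> 1" if "j < J" for j
  proof -
    have "(u j)\<^sup>2 \<le> norm2 u" unfolding norm2_def using that by (intro member_le_sum) auto
    then show ?thesis using nu by (simp add: abs_square_le_1)
  qed
  define w where "w j = (if j < J then trunc M (u j) else 0)" for j
  define y where "y = (\<lambda>j. of_int (w j) / real M)"
  have supp: "{j. w j \<noteq> 0} \<subseteq> {j. j < J \<and> x j \<noteq> 0}"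
    unfolding w_def using trunc(4)[OF M(2)] u1 by (auto simp: u_def)
  have "y \<in> grid J k M"
    unfolding grid_def y_def
  proof (intro CollectI exI[of _ w] conjI refl)
    show "{j. w j \<noteq> 0} \<subseteq> {..<J}" using supp by auto
    have "card {j. w j \<noteq> 0} \<le> card {j. j < J \<and> x j \<noteq> 0}" using supp by (intro card_mono) auto
    then show "card {j. w j \<noteq> 0} \<le> k" using x unfolding sparse_on_def by simp
    show "\<forall>j. \<bar>w j\<bar> \<le> int M" unfolding w_def using trunc(3)[OF M(2) u1] by auto
  qed
  moreover have yu: "\<bar>y j\<bar> \<le> \<bar>u j\<bar>" if "j < J" for j
    using trunc(2)[OF M(2) u1[OF that]] that unfolding y_def w_def by simp
  then have "norm2 y \<le> norm2 u" unfolding norm2_def by (intro sum_mono) (auto simp: abs_le_square_iff)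
  ultimately have "\<bar>deviation E y\<bar> < s" using grid nu by simp
  moreover have "\<bar>deviation E u - deviation E y\<bar>
      \<le> (2 * real (card I) * (D + real J)\<^sup>2 + 2 * (D\<^sup>2 + real h) * real J) * (1 / real M)"
  proof (rule deviation_close)
    fix j assume j: "j < J"
    show "\<bar>u j\<bar> \<le> 1" "\<bar>y j\<bar> \<le> 1" using u1[OF j] yu[OF j] by auto
    show "\<bar>u j - y j\<bar> \<le> 1 / real M"
      using trunc(1)[OF M(2) u1[OF j]] j unfolding y_def w_def by simp
  qed simp
  moreover have "\<dots> \<le> 1" using M by (simp add: field_simps)
  ultimately have "\<bar>deviation E u\<bar> \<le> s + 1" by linarith
  moreover have "x = (\<lambda>j. r * u j)" unfolding u_def using r by auto
  then have "deviation E x = r\<^sup>2 * deviation E u" using deviation_scale by metis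
  ultimately have "\<bar>deviation E x\<bar> \<le> r\<^sup>2 * (s + 1)" by (simp add: abs_mult mult_left_mono)
  then show ?thesis using r(2) by (simp add: mult.commute)
qed

lemma deviation_union:
  assumes W: "D\<^sup>2 + real h \<le> W" and s: "0 < s" "s \<le> 2 * W"
    and M: "2 * real (card I) * (D + real J)\<^sup>2 + 2 * (D\<^sup>2 + real h) * real J \<le> real M" "0 < M"
  shows "real (card {E \<in> Pow Q. \<exists>x. sparse_on J k x \<and> (s + 1) * norm2 x < \<bar>deviation E x\<bar>})
    \<le> real (J * (2 * M + 1)) ^ k * (2 * 2 ^ card Q * exp (- (s\<^sup>2 / (32 * W))))"
proof -
  define G where "G = {y \<in> grid J k M. norm2 y \<le> 1}"
  define B where "B y = {E \<in> Pow Q. s \<le> \<bar>deviation E y\<bar>}" for y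
  have G: "finite G" "card G \<le> (J * (2 * M + 1)) ^ k"
    using grid_card[OF J0, of k M] unfolding G_def by (auto intro: le_trans[OF card_mono])
  have "{E \<in> Pow Q. \<exists>x. sparse_on J k x \<and> (s + 1) * norm2 x < \<bar>deviation E x\<bar>} \<subseteq> (\<Union>y\<in>G. B y)"
  proof
    fix E assume "E \<in> {E \<in> Pow Q. \<exists>x. sparse_on J k x \<and> (s + 1) * norm2 x < \<bar>deviation E x\<bar>}"
    then obtain x where E: "E \<in> Pow Q" and x: "sparse_on J k x" "(s + 1) * norm2 x < \<bar>deviation E x\<bar>" by blast
    have "\<not> (\<forall>y. y \<in> grid J k M \<longrightarrow> norm2 y \<le> 1 \<longrightarrow> \<bar>deviation E y\<bar> < s)"
      using deviation_grid[OF _ M x(1), of E s] x(2) by force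
    then show "E \<in> (\<Union>y\<in>G. B y)" unfolding G_def B_def using E by force
  qed
  then have "card {E \<in> Pow Q. \<exists>x. sparse_on J k x \<and> (s + 1) * norm2 x < \<bar>deviation E x\<bar>} \<le> card (\<Union>y\<in>G. B y)"
    using G(1) finQ by (intro card_mono finite_UN_I) (auto simp: B_def)
  also have "\<dots> \<le> (\<Sum>y\<in>G. card (B y))" using G(1) by (rule card_UN_le)
  finally have "real (card {E \<in> Pow Q. \<exists>x. sparse_on J k x \<and> (s + 1) * norm2 x < \<bar>deviation E x\<bar>})
    \<le> (\<Sum>y\<in>G. real (card (B y)))" by (simp flip: of_nat_sum)
  also have "\<dots> \<le> (\<Sum>y\<in>G. 2 * 2 ^ card Q * exp (- (s\<^sup>2 / (32 * W))))"
    using deviation_tail[OF _ W s] unfolding B_def G_def by (intro sum_mono) auto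
  also have "\<dots> = real (card G) * (2 * 2 ^ card Q * exp (- (s\<^sup>2 / (32 * W))))" by simp
  also have "\<dots> \<le> real ((J * (2 * M + 1)) ^ k) * (2 * 2 ^ card Q * exp (- (s\<^sup>2 / (32 * W))))"
    using G(2) by (intro mult_right_mono of_nat_mono) auto
  finally show ?thesis by simp
qed

end

subsection \<open>The matrices of the reduction\<close>

definition vertex_pairs :: "nat \<Rightarrow> nat set set" where
  "vertex_pairs n = {{u, v} | u v. u < n \<and> v < n \<and> u \<noteq> v}"

lemma finite_vertex_pairs: "finite (vertex_pairs n)"
proof -
  have "vertex_pairs n \<subseteq> (\<lambda>(u, v). {u, v}) ` ({..<n} \<times> {..<n})" unfolding vertex_pairs_def by auto
  then show ?thesis by (rule finite_subset) auto
qed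

lemma two_half_less: "0 < n \<Longrightarrow> 2 * half n < n"
  by (auto simp: half_def)

lemma shift_mod: "i < n \<Longrightarrow> d < n \<Longrightarrow> (i + d) mod n = (if i + d < n then i + d else i + d - n)" for n :: nat
  by (auto simp: le_mod_geq)

lemma gap_mod: "r < n \<Longrightarrow> c < n \<Longrightarrow> (c + n - r) mod n = (if r \<le> c then c - r else c + n - r)" for n :: nat
  by (auto simp: le_mod_geq)

text \<open>If the two pairs agreed with their ends exchanged, d + d' would be a multiple of n, but
  it lies strictly between 0 and n.\<close>

lemma shift_pair_inj:
  assumes "i < n" "i' < n" "d \<in> {1..half n}" "d' \<in> {1..half n}"
    and eq: "{i, (i + d) mod n} = {i', (i' + d') mod n}"
  shows "i = i' \<and> d = d'"
proof -
  have d: "d < n" "d' < n" "0 < d" "0 < d'" "d + d' < n" using assms two_half_less[of n] by auto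
  from eq have "(i = i' \<and> (i + d) mod n = (i' + d') mod n) \<or> (i = (i' + d') mod n \<and> (i + d) mod n = i')"
    by (auto simp: doubleton_eq_iff)
  then show ?thesis
    using d assms(1,2) unfolding shift_mod[OF assms(1) d(1)] shift_mod[OF assms(2) d(2)]
    by (auto split: if_splits)
qed

lemma shift_pair_in:
  assumes "i < n" "d \<in> {1..half n}"
  shows "{i, (i + d) mod n} \<in> vertex_pairs n"
proof -
  have d: "d < n" "0 < d" using assms two_half_less[of n] by auto
  have "i \<noteq> (i + d) mod n" unfolding shift_mod[OF assms(1) d(1)] using d assms(1) by auto
  moreover have "(i + d) mod n < n" using assms(1) by simp
  ultimately show ?thesis unfolding vertex_pairs_def using assms(1) by blast
qed

lemma graph_sign_matrix:
  assumes "0 < n" "0 \<le> D"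
  shows "sign_matrix {..<n} n ({..<n} \<times> {1..half n}) fst (\<lambda>(i, d). (i + d) mod n)
    (\<lambda>(i, d). {i, (i + d) mod n}) (vertex_pairs n) D (half n)"
proof
  show "inj_on (\<lambda>(i, d). {i, (i + d) mod n}) ({..<n} \<times> {1..half n})"
    using shift_pair_inj[of _ n] by (auto simp: inj_on_def)
  show "(\<lambda>(i, d). {i, (i + d) mod n}) ` ({..<n} \<times> {1..half n}) \<subseteq> vertex_pairs n"
    using shift_pair_in[of _ n] by auto
  show "inj_on (\<lambda>p. (fst p, case p of (i, d) \<Rightarrow> (i + d) mod n)) ({..<n} \<times> {1..half n})"
    using shift_pair_inj[of _ n] by (force simp: inj_on_def)
  fix j assume j: "j < n"
  \<comment> \<open>In a fixed column each distance d determines the row, so a column meets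
    \<open>half n\<close> edges.\<close>
  have *: "(i + d) mod n = j \<longleftrightarrow> i = (j + n - d) mod n" if "i < n" "d \<in> {1..half n}" for i d
  proof -
    have d: "d < n" using that two_half_less[of n] by auto
    show ?thesis unfolding shift_mod[OF that(1) d] gap_mod[OF d j] using that(1) j d by auto
  qed
  have "{p \<in> {..<n} \<times> {1..half n}. (case p of (i, d) \<Rightarrow> (i + d) mod n) = j}
    = {p \<in> {..<n} \<times> {1..half n}. fst p = (j + n - snd p) mod n}"
  proof (intro Collect_cong conj_cong refl)
    fix p assume "p \<in> {..<n} \<times> {1..half n}"
    then show "(case p of (i, d) \<Rightarrow> (i + d) mod n) = j \<longleftrightarrow> fst p = (j + n - snd p) mod n"
      unfolding case_prod_beta mem_Times_iff lessThan_iff using *[of "fst p" "snd p"] by blast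
  qed
  also have "\<dots> = (\<lambda>d. ((j + n - d) mod n, d)) ` {1..half n}"
    using assms(1) by (auto simp: image_iff)
  finally have "{p \<in> {..<n} \<times> {1..half n}. (case p of (i, d) \<Rightarrow> (i + d) mod n) = j}
    = (\<lambda>d. ((j + n - d) mod n, d)) ` {1..half n}" .
  moreover have "inj_on (\<lambda>d. ((j + n - d) mod n, d)) {1..half n}" by (auto simp: inj_on_def)
  ultimately show "card {p \<in> {..<n} \<times> {1..half n}. (case p of (i, d) \<Rightarrow> (i + d) mod n) = j} = half n"
    by (simp add: card_image)
qed (use assms finite_vertex_pairs in auto)

definition pad_edge :: "nat \<Rightarrow> nat \<Rightarrow> nat \<Rightarrow> nat set" where
  "pad_edge n p q = {q mod n, (q mod n + 1 + 99 * p + q div n) mod n}"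

lemma pad_edge_eq: "pad_edge n p q = {q mod n, (q mod n + (1 + 99 * p + q div n)) mod n}"
  by (simp add: pad_edge_def add.assoc)

text \<open>The distance is at most 99 v^2, and 324 v^2 \<le> h.\<close>

lemma pad_shift_in:
  assumes "0 < n" "p < (scale n)\<^sup>2" "q < 99 * n"
  shows "1 + 99 * p + q div n \<in> {1..half n}"
proof -
  have "q div n < 99" using assms by (simp add: less_mult_imp_div_less)
  then have "1 + 99 * p + q div n \<le> 99 * (scale n)\<^sup>2" using assms(2) by linarith
  then show ?thesis using scale_le[of n] by simp
qed

text \<open>The pair of vertices determines the position: its first vertex is q mod n, and the
  distance minus 1, written in base 99, has last digit q div n and leading part p.\<close>

lemma pad_sign_matrix:
  assumes "0 < n"
  shows "sign_matrix {..<(scale n)\<^sup>2} (99 * n) ({..<(scale n)\<^sup>2} \<times> {..<99 * n}) fst snd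
    (\<lambda>(p, q). pad_edge n p q) (vertex_pairs n) 0 ((scale n)\<^sup>2)"
proof
  have "p = p' \<and> q = q'" if "p < (scale n)\<^sup>2" "p' < (scale n)\<^sup>2" "q < 99 * n" "q' < 99 * n"
    "pad_edge n p q = pad_edge n p' q'" for p p' q q'
  proof -
    have eq: "q mod n = q' mod n \<and> 1 + 99 * p + q div n = 1 + 99 * p' + q' div n"
      using that assms unfolding pad_edge_eq
      by (intro shift_pair_inj[of _ n] pad_shift_in) auto
    have "q div n < 99" "q' div n < 99" using that by (simp_all add: less_mult_imp_div_less)
    moreover have "u = u' \<and> a = a'" if "99 * u + a = 99 * u' + a'" "a < 99" "a' < 99" for u u' a a' :: nat
    proof -
      have "u = (99 * u + a) div 99" "a = (99 * u + a) mod 99" using that(2) by simp_all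
      moreover have "u' = (99 * u' + a') div 99" "a' = (99 * u' + a') mod 99" using that(3) by simp_all
      ultimately show ?thesis using that(1) by metis
    qed
    ultimately have "p = p'" "q div n = q' div n" using eq by auto
    with eq show ?thesis by (metis mod_div_mult_eq)
  qed
  then show "inj_on (\<lambda>(p, q). pad_edge n p q) ({..<(scale n)\<^sup>2} \<times> {..<99 * n})"
    by (auto simp: inj_on_def)
  show "(\<lambda>(p, q). pad_edge n p q) ` ({..<(scale n)\<^sup>2} \<times> {..<99 * n}) \<subseteq> vertex_pairs n"
    unfolding pad_edge_eq using shift_pair_in[OF _ pad_shift_in[OF assms]] assms by auto
  fix j assume "j < 99 * n"
  then have "{p \<in> {..<(scale n)\<^sup>2} \<times> {..<99 * n}. snd p = j} = {..<(scale n)\<^sup>2} \<times> {j}" by auto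
  then show "card {p \<in> {..<(scale n)\<^sup>2} \<times> {..<99 * n}. snd p = j} = (scale n)\<^sup>2"
    by (simp add: card_cartesian_product)
qed (use assms finite_vertex_pairs in \<open>auto simp: inj_on_def\<close>)

section \<open>Good events for the two blocks\<close>

definition graph_row :: "nat \<Rightarrow> nat set set \<Rightarrow> (nat \<Rightarrow> real) \<Rightarrow> nat \<Rightarrow> real" where
  "graph_row n E x i = (\<Sum>d\<in>{1..half n}. sign_in E {i, (i + d) mod n} * x ((i + d) mod n))"

definition pad_row :: "nat \<Rightarrow> nat set set \<Rightarrow> (nat \<Rightarrow> real) \<Rightarrow> nat \<Rightarrow> real" where
  "pad_row n E x p = (\<Sum>q<99 * n. sign_in E (pad_edge n p q) * x q)"

text \<open>The upper left block is multiplied by 30 v to clear denominators: the diagonal becomes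
  24 v, and a column has squared length 576 v^2 + h.\<close>

definition graph_good :: "nat \<Rightarrow> nat \<Rightarrow> real \<Rightarrow> nat set set \<Rightarrow> bool" where
  "graph_good n k s E \<longleftrightarrow> (\<forall>x. sparse_on n k x \<longrightarrow>
    \<bar>(\<Sum>i<n. (24 * rscale n * x i + graph_row n E x i)\<^sup>2)
      - (576 * (rscale n)\<^sup>2 + real (half n)) * (\<Sum>j<n. (x j)\<^sup>2)\<bar> \<le> s * (\<Sum>j<n. (x j)\<^sup>2))"

definition pad_good :: "nat \<Rightarrow> nat \<Rightarrow> real \<Rightarrow> nat set set \<Rightarrow> bool" where
  "pad_good n k s E \<longleftrightarrow> (\<forall>x. sparse_on (99 * n) k x \<longrightarrow>
    \<bar>(\<Sum>p<(scale n)\<^sup>2. (pad_row n E x p)\<^sup>2) - (rscale n)\<^sup>2 * (\<Sum>j<99 * n. (x j)\<^sup>2)\<bar>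
      \<le> s * (\<Sum>j<99 * n. (x j)\<^sup>2))"

lemma card_not_graph_good:
  assumes "0 < n" and s: "0 < s" "s \<le> 2 * W" and W: "576 * (rscale n)\<^sup>2 + real (half n) \<le> W"
    and M: "2 * real n * (24 * rscale n + real n)\<^sup>2 + 2 * (576 * (rscale n)\<^sup>2 + real (half n)) * real n \<le> real M" "0 < M"
  shows "real (card {E \<in> Pow (vertex_pairs n). \<not> graph_good n k (s + 1) E})
    \<le> real (n * (2 * M + 1)) ^ k * (2 * 2 ^ card (vertex_pairs n) * exp (- (s\<^sup>2 / (32 * W))))"
proof -
  interpret G: sign_matrix "{..<n}" n "{..<n} \<times> {1..half n}" fst "\<lambda>(i, d). (i + d) mod n"
    "\<lambda>(i, d). {i, (i + d) mod n}" "vertex_pairs n" "24 * rscale n" "half n"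
    using assms(1) by (intro graph_sign_matrix) auto
  have D: "(24 * rscale n)\<^sup>2 = 576 * (rscale n)\<^sup>2" by (simp add: power_mult_distrib)
  have row: "G.entry_sum E x i = 24 * rscale n * x i + graph_row n E x i" if "i < n" for E x i
  proof -
    have "{p \<in> {..<n} \<times> {1..half n}. fst p = i} = Pair i ` {1..half n}" using that by auto
    then show ?thesis
      unfolding G.entry_sum_def G.row_sum_restrict graph_row_def by (simp add: sum.reindex inj_on_def)
  qed
  have good: "graph_good n k (s + 1) E \<longleftrightarrow> (\<forall>x. sparse_on n k x \<longrightarrow> \<bar>G.deviation E x\<bar> \<le> (s + 1) * G.norm2 x)" for E
    unfolding graph_good_def G.deviation_def G.norm2_def D using row by simp
  show ?thesis
    using G.deviation_union[of W s M k] s W M unfolding good D by (simp add: not_le Bex_def)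
qed

lemma card_not_pad_good:
  assumes "0 < n" and s: "0 < s" "s \<le> 2 * W" and W: "(rscale n)\<^sup>2 \<le> W"
    and M: "2 * (rscale n)\<^sup>2 * (real (99 * n))\<^sup>2 + 2 * (rscale n)\<^sup>2 * real (99 * n) \<le> real M" "0 < M"
  shows "real (card {E \<in> Pow (vertex_pairs n). \<not> pad_good n k (s + 1) E})
    \<le> real (99 * n * (2 * M + 1)) ^ k * (2 * 2 ^ card (vertex_pairs n) * exp (- (s\<^sup>2 / (32 * W))))"
proof -
  interpret G: sign_matrix "{..<(scale n)\<^sup>2}" "99 * n" "{..<(scale n)\<^sup>2} \<times> {..<99 * n}" fst snd
    "\<lambda>(p, q). pad_edge n p q" "vertex_pairs n" 0 "(scale n)\<^sup>2"
    using assms(1) by (rule pad_sign_matrix)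
  have row: "G.entry_sum E x p = pad_row n E x p" if "p < (scale n)\<^sup>2" for E x p
  proof -
    have "{p' \<in> {..<(scale n)\<^sup>2} \<times> {..<99 * n}. fst p' = p} = Pair p ` {..<99 * n}" using that by auto
    then show ?thesis
      unfolding G.entry_sum_def G.row_sum_restrict pad_row_def by (simp add: sum.reindex inj_on_def)
  qed
  have good: "pad_good n k (s + 1) E \<longleftrightarrow> (\<forall>x. sparse_on (99 * n) k x \<longrightarrow> \<bar>G.deviation E x\<bar> \<le> (s + 1) * G.norm2 x)" for E
    unfolding pad_good_def G.deviation_def G.norm2_def using row by simp
  show ?thesis
    using G.deviation_union[of W s M k] s W M unfolding good by (simp add: not_le Bex_def)
qed

lemma real_bit_sign: "real_of_int (bit_sign E i j) = sign_in E {i, j}"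
  by (simp add: bit_sign_def sign_in_def)

text \<open>Negating the signs amounts to passing to the complement, which is again a uniformly
  random graph; one deviation bound therefore serves both matrices.\<close>

definition oriented :: "nat \<Rightarrow> nat set set \<Rightarrow> int \<Rightarrow> nat set set" where
  "oriented n E g = (if g = 1 then E else vertex_pairs n - E)"

lemma norm_sq_mult_mat_vec:
  assumes "x \<in> carrier_vec (dim_col A)"
  shows "norm_sq (A *\<^sub>v x) = (\<Sum>i<dim_row A. (\<Sum>j<dim_col A. A $$ (i, j) * x $ j)\<^sup>2)"
proof -
  have dx: "dim_vec x = dim_col A" using assms by auto
  show ?thesis by (simp add: norm_sq_sum scalar_prod_def atLeast0LessThan dx row_def)
qed

lemma rip_mat_graph_row:
  assumes v: "0 < scale n" and g: "g = 1 \<or> g = - 1" and r: "r < n"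
  shows "(\<Sum>c<100 * n. of_rat (rip_mat n E g $$ (r, c)) * x c)
    = (24 * rscale n * x r + graph_row n (oriented n E g) x r) / (30 * rscale n)"
proof -
  define a where "a c = (of_rat (rip_mat n E g $$ (r, c)) :: real)" for c
  have n: "0 < n" using r by simp
  have a: "a c = real_of_int (fst (entry n E g r c)) / real_of_int (snd (entry n E g r c))" if "c < 100 * n" for c
    using that r v by (simp add: a_def rip_mat_def of_rat_rat entry_def)
  have a0: "a c = 0" if "n \<le> c" "c < 100 * n" for c
    using that r unfolding a[OF that(2)] by (simp add: entry_def)
  have a1: "a r = 4 / 5" using r by (simp add: a entry_def)
  \<comment> \<open>Columns are reparametrised by their cyclic distance d from the row: d = 0 is the
    diagonal, d up to h carries signs, and larger d carry zeros.\<close>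
  have S: "{..<n} = insert r (((\<lambda>d. (r + d) mod n) ` {1..half n}) \<union> ((\<lambda>d. (r + d) mod n) ` {half n<..<n}))"
  proof (intro equalityI subsetI)
    fix c assume "c \<in> {..<n}"
    then have c: "c < n" by simp
    define d where "d = (c + n - r) mod n"
    have d: "d < n" "(r + d) mod n = c"
      unfolding d_def gap_mod[OF r c] using r c by (auto simp: le_mod_geq)
    have "d = 0 \<or> d \<in> {1..half n} \<or> d \<in> {half n<..<n}" using d(1) by auto
    then show "c \<in> insert r (((\<lambda>d. (r + d) mod n) ` {1..half n}) \<union> ((\<lambda>d. (r + d) mod n) ` {half n<..<n}))"
      using d(2) r by (auto simp: image_iff)
  qed (use r in auto)
  have gap: "((r + d) mod n + n - r) mod n = d" if "d < n" for d
  proof -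
    have l: "(r + d) mod n < n" using n by simp
    show ?thesis unfolding gap_mod[OF r l] unfolding shift_mod[OF r that] using that r by auto
  qed
  have inj: "inj_on (\<lambda>d. (r + d) mod n) {..<n}"
    by (rule inj_on_inverseI[where g = "\<lambda>c. (c + n - r) mod n"]) (use gap in auto)
  have hn: "half n < n" using two_half_less[OF n] by simp
  have a2: "a ((r + d) mod n) = sign_in (oriented n E g) {r, (r + d) mod n} / (30 * rscale n)"
    if "d \<in> {1..half n}" for d
  proof -
    have d: "d < n" using that hn by simp
    have "(r + d) mod n < n" using n by simp
    moreover have "(r + d) mod n < 100 * n" using calculation by linarith
    moreover have "real_of_int (g * bit_sign E r ((r + d) mod n)) = sign_in (oriented n E g) {r, (r + d) mod n}"
      using shift_pair_in[OF r that] g by (auto simp: real_bit_sign oriented_def sign_in_def)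
    ultimately show ?thesis
      using that r gap[OF d] by (simp add: a entry_def)
  qed
  have a3: "a ((r + d) mod n) = 0" if "d \<in> {half n<..<n}" for d
  proof -
    have d: "d < n" using that by simp
    have "(r + d) mod n < n" using n by simp
    moreover have "(r + d) mod n < 100 * n" using calculation by linarith
    ultimately show ?thesis using that r gap[OF d] by (simp add: a entry_def)
  qed
  have "(\<Sum>c<100 * n. a c * x c) = (\<Sum>c<n. a c * x c)"
    using a0 by (intro sum.mono_neutral_right) auto
  also have "\<dots> = a r * x r + (\<Sum>c\<in>((\<lambda>d. (r + d) mod n) ` {1..half n}) \<union> ((\<lambda>d. (r + d) mod n) ` {half n<..<n}). a c * x c)"
  proof -
    have "r \<noteq> (r + d) mod n" if "0 < d" "d < n" for d
      unfolding shift_mod[OF r that(2)] using that r by auto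
    then have "r \<notin> ((\<lambda>d. (r + d) mod n) ` {1..half n}) \<union> ((\<lambda>d. (r + d) mod n) ` {half n<..<n})"
      using hn by auto
    then show ?thesis by (subst S, subst sum.insert) auto
  qed
  also have "(\<Sum>c\<in>((\<lambda>d. (r + d) mod n) ` {1..half n}) \<union> ((\<lambda>d. (r + d) mod n) ` {half n<..<n}). a c * x c)
    = (\<Sum>c\<in>(\<lambda>d. (r + d) mod n) ` {1..half n}. a c * x c)"
    using a3 by (intro sum.mono_neutral_right) auto
  also have "\<dots> = (\<Sum>d\<in>{1..half n}. a ((r + d) mod n) * x ((r + d) mod n))"
    by (subst sum.reindex) (use inj hn in \<open>auto intro: inj_on_subset\<close>)
  also have "\<dots> = graph_row n (oriented n E g) x r / (30 * rscale n)"
    unfolding graph_row_def sum_divide_distrib by (intro sum.cong refl) (simp add: a2)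
  finally show ?thesis unfolding a_def[symmetric] a1 using v by (simp add: add_divide_distrib)
qed

lemma sum_shift_bounds: "(\<Sum>c<n + m. f c) = (\<Sum>c<n. f c) + (\<Sum>q<m. f (n + q))" for f :: "nat \<Rightarrow> 'a :: comm_monoid_add"
  using sum.atLeastLessThan_concat[of 0 n "n + m" f] sum.shift_bounds_nat_ivl[of f 0 n m]
  by (simp add: atLeast0LessThan add.commute)

lemma rip_mat_pad_row:
  assumes v: "0 < scale n" and p: "p < n"
  shows "(\<Sum>c<100 * n. of_rat (rip_mat n E g $$ (n + p, c)) * x c)
    = (if p < (scale n)\<^sup>2 then pad_row n E (\<lambda>q. x (n + q)) p / rscale n else 0)"
proof -
  define a where "a c = (of_rat (rip_mat n E g $$ (n + p, c)) :: real)" for c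
  have a: "a c = real_of_int (fst (entry n E g (n + p) c)) / real_of_int (snd (entry n E g (n + p) c))" if "c < 100 * n" for c
    using that p v by (simp add: a_def rip_mat_def of_rat_rat entry_def)
  have a0: "a c = 0" if "c < n" for c using that by (simp add: a entry_def)
  have a1: "a (n + q) = (if p < (scale n)\<^sup>2 then sign_in E (pad_edge n p q) / rscale n else 0)" if "q < 99 * n" for q
    using that by (simp add: a entry_def real_bit_sign pad_edge_def)
  have "(\<Sum>c<100 * n. a c * x c) = (\<Sum>c<n. a c * x c) + (\<Sum>q<99 * n. a (n + q) * x (n + q))"
    using sum_shift_bounds[of "\<lambda>c. a c * x c" n "99 * n"] by simp
  also have "(\<Sum>c<n. a c * x c) = 0" using a0 by simp
  also have "(\<Sum>q<99 * n. a (n + q) * x (n + q))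
    = (if p < (scale n)\<^sup>2 then pad_row n E (\<lambda>q. x (n + q)) p / rscale n else 0)"
    using a1 by (simp add: pad_row_def sum_divide_distrib)
  finally show ?thesis unfolding a_def by simp
qed

lemma norm_sq_rip_mat:
  assumes v: "0 < scale n" and g: "g = 1 \<or> g = - 1" and x: "x \<in> carrier_vec (100 * n)"
  shows "norm_sq (map_mat of_rat (rip_mat n E g) *\<^sub>v x) =
    (\<Sum>i<n. (24 * rscale n * x $ i + graph_row n (oriented n E g) (\<lambda>j. x $ j) i)\<^sup>2) / (900 * (rscale n)\<^sup>2)
    + (\<Sum>p<(scale n)\<^sup>2. (pad_row n E (\<lambda>q. x $ (n + q)) p)\<^sup>2) / (rscale n)\<^sup>2"
proof -
  have d: "dim_row (rip_mat n E g) = 2 * n" "dim_col (rip_mat n E g) = 100 * n" by (auto simp: rip_mat_def)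
  define R where "R i = (\<Sum>j<100 * n. of_rat (rip_mat n E g $$ (i, j)) * x $ j)" for i
  have vn: "(scale n)\<^sup>2 \<le> n" using scale_le[of n] by (auto simp: half_def)
  have "norm_sq (map_mat of_rat (rip_mat n E g) *\<^sub>v x) = (\<Sum>i<2 * n. (R i)\<^sup>2)"
    using x unfolding R_def by (subst norm_sq_mult_mat_vec) (auto simp: d)
  also have "\<dots> = (\<Sum>i<n. (R i)\<^sup>2) + (\<Sum>p<n. (R (n + p))\<^sup>2)"
    using sum_shift_bounds[of "\<lambda>i. (R i)\<^sup>2" n n] by (simp add: mult_2)
  also have "(\<Sum>i<n. (R i)\<^sup>2) = (\<Sum>i<n. (24 * rscale n * x $ i + graph_row n (oriented n E g) (\<lambda>j. x $ j) i)\<^sup>2) / (900 * (rscale n)\<^sup>2)"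
    unfolding sum_divide_distrib R_def
    by (intro sum.cong refl) (simp add: rip_mat_graph_row[OF v g] power_divide power_mult_distrib)
  also have "(\<Sum>p<n. (R (n + p))\<^sup>2) = (\<Sum>p<(scale n)\<^sup>2. (R (n + p))\<^sup>2)"
    using vn by (intro sum.mono_neutral_right) (auto simp: R_def rip_mat_pad_row[OF v])
  also have "\<dots> = (\<Sum>p<(scale n)\<^sup>2. (pad_row n E (\<lambda>q. x $ (n + q)) p)\<^sup>2) / (rscale n)\<^sup>2"
    unfolding sum_divide_distrib R_def using vn
    by (intro sum.cong refl) (simp add: rip_mat_pad_row[OF v] power_divide)
  finally show ?thesis .
qed

text \<open>The matrix is block diagonal, so a k-sparse vector splits into two k-sparse parts whose
  errors add up as their squared norms do. In the first block 576 v^2 + h takes the place of the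
  ideal 900 v^2; the excess h - 324 v^2 is the error of normalisation.\<close>

lemma rip_upper:
  assumes v: "0 < scale n" and g: "g = 1 \<or> g = - 1"
    and G: "graph_good n k s (oriented n E g)" and P: "pad_good n k s E"
    and s: "(real (half n) - 324 * (rscale n)\<^sup>2 + s) / (900 * (rscale n)\<^sup>2) \<le> \<delta>"
      "s / (rscale n)\<^sup>2 \<le> \<delta>" "0 \<le> s"
  shows "rip_of k (rip_mat n E g) \<le> \<delta>"
proof -
  define V where "V = (rscale n)\<^sup>2"
  have V: "0 < V" using v by (simp add: V_def)
  have \<delta>: "0 \<le> \<delta>" using s(2,3) by (meson divide_nonneg_nonneg order.trans zero_le_power2)
  have "324 * V \<le> real (half n)"
  proof -
    have "real (324 * (scale n)\<^sup>2) \<le> real (half n)" using scale_le[of n] by (simp only: of_nat_le_iff)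
    then show ?thesis by (simp add: V_def)
  qed
  have "has_rip (map_mat of_rat (rip_mat n E g)) k \<delta>"
    unfolding has_rip_def
  proof (intro ballI impI)
    fix x :: "real vec"
    assume "x \<in> carrier_vec (dim_col (map_mat of_rat (rip_mat n E g) :: real mat))" and sp: "sparse_vec k x"
    then have x: "x \<in> carrier_vec (100 * n)" by (simp add: rip_mat_def)
    define y z where "y = (\<lambda>j. x $ j)" and "z = (\<lambda>q. x $ (n + q))"
    define Y Z where "Y = (\<Sum>j<n. (y j)\<^sup>2)" and "Z = (\<Sum>j<99 * n. (z j)\<^sup>2)"
    define U where "U = (\<Sum>i<n. (24 * rscale n * y i + graph_row n (oriented n E g) y i)\<^sup>2)"
    define T where "T = (\<Sum>p<(scale n)\<^sup>2. (pad_row n E z p)\<^sup>2)"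
    have YZ: "0 \<le> Y" "0 \<le> Z" by (simp_all add: Y_def Z_def sum_nonneg)
    have N: "norm_sq x = Y + Z"
      using x sum_shift_bounds[of "\<lambda>j. (x $ j)\<^sup>2" n "99 * n"] by (simp add: norm_sq_sum Y_def Z_def y_def z_def)
    have A: "norm_sq (map_mat of_rat (rip_mat n E g) *\<^sub>v x) = U / (900 * V) + T / V"
      unfolding norm_sq_rip_mat[OF v g x] U_def T_def V_def y_def z_def ..
    have supp: "card {i. i < 100 * n \<and> x $ i \<noteq> 0} \<le> k" using sp x by (simp add: sparse_vec_def)
    have "card {j. j < n \<and> y j \<noteq> 0} \<le> card {i. i < 100 * n \<and> x $ i \<noteq> 0}"
      by (intro card_mono) (auto simp: y_def)
    then have "sparse_on n k y" using supp by (simp add: sparse_on_def)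
    then have u: "\<bar>U - (576 * V + real (half n)) * Y\<bar> \<le> s * Y"
      using G unfolding graph_good_def U_def V_def Y_def by blast
    have "card {j. j < 99 * n \<and> z j \<noteq> 0} \<le> card {i. i < 100 * n \<and> x $ i \<noteq> 0}"
      by (rule card_inj_on_le[where f = "\<lambda>j. n + j"]) (auto simp: z_def)
    then have "sparse_on (99 * n) k z" using supp by (simp add: sparse_on_def)
    then have t: "\<bar>T - V * Z\<bar> \<le> s * Z"
      using P unfolding pad_good_def T_def V_def Z_def by blast
    have "\<bar>U - 900 * V * Y\<bar> \<le> (real (half n) - 324 * V + s) * Y"
    proof -
      have "U - 900 * V * Y = (U - (576 * V + real (half n)) * Y) + (real (half n) - 324 * V) * Y"
        by (simp add: algebra_simps)
      moreover have "0 \<le> (real (half n) - 324 * V) * Y" using YZ \<open>324 * V \<le> real (half n)\<close> by simp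
      ultimately show ?thesis using u by (simp add: distrib_right)
    qed
    then have "\<bar>U - 900 * V * Y\<bar> / (900 * V) \<le> (real (half n) - 324 * V + s) * Y / (900 * V)"
      using V by (intro divide_right_mono) auto
    also have "\<dots> = (real (half n) - 324 * V + s) / (900 * V) * Y" by simp
    also have "\<dots> \<le> \<delta> * Y" using s(1) YZ unfolding V_def[symmetric] by (intro mult_right_mono)
    finally have "\<bar>(U - 900 * V * Y) / (900 * V)\<bar> \<le> \<delta> * Y" using V by simp
    then have 1: "\<bar>U / (900 * V) - Y\<bar> \<le> \<delta> * Y" using V by (simp add: diff_divide_distrib)
    have "\<bar>T - V * Z\<bar> / V \<le> s / V * Z" using t V by (simp add: field_simps)
    also have "\<dots> \<le> \<delta> * Z" using s(2) YZ unfolding V_def[symmetric] by (intro mult_right_mono)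
    finally have "\<bar>(T - V * Z) / V\<bar> \<le> \<delta> * Z" using V by simp
    then have 2: "\<bar>T / V - Z\<bar> \<le> \<delta> * Z" using V by (simp add: diff_divide_distrib)
    show "(1 - \<delta>) * norm_sq x \<le> norm_sq (map_mat of_rat (rip_mat n E g) *\<^sub>v x) \<and>
        norm_sq (map_mat of_rat (rip_mat n E g) *\<^sub>v x) \<le> (1 + \<delta>) * norm_sq x"
      unfolding N A using 1 2 by (simp add: algebra_simps abs_le_iff)
  qed
  then show ?thesis unfolding rip_of_def using rip_param_least(3) \<delta> by blast
qed

text \<open>The two cyclic distances between distinct vertices i and j add up to n, so one of them
  is at most h unless j is i shifted by h + 1. Equal vertices and this exceptional shift account for
  at most |K| ordered pairs each.\<close>

lemma clique_shift_count:
  assumes K: "K \<subseteq> {..<n}"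
  shows "(card K)\<^sup>2 \<le> 2 * card {(i, d) \<in> {..<n} \<times> {1..half n}. i \<in> K \<and> (i + d) mod n \<in> K} + 2 * card K"
proof (cases "n = 0")
  case False
  define S where "S = {(i, d) \<in> {..<n} \<times> {1..half n}. i \<in> K \<and> (i + d) mod n \<in> K}"
  have "S \<subseteq> {..<n} \<times> {1..half n}" unfolding S_def by auto
  then have fin: "finite K" "finite S" using K by (auto intro: finite_subset)
  define c1 c2 where "c1 = (\<lambda>(i, d). (i, (i + d) mod n))" and "c2 = (\<lambda>(i, d). ((i + d) mod n, i))"
  have "K \<times> K \<subseteq> c1 ` S \<union> c2 ` S \<union> (\<lambda>i. (i, i)) ` K \<union> (\<lambda>i. (i, (i + (half n + 1)) mod n)) ` K"
  proof clarify
    fix i j assume ij: "i \<in> K" "j \<in> K" and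
      no: "(i, j) \<notin> (\<lambda>i. (i, (i + (half n + 1)) mod n)) ` K" "(i, j) \<notin> (\<lambda>i. (i, i)) ` K" "(i, j) \<notin> c2 ` S"
    have l: "i < n" "j < n" using ij K by auto
    define d where "d = (j + n - i) mod n"
    have d: "d < n" "(i + d) mod n = j" unfolding d_def gap_mod[OF l] using l by (auto simp: le_mod_geq)
    define e where "e = (i + n - j) mod n"
    have e: "e < n" "(j + e) mod n = i" unfolding e_def gap_mod[OF l(2,1)] using l by (auto simp: le_mod_geq)
    have "i \<noteq> j" using no(2) ij by auto
    then have de: "d + e = n" "0 < d" "0 < e" unfolding d_def e_def gap_mod[OF l] gap_mod[OF l(2,1)] using l by auto
    have "d \<noteq> half n + 1" using no(1) ij d by auto
    moreover have "\<not> e \<le> half n"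
    proof
      assume "e \<le> half n"
      then have "(j, e) \<in> S" unfolding S_def using l ij e de by auto
      then show False using no(3) e unfolding c2_def by force
    qed
    moreover have "n \<le> 2 * half n + 2" unfolding half_def by linarith
    ultimately have "d \<le> half n" using de by linarith
    then have "(i, d) \<in> S" unfolding S_def using l ij d de by auto
    then show "(i, j) \<in> c1 ` S" using d unfolding c1_def by force
  qed
  then have "card (K \<times> K) \<le> card (c1 ` S \<union> c2 ` S \<union> (\<lambda>i. (i, i)) ` K \<union> (\<lambda>i. (i, (i + (half n + 1)) mod n)) ` K)"
    using fin by (intro card_mono) auto
  also have "\<dots> \<le> card (c1 ` S) + card (c2 ` S) + card ((\<lambda>i. (i, i)) ` K) + card ((\<lambda>i. (i, (i + (half n + 1)) mod n)) ` K)"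
    by (intro order.trans[OF card_Un_le] add_mono order.refl)
  also have "\<dots> \<le> card S + card S + card K + card K"
    using fin by (intro add_mono card_image_le)
  finally show ?thesis unfolding S_def by (simp add: card_cartesian_product power2_eq_square)
qed (use K in auto)

text \<open>On the indicator vector of the clique the padding vanishes, and the two squared norms
  differ by 4 times the product of diagonal and sign part, to which only pairs inside the clique
  contribute. The first parameter bounds one norm from above, the second bounds the other from
  below.\<close>

lemma rip_lower:
  assumes v: "0 < scale n" and K: "K \<subseteq> {..<n}" "card K \<le> k" "K \<noteq> {}"
    and clique: "\<And>u w. u \<in> K \<Longrightarrow> w \<in> K \<Longrightarrow> u \<noteq> w \<Longrightarrow> {u, w} \<in> E"
  shows "4 / 75 * (real (card K) - 2) / rscale n \<le> rip_of k (rip_mat n E 1) + rip_of k (rip_mat n E (- 1))"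
proof -
  define x where "x = vec (100 * n) (\<lambda>j. if j \<in> K then 1 else 0 :: real)"
  define y where "y = (\<lambda>j. x $ j)"
  define m where "m = real (card K)"
  define V where "V = rscale n"
  define N where "N = card {(i, d) \<in> {..<n} \<times> {1..half n}. i \<in> K \<and> (i + d) mod n \<in> K}"
  define F where "F = map_mat of_rat (rip_mat n E 1) *\<^sub>v x"
  define F' where "F' = map_mat of_rat (rip_mat n E (- 1)) *\<^sub>v x"
  have V: "0 < V" using v by (simp add: V_def)
  have finK: "finite K" using K finite_subset by blast
  have n: "0 < n" using K by auto
  have x: "x \<in> carrier_vec (100 * n)" by (simp add: x_def)
  have yi: "y j = (if j \<in> K then 1 else 0)" if "j < n" for j using that by (simp add: y_def x_def)
  have "{i. i < 100 * n \<and> x $ i \<noteq> 0} = K" using K(1) by (auto simp: x_def split: if_splits)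
  then have sp: "sparse_vec k x" unfolding sparse_vec_def using K by (simp add: x_def)
  have "norm_sq x = (\<Sum>j<100 * n. if j \<in> K then 1 else 0)"
    unfolding norm_sq_sum by (intro sum.cong) (auto simp: x_def)
  also have "\<dots> = (\<Sum>j\<in>{..<100 * n} \<inter> K. 1)" by (rule sum.inter_restrict[symmetric]) simp
  also have "{..<100 * n} \<inter> K = K" using K by auto
  finally have nx: "norm_sq x = m" by (simp add: m_def)
  have m: "0 < m" using K finK by (simp add: m_def card_gt_0_iff)
  have opp: "graph_row n (oriented n E (- 1)) y i = - graph_row n (oriented n E 1) y i" if "i < n" for i
    unfolding graph_row_def sum_negf[symmetric]
    by (intro sum.cong refl) (use shift_pair_in[OF that] in \<open>auto simp: oriented_def sign_in_def\<close>)
  define S where "S i = graph_row n E y i" for i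
  have S: "graph_row n (oriented n E 1) y i = S i" for i by (simp add: S_def oriented_def)
  have "norm_sq F - norm_sq F' = ((\<Sum>i<n. (24 * V * y i + S i)\<^sup>2) - (\<Sum>i<n. (24 * V * y i - S i)\<^sup>2)) / (900 * V\<^sup>2)"
    unfolding F_def F'_def norm_sq_rip_mat[OF v disjI1[OF refl] x] norm_sq_rip_mat[OF v disjI2[OF refl] x]
      y_def[symmetric] V_def[symmetric]
    by (simp add: opp S diff_divide_distrib)
  also have "(\<Sum>i<n. (24 * V * y i + S i)\<^sup>2) - (\<Sum>i<n. (24 * V * y i - S i)\<^sup>2) = 96 * V * (\<Sum>i<n. y i * S i)"
    unfolding sum_subtractf[symmetric] sum_distrib_left
    by (intro sum.cong refl) (simp add: power2_eq_square algebra_simps)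
  also have "(\<Sum>i<n. y i * S i) = real N"
  proof -
    have "(\<Sum>i<n. y i * S i) = (\<Sum>i<n. \<Sum>d\<in>{1..half n}. if i \<in> K \<and> (i + d) mod n \<in> K then 1 else 0)"
    proof (intro sum.cong refl)
      fix i assume "i \<in> {..<n}"
      then have i: "i < n" by simp
      have "y i * (sign_in E {i, (i + d) mod n} * y ((i + d) mod n)) = (if i \<in> K \<and> (i + d) mod n \<in> K then 1 else 0)"
        if d: "d \<in> {1..half n}" for d
      proof -
        have dn: "d < n" "0 < d" using d two_half_less[OF n] by auto
        have "i \<noteq> (i + d) mod n" unfolding shift_mod[OF i dn(1)] using dn i by auto
        then show ?thesis using clique[of i "(i + d) mod n"] i n by (simp add: yi sign_in_def)
      qed
      then show "y i * S i = (\<Sum>d\<in>{1..half n}. if i \<in> K \<and> (i + d) mod n \<in> K then 1 else 0)"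
        unfolding S_def graph_row_def sum_distrib_left by (intro sum.cong refl) simp
    qed
    also have "\<dots> = (\<Sum>p\<in>{..<n} \<times> {1..half n}. if fst p \<in> K \<and> (fst p + snd p) mod n \<in> K then 1 else 0)"
      by (simp add: sum.cartesian_product case_prod_beta)
    also have "\<dots> = real N"
    proof -
      have "{(i, d) \<in> {..<n} \<times> {1..half n}. i \<in> K \<and> (i + d) mod n \<in> K}
        = {p \<in> {..<n} \<times> {1..half n}. fst p \<in> K \<and> (fst p + snd p) mod n \<in> K}" by auto
      then show ?thesis unfolding N_def by (simp add: sum.inter_filter[symmetric])
    qed
    finally show ?thesis .
  qed
  finally have diff: "norm_sq F - norm_sq F' = 8 / 75 * real N / V"
    using V by (simp add: power2_eq_square)
  have "real ((card K)\<^sup>2) \<le> real (2 * N + 2 * card K)"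
    using clique_shift_count[OF K(1)] unfolding N_def by (intro of_nat_mono)
  then have N: "m * (m - 2) / 2 \<le> real N" by (simp add: m_def power2_eq_square algebra_simps)
  define a b where "a = rip_of k (rip_mat n E 1)" and "b = rip_of k (rip_mat n E (- 1))"
  have "norm_sq F \<le> (1 + a) * m"
    using rip_param_least(2)[of "map_mat of_rat (rip_mat n E 1)" k] x sp
    unfolding has_rip_def a_def rip_of_def F_def nx[symmetric] by (auto simp: rip_mat_def)
  moreover have "(1 - b) * m \<le> norm_sq F'"
    using rip_param_least(2)[of "map_mat of_rat (rip_mat n E (- 1))" k] x sp
    unfolding has_rip_def b_def rip_of_def F'_def nx[symmetric] by (auto simp: rip_mat_def)
  ultimately have "norm_sq F - norm_sq F' \<le> (a + b) * m" by (simp add: algebra_simps)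
  then have "8 / 75 * real N / V \<le> (a + b) * m" unfolding diff .
  moreover have "8 / 75 * (m * (m - 2) / 2) / V \<le> 8 / 75 * real N / V"
    using N V by (intro divide_right_mono mult_left_mono) auto
  moreover have "8 / 75 * (m * q / 2) / V = (4 / 75 * q / V) * m" for q by simp
  then have "8 / 75 * (m * (m - 2) / 2) / V = (4 / 75 * (m - 2) / V) * m" .
  ultimately have "(4 / 75 * (m - 2) / V) * m \<le> (a + b) * m" by linarith
  then have "4 / 75 * (m - 2) / V \<le> a + b" using m by (simp only: mult_le_cancel_right_pos)
  then show ?thesis by (simp only: a_def b_def m_def V_def)
qed

subsection \<open>Asymptotics\<close>

lemma eventually_le_powr:
  assumes "0 < a"
  shows "\<forall>\<^sub>F n in sequentially. C \<le> real n powr a"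
proof -
  have "filterlim (\<lambda>n. real n powr a) at_top sequentially" using assms by real_asymp
  then show ?thesis by (simp add: filterlim_at_top)
qed

text \<open>All three come from 324 v^2 \<le> h < 324 (v + 1)^2 and v \<ge> 1, which n \<ge> 649
  guarantees; then 648 v + 324 \<le> 972 v.\<close>

lemma scale_square_bounds:
  assumes "649 \<le> n"
  shows "648 * (rscale n)\<^sup>2 \<le> real n" "real n \<le> 3000 * (rscale n)\<^sup>2"
    "real (half n) \<le> 324 * (rscale n)\<^sup>2 + 972 * rscale n"
proof -
  have v: "1 \<le> scale n" using scale_pos[OF assms] by simp
  have h: "real (half n) \<le> 324 * (rscale n + 1)\<^sup>2"
  proof -
    have "real (half n) \<le> real (324 * (Suc (scale n))\<^sup>2)"
      using half_less_scale[of n] by (simp only: of_nat_le_iff)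
    then show ?thesis by (simp add: add.commute)
  qed
  have v2: "rscale n \<le> (rscale n)\<^sup>2" using v by (simp add: power2_eq_square)
  have v1: "1 \<le> rscale n" using v by simp
  have h': "real (half n) \<le> 324 * (rscale n)\<^sup>2 + 648 * rscale n + 324"
    using h by (simp add: power2_eq_square algebra_simps)
  then show "real (half n) \<le> 324 * (rscale n)\<^sup>2 + 972 * rscale n"
    using v1 by linarith
  have n: "real n \<le> 2 * real (half n) + 2" "2 * real (half n) \<le> real n"
    unfolding half_def using assms by linarith+
  have "324 * (rscale n)\<^sup>2 \<le> real (half n)"
  proof -
    have "real (324 * (scale n)\<^sup>2) \<le> real (half n)" using scale_le[of n] by (simp only: of_nat_le_iff)
    then show ?thesis by simp
  qed
  then show "648 * (rscale n)\<^sup>2 \<le> real n" using n by linarith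
  show "real n \<le> 3000 * (rscale n)\<^sup>2" using n h' v1 v2 by linarith
qed

text \<open>The constants fit because 25^2 \<le> 648 and 3000 \<le> 55^2.\<close>

lemma scale_bounds:
  assumes "649 \<le> n"
  shows "25 * rscale n \<le> sqrt (real n)" "sqrt (real n) \<le> 55 * rscale n"
proof -
  have "(25 * rscale n)\<^sup>2 \<le> real n"
    using scale_square_bounds(1)[OF assms] zero_le_power2[of "rscale n"]
    unfolding power_mult_distrib by simp
  then show "25 * rscale n \<le> sqrt (real n)" by (rule real_le_rsqrt)
  have "real n \<le> (55 * rscale n)\<^sup>2"
    using scale_square_bounds(2)[OF assms] zero_le_power2[of "rscale n"]
    unfolding power_mult_distrib by simp
  then show "sqrt (real n) \<le> 55 * rscale n" by (intro real_le_lsqrt) auto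
qed

text \<open>With f for the exponent, f - \<epsilon> = \<epsilon> / 2 * (1 / 2 - \<epsilon>) and 1 /
  2 - f = (1 / 2 - \<epsilon>) * (1 - \<epsilon> / 2). The first separates the two thresholds, the
  second puts the error of normalisation below the lower one.\<close>

lemma rip_exponents:
  fixes \<epsilon> :: real
  assumes "0 < \<epsilon>" "\<epsilon> < 1 / 2"
  shows "0 < 5 * \<epsilon> / 4 - \<epsilon>\<^sup>2 / 2" "\<epsilon> < 5 * \<epsilon> / 4 - \<epsilon>\<^sup>2 / 2" "5 * \<epsilon> / 4 - \<epsilon>\<^sup>2 / 2 < 1 / 2"
proof -
  have "0 < \<epsilon> / 2 * (1 / 2 - \<epsilon>)" using assms by simp
  then show 1: "\<epsilon> < 5 * \<epsilon> / 4 - \<epsilon>\<^sup>2 / 2" by (simp add: power2_eq_square algebra_simps)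
  then show "0 < 5 * \<epsilon> / 4 - \<epsilon>\<^sup>2 / 2" using assms by linarith
  have "0 < (1 / 2 - \<epsilon>) * (1 - \<epsilon> / 2)" using assms by simp
  then show "5 * \<epsilon> / 4 - \<epsilon>\<^sup>2 / 2 < 1 / 2" by (simp add: power2_eq_square algebra_simps)
qed

lemma rip_small_smallo:
  assumes "0 < \<epsilon>" "\<epsilon> < 1 / 2"
  shows "rip_small \<epsilon> \<in> o(rip_large \<epsilon>)"
proof (rule smalloI_tendsto)
  define \<gamma> where "\<gamma> = \<epsilon> / 2 * (1 / 2 - \<epsilon>)"
  have \<gamma>: "0 < \<gamma>" using assms by (simp add: \<gamma>_def)
  have "(\<lambda>n. 4 * real n powr (- \<gamma>)) \<longlonglongrightarrow> 0" using \<gamma> by real_asymp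
  moreover have "\<forall>\<^sub>F n in sequentially. 4 * real n powr (- \<gamma>) = rip_small \<epsilon> n / rip_large \<epsilon> n"
    using eventually_gt_at_top[of 0]
  proof eventually_elim
    case (elim n)
    have "- 5 * \<epsilon> / 4 + \<epsilon>\<^sup>2 / 2 = - \<gamma> + - \<epsilon>" by (simp add: \<gamma>_def power2_eq_square algebra_simps)
    then show ?case using elim unfolding rip_small_def rip_large_def
      by (simp only: powr_add) simp
  qed
  ultimately show "(\<lambda>n. rip_small \<epsilon> n / rip_large \<epsilon> n) \<longlonglongrightarrow> 0"
    by (rule Lim_transform_eventually)
  show "\<forall>\<^sub>F n in sequentially. rip_large \<epsilon> n \<noteq> 0"
    using eventually_gt_at_top[of 0] by eventually_elim (simp add: rip_large_def)
qed

text \<open>This makes the indicator vector of the clique k-sparse. With \<gamma> = 1 / 2 -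
  \<epsilon> the exponent of k is \<gamma> + 2 \<gamma>^2, against \<gamma> for the clique; a gap of
  2 absorbs floor and ceiling.\<close>

lemma eventually_clique_size_le:
  assumes "0 < \<epsilon>" "\<epsilon> < 1 / 2"
  shows "\<forall>\<^sub>F n in sequentially. clique_size \<epsilon> n \<le> rip_order \<epsilon> n"
proof -
  define \<gamma> where "\<gamma> = 1 / 2 - \<epsilon>"
  have \<gamma>: "0 < \<gamma>" using assms by (simp add: \<gamma>_def)
  have "0 < 2 * \<gamma>\<^sup>2" using \<gamma> by simp
  from eventually_le_powr[OF \<gamma>, of 2] eventually_le_powr[OF this, of 2]
  show ?thesis
  proof eventually_elim
    case (elim n)
    have "(1 - 2 * \<epsilon>) * (1 - \<epsilon>) = \<gamma> + 2 * \<gamma>\<^sup>2" by (simp add: \<gamma>_def power2_eq_square algebra_simps)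
    then have "real n powr ((1 - 2 * \<epsilon>) * (1 - \<epsilon>)) = real n powr \<gamma> * real n powr (2 * \<gamma>\<^sup>2)"
      by (simp only: powr_add)
    moreover have "real n powr \<gamma> * 2 \<le> real n powr \<gamma> * real n powr (2 * \<gamma>\<^sup>2)"
      using elim by (intro mult_left_mono) auto
    ultimately have "real n powr \<gamma> + 2 \<le> real n powr ((1 - 2 * \<epsilon>) * (1 - \<epsilon>))" using elim by linarith
    then have "\<lceil>real n powr (1 / 2 - \<epsilon>)\<rceil> \<le> \<lfloor>real n powr ((1 - 2 * \<epsilon>) * (1 - \<epsilon>))\<rfloor>"
      unfolding \<gamma>_def by linarith
    then show ?case unfolding clique_size_def rip_order_def by (rule nat_mono)
  qed
qed

text \<open>The factor 2 is there because the lower bound concerns a sum of two parameters. As 25 v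
  \<le> sqrt n and 4 / 75 * 25 = 4 / 3, the right side is at least 4 / 3 * (m - 2) / sqrt n for a
  clique of size m, and 4 / 3 * (m - 2) \<ge> m / 2 once m \<ge> 4.\<close>

lemma eventually_clique_gap:
  assumes "0 < \<epsilon>" "\<epsilon> < 1 / 2"
  shows "\<forall>\<^sub>F n in sequentially. 2 * rip_large \<epsilon> n \<le> 4 / 75 * (real (clique_size \<epsilon> n) - 2) / rscale n"
proof -
  define \<gamma> where "\<gamma> = 1 / 2 - \<epsilon>"
  have \<gamma>: "0 < \<gamma>" using assms by (simp add: \<gamma>_def)
  from eventually_le_powr[OF \<gamma>, of 4] eventually_ge_at_top[of 649] show ?thesis
  proof eventually_elim
    case (elim n)
    have v: "0 < rscale n" using scale_pos elim by simp
    have r: "0 < sqrt (real n)" using elim by simp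
    have "- \<epsilon> = \<gamma> - 1 / 2" by (simp add: \<gamma>_def)
    then have p: "real n powr (- \<epsilon>) = real n powr \<gamma> / sqrt (real n)"
      by (simp only: powr_diff powr_half_sqrt[OF of_nat_0_le_iff])
    have m: "real n powr \<gamma> \<le> real (clique_size \<epsilon> n)"
      unfolding clique_size_def \<gamma>_def by (simp add: real_nat_ceiling_ge)
    have "2 * rip_large \<epsilon> n = (real n powr \<gamma> / 2) / sqrt (real n)" unfolding rip_large_def p by simp
    also have "\<dots> \<le> (real (clique_size \<epsilon> n) - 2) * (4 / 3) / sqrt (real n)"
    proof (rule divide_right_mono)
      define p q where "p = real n powr \<gamma>" and "q = real (clique_size \<epsilon> n)"
      have "p \<le> q" "4 \<le> p" using m elim by (simp_all add: p_def q_def)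
      then have "p / 2 \<le> (q - 2) * (4 / 3)" by (simp add: field_simps)
      then show "real n powr \<gamma> / 2 \<le> (real (clique_size \<epsilon> n) - 2) * (4 / 3)" by (simp only: p_def q_def)
    qed (use r in simp)
    also have "\<dots> = (real (clique_size \<epsilon> n) - 2) * (4 / 3) * (1 / sqrt (real n))" by simp
    also have "\<dots> \<le> (real (clique_size \<epsilon> n) - 2) * (4 / 3) * (1 / (25 * rscale n))"
      using scale_bounds(1)[OF elim(2)] v m elim by (intro mult_left_mono divide_left_mono) auto
    finally show ?case using v by (simp add: field_simps)
  qed
qed

text \<open>The relative error of normalisation is O(1 / v), so it is below \<delta> if v \<delta>
  is large enough. The 165 in the proof is 3 times the 55 of the bound on sqrt n.\<close>

lemma eventually_scale_error:
  assumes "0 < \<epsilon>" "\<epsilon> < 1 / 2"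
  shows "\<forall>\<^sub>F n in sequentially. 3 \<le> rscale n * rip_small \<epsilon> n"
proof -
  define \<gamma> where "\<gamma> = 1 / 2 - (5 * \<epsilon> / 4 - \<epsilon>\<^sup>2 / 2)"
  have \<gamma>: "0 < \<gamma>" using rip_exponents[OF assms] by (simp add: \<gamma>_def)
  from eventually_le_powr[OF \<gamma>, of 165] eventually_ge_at_top[of 649] show ?thesis
  proof eventually_elim
    case (elim n)
    have "- 5 * \<epsilon> / 4 + \<epsilon>\<^sup>2 / 2 = \<gamma> - 1 / 2" by (simp add: \<gamma>_def)
    then have p: "rip_small \<epsilon> n = real n powr \<gamma> / sqrt (real n)"
      by (simp only: rip_small_def powr_diff powr_half_sqrt[OF of_nat_0_le_iff])
    have r: "0 < sqrt (real n)" using elim by simp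
    have "165 \<le> real n powr \<gamma>" by fact
    also have "\<dots> = rip_small \<epsilon> n * sqrt (real n)" using r p by simp
    also have "\<dots> \<le> rip_small \<epsilon> n * (55 * rscale n)"
      using scale_bounds(2)[OF elim(2)] by (intro mult_left_mono) (auto simp: rip_small_def)
    finally show ?case by (simp add: mult.commute)
  qed
qed

text \<open>The grid has at most (n^5)^k elements. With s = \<delta> v^2 / 4 and W = 2000 v^2 the
  tail exponent s^2 / (32 W) is \<delta>^2 v^2 / 1024000.\<close>

definition failure_bound :: "real \<Rightarrow> nat \<Rightarrow> real" where
  "failure_bound \<epsilon> n = (real n ^ 5) ^ rip_order \<epsilon> n * exp (- ((rip_small \<epsilon> n)\<^sup>2 * (rscale n)\<^sup>2 / 1024000))"

text \<open>As v^2 \<ge> n / 3000, the logarithm of the bound is at most n powr \<kappa> times 5 ln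
  n - c n powr \<beta>, where \<beta> = \<epsilon> * (1 / 2 - \<epsilon>) is positive; the power
  beats the logarithm.\<close>

lemma failure_bound_tendsto:
  assumes "0 < \<epsilon>" "\<epsilon> < 1 / 2"
  shows "failure_bound \<epsilon> \<longlonglongrightarrow> 0"
proof -
  define \<kappa> where "\<kappa> = (1 - 2 * \<epsilon>) * (1 - \<epsilon>)"
  define \<beta> where "\<beta> = \<epsilon> * (1 / 2 - \<epsilon>)"
  define c :: real where "c = 1 / (3000 * 1024000)"
  have \<kappa>: "0 < \<kappa>" and \<beta>: "0 < \<beta>" and c: "0 < c" using assms by (simp_all add: \<kappa>_def \<beta>_def c_def)
  define h where "h n = 5 * ln (real n) - c * real n powr \<beta>" for n
  have "filterlim h at_bot sequentially" unfolding h_def using \<beta> c by real_asymp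
  then have lim: "(\<lambda>n. exp (h n)) \<longlonglongrightarrow> 0" by (rule filterlim_compose[OF exp_at_bot])
  have neg: "\<forall>\<^sub>F n in sequentially. h n \<le> 0"
    using \<open>filterlim h at_bot sequentially\<close> by (simp add: filterlim_at_bot)
  have "\<forall>\<^sub>F n in sequentially. norm (failure_bound \<epsilon> n) \<le> exp (h n)"
    using neg eventually_ge_at_top[of 649]
  proof eventually_elim
    case (elim n)
    have n: "0 < real n" "1 \<le> real n" using elim by auto
    define k where "k = rip_order \<epsilon> n"
    have k: "real k \<le> real n powr \<kappa>" unfolding k_def rip_order_def \<kappa>_def by simp
    have "real n ^ 5 = exp (5 * ln (real n))"
      using n exp_of_nat_mult[of 5 "ln (real n)"] by simp
    then have "(real n ^ 5) ^ k = exp (real k * (5 * ln (real n)))" by (simp only: exp_of_nat_mult)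
    also have "\<dots> \<le> exp (real n powr \<kappa> * (5 * ln (real n)))"
      using k n by (simp add: mult_right_mono)
    finally have 1: "(real n ^ 5) ^ k \<le> exp (real n powr \<kappa> * (5 * ln (real n)))" .
    have "2 * (- 5 * \<epsilon> / 4 + \<epsilon>\<^sup>2 / 2) + 1 = \<kappa> + \<beta>"
      by (simp add: \<kappa>_def \<beta>_def power2_eq_square algebra_simps)
    moreover have "(rip_small \<epsilon> n)\<^sup>2 = real n powr (2 * (- 5 * \<epsilon> / 4 + \<epsilon>\<^sup>2 / 2))"
      unfolding rip_small_def power2_eq_square by (simp flip: powr_add)
    ultimately have sm: "(rip_small \<epsilon> n)\<^sup>2 * real n = real n powr \<kappa> * real n powr \<beta>"
      using n by (metis powr_add powr_one less_imp_le)
    have "(rip_small \<epsilon> n)\<^sup>2 * real n \<le> (rip_small \<epsilon> n)\<^sup>2 * (3000 * (rscale n)\<^sup>2)"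
      using scale_square_bounds(2)[OF elim(2)] by (intro mult_left_mono) auto
    then have 2: "c * (real n powr \<kappa> * real n powr \<beta>) \<le> (rip_small \<epsilon> n)\<^sup>2 * (rscale n)\<^sup>2 / 1024000"
      unfolding sm[symmetric] c_def by (simp add: mult_ac)
    have "failure_bound \<epsilon> n \<le> exp (real n powr \<kappa> * (5 * ln (real n))) * exp (- (c * (real n powr \<kappa> * real n powr \<beta>)))"
      unfolding failure_bound_def k_def[symmetric] using 1 2 by (intro mult_mono) auto
    also have "\<dots> = exp (real n powr \<kappa> * h n)" unfolding h_def exp_add[symmetric] by (simp add: algebra_simps)
    also have "\<dots> \<le> exp (h n)"
    proof -
      have "1 \<le> real n powr \<kappa>" using n \<kappa> by (simp add: ge_one_powr_ge_zero)
      then have "real n powr \<kappa> * h n \<le> 1 * h n" using elim(1) by (intro mult_right_mono_neg) auto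
      then show ?thesis by simp
    qed
    finally show ?case by (simp add: failure_bound_def)
  qed
  then show ?thesis using lim by (rule Lim_null_comparison)
qed

subsection \<open>Hardness of separation\<close>

lemma poly_nat_mono: "x \<le> y \<Longrightarrow> poly p x \<le> poly p y" for p :: "nat poly"
  by (induction p) (auto intro!: mult_le_mono)

lemma deterministic_always:
  assumes "deterministic c" "always c x Z" "exec c (init x) [] t s"
  shows "Z s"
proof -
  from assms(2) obtain m t' s' where e: "exec c (init x) (map (\<lambda>_. False) [0..<m]) t' s'" "Z s'"
    unfolding always_def by blast
  have "map (\<lambda>_. False) [0..<m] = []" using exec_deterministic[OF e(1) assms(1)] .
  then show ?thesis using exec_determ[OF assms(3) e(1), of "[]" "[]"] e(2) by simp
qed

lemma deterministic_polytime:
  assumes "deterministic c" "polytime_on X c"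
  shows "\<exists>p :: nat poly. \<forall>x\<in>X. \<exists>t s. exec c (init x) [] t s \<and> t \<le> poly p (input_size x)"
proof -
  from assms(2) obtain p :: "nat poly" where
    p: "\<forall>x\<in>X. \<forall>\<omega> :: nat \<Rightarrow> bool. \<exists>m t s. exec c (init x) (map \<omega> [0..<m]) t s \<and> t \<le> poly p (input_size x)"
    unfolding polytime_on_def by blast
  show ?thesis
  proof (intro exI[of _ p] ballI)
    fix x assume "x \<in> X"
    with p obtain m t s where e: "exec c (init x) (map (\<lambda>_. False) [0..<m]) t s" "t \<le> poly p (input_size x)"
      by blast
    have "map (\<lambda>_. False) [0..<m] = []" using exec_deterministic[OF e(1) assms(1)] .
    with e show "\<exists>t s. exec c (init x) [] t s \<and> t \<le> poly p (input_size x)" by auto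
  qed
qed

lemma runs_always: "runs c (init x) T Z \<Longrightarrow> always c x Z"
  unfolding always_def runs_def
proof (intro allI)
  fix \<omega> :: "nat \<Rightarrow> bool"
  assume "\<exists>t s'. exec c (init x) [] t s' \<and> t \<le> T \<and> Z s'"
  then obtain t s where "exec c (init x) (map \<omega> [0..<0]) t s" "Z s" by auto
  then show "\<exists>m t s. exec c (init x) (map \<omega> [0..<m]) t s \<and> Z s" by blast
qed

lemma runs_polytime:
  assumes "\<And>x. x \<in> X \<Longrightarrow> \<exists>Z. runs c (init x) (poly p (input_size x)) Z"
  shows "polytime_on X c"
  unfolding polytime_on_def
proof (intro exI[of _ p] ballI allI)
  fix x and \<omega> :: "nat \<Rightarrow> bool" assume "x \<in> X"
  from assms[OF this] obtain t s where "exec c (init x) (map \<omega> [0..<0]) t s" "t \<le> poly p (input_size x)"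
    unfolding runs_def by auto
  then show "\<exists>m t s. exec c (init x) (map \<omega> [0..<m]) t s \<and> t \<le> poly p (input_size x)" by blast
qed

text \<open>The only coin sequence of a halting run is the empty one, of weight 1.\<close>

lemma prob_output_deterministic:
  assumes "deterministic c" "always c x Z"
  shows "prob_output c x Z = 1"
proof -
  from assms(2) obtain m t s where e: "exec c (init x) (map (\<lambda>_. False) [0..<m]) t s" "Z s"
    unfolding always_def by blast
  have "map (\<lambda>_. False) [0..<m] = []" using exec_deterministic[OF e(1) assms(1)] .
  then have "{w. \<exists>t s. exec c (init x) w t s \<and> Z s} = {[]}"
    using e exec_deterministic[OF _ assms(1)] by auto
  then show ?thesis by (simp add: prob_output_def)
qed

lemma input_size_le: "(\<And>z. z \<in> set x \<Longrightarrow> 1 + bits z \<le> C) \<Longrightarrow> input_size x \<le> length x * C"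
proof (induction x)
  case (Cons a x)
  have "input_size x \<le> length x * C" "1 + bits a \<le> C" using Cons by auto
  then show ?case by (simp add: input_size_def)
qed (simp add: input_size_def)

lemma length_le_input_size: "length x \<le> input_size x"
  by (induction x) (auto simp: input_size_def)

lemma bits_le_input_size: "z \<in> set x \<Longrightarrow> bits z \<le> input_size x"
  by (induction x) (auto simp: input_size_def)

lemma le_input_size_graph: "n \<le> input_size (enc_graph n E)"
proof -
  have "length (enc_graph n E) = 1 + n * n"
    unfolding enc_graph_def using concat_rectangle[of "\<lambda>i j. of_bool ({i, j} \<in> E) :: int" n n] by simp
  then have "n \<le> length (enc_graph n E)" by (cases n) auto
  then show ?thesis using length_le_input_size[of "enc_graph n E"] by linarith
qed

lemma input_size_rip_mat:
  assumes "0 < scale n" "g = 1 \<or> g = - 1"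
  shows "input_size (enc_mat n (rip_mat n E g)) \<le> (3 + 400 * n\<^sup>2) * (1 + entryB n)"
proof -
  have n: "bits (int n) \<le> entryB n" "bits (int (2 * n)) \<le> entryB n" "bits (int (100 * n)) \<le> entryB n"
    by (rule entryB_bits; simp add: power2_eq_square; cases n; simp add: algebra_simps)+
  have "1 + bits z \<le> 1 + entryB n" if "z \<in> set (enc_mat n (rip_mat n E g))" for z
    using that n entry_bits[OF assms(2)] unfolding enc_rip_mat[OF assms] by auto
  then have "input_size (enc_mat n (rip_mat n E g)) \<le> length (enc_mat n (rip_mat n E g)) * (1 + entryB n)"
    by (rule input_size_le)
  moreover have "length (enc_mat n (rip_mat n E g)) = 3 + 400 * n\<^sup>2" by (simp add: enc_rip_mat[OF assms])
  ultimately show ?thesis by (simp only:)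
qed

definition rip_good :: "real \<Rightarrow> nat \<Rightarrow> nat set set \<Rightarrow> bool" where
  "rip_good \<epsilon> n E \<longleftrightarrow> rip_of (rip_order \<epsilon> n) (rip_mat n E 1) \<le> rip_small \<epsilon> n \<and>
     rip_of (rip_order \<epsilon> n) (rip_mat n E (- 1)) \<le> rip_small \<epsilon> n"

lemma graphs_eq: "graphs n = Pow (vertex_pairs n)"
  by (simp add: graphs_def vertex_pairs_def)

text \<open>There are three bad events, each of relative frequency at most twice
  \<open>failure_bound\<close>: the graph block fails for E, it fails for the complement, or the
  padding fails.\<close>

lemma card_not_rip_good:
  assumes \<epsilon>: "0 < \<epsilon>" "\<epsilon> < 1 / 2" and n: "4000000 \<le> n" and err: "3 \<le> rscale n * rip_small \<epsilon> n"
  shows "real (card {E \<in> graphs n. \<not> rip_good \<epsilon> n E}) \<le> 6 * failure_bound \<epsilon> n * 2 ^ card (vertex_pairs n)"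
proof -
  define \<delta> where "\<delta> = rip_small \<epsilon> n"
  define v where "v = rscale n"
  define k where "k = rip_order \<epsilon> n"
  define Q where "Q = vertex_pairs n"
  \<comment> \<open>A quarter of the tolerance \<delta> v^2 of the padding, which leaves room for
    the rounding error 1.\<close>
  define s where "s = \<delta> * v\<^sup>2 / 4"
  \<comment> \<open>Dominates 576 v^2 + h, which is at most 900 v^2 + 972 v.\<close>
  define W where "W = 2000 * v\<^sup>2"
  \<comment> \<open>The Lipschitz constants of both blocks are at most cubic in n.\<close>
  define M where "M = 20000 * n ^ 3"
  have n649: "649 \<le> n" and n0: "0 < n" using n by auto
  have vpos: "0 < scale n" using scale_pos[OF n649] .
  have v1: "1 \<le> v" using vpos by (simp add: v_def)
  have v2: "v \<le> v\<^sup>2" "1 \<le> v\<^sup>2" using v1 by (simp_all add: power2_eq_square mult_ge1_I)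
  have vn: "648 * v\<^sup>2 \<le> real n" "real (half n) \<le> 324 * v\<^sup>2 + 972 * v"
    using scale_square_bounds[OF n649] by (simp_all add: v_def)
  have err: "3 \<le> v * \<delta>" using err by (simp add: v_def \<delta>_def)
  have \<delta>: "0 < \<delta>" "\<delta> \<le> 1"
  proof -
    show "0 < \<delta>" using n0 by (simp add: \<delta>_def rip_small_def)
    have "real n powr (- 5 * \<epsilon> / 4 + \<epsilon>\<^sup>2 / 2) \<le> real n powr 0"
      using rip_exponents(1)[OF \<epsilon>] n0 by (intro powr_mono) auto
    then show "\<delta> \<le> 1" using n0 by (simp add: \<delta>_def rip_small_def)
  qed
  have v\<delta>: "3 * v \<le> v\<^sup>2 * \<delta>" using mult_left_mono[OF err, of v] v1 by (simp add: power2_eq_square mult_ac)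
  have s: "0 < s" "s \<le> 2 * W"
  proof -
    show "0 < s" unfolding s_def using \<delta>(1) v2 by (intro divide_pos_pos mult_pos_pos) auto
    have "\<delta> * v\<^sup>2 \<le> 1 * v\<^sup>2" using \<delta> by (intro mult_right_mono) auto
    then show "s \<le> 2 * W" unfolding s_def W_def using v2 by linarith
  qed
  have expo: "s\<^sup>2 / (32 * W) = \<delta>\<^sup>2 * v\<^sup>2 / 1024000"
    using v1 unfolding s_def W_def by (simp add: power2_eq_square field_simps)
  have Wg: "576 * v\<^sup>2 + real (half n) \<le> W" using vn v2 unfolding W_def by linarith
  have Wp: "v\<^sup>2 \<le> W" using v2 unfolding W_def by linarith
  have M0: "0 < M" using n0 by (simp add: M_def)
  have rn: "1 \<le> real n" using n0 by simp
  have v_le: "v \<le> real n" using vn v2 by linarith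
  have Mg: "2 * real n * (24 * v + real n)\<^sup>2 + 2 * (576 * v\<^sup>2 + real (half n)) * real n \<le> real M"
  proof -
    have "(24 * v + real n)\<^sup>2 \<le> (25 * real n)\<^sup>2" using v_le v1 by (intro power_mono) auto
    then have 1: "2 * real n * (24 * v + real n)\<^sup>2 \<le> 2 * real n * (25 * real n)\<^sup>2"
      by (intro mult_left_mono) auto
    have "576 * v\<^sup>2 + real (half n) \<le> 3 * real n" using vn v2 by linarith
    then have 2: "2 * (576 * v\<^sup>2 + real (half n)) * real n \<le> 2 * (3 * real n) * real n"
      by (intro mult_right_mono mult_left_mono) auto
    have "real n * real n * 1 \<le> real n * real n * real n" using rn by (intro mult_left_mono) auto
    moreover have "2 * real n * (25 * real n)\<^sup>2 = 1250 * (real n * real n * real n)"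
      by (simp add: power2_eq_square)
    moreover have "2 * (3 * real n) * real n = 6 * (real n * real n)" by simp
    moreover have "real M = 20000 * (real n * real n * real n)" by (simp add: M_def power3_eq_cube)
    moreover have "0 \<le> real n * real n * real n" by simp
    ultimately show ?thesis using 1 2 by linarith
  qed
  have Mp: "2 * v\<^sup>2 * (real (99 * n))\<^sup>2 + 2 * v\<^sup>2 * real (99 * n) \<le> real M"
  proof -
    have v: "v\<^sup>2 \<le> real n / 648" using vn by simp
    have 1: "v\<^sup>2 * (real (99 * n))\<^sup>2 \<le> real n / 648 * (real (99 * n))\<^sup>2" using v by (intro mult_right_mono) auto
    have 2: "v\<^sup>2 * real (99 * n) \<le> real n / 648 * real (99 * n)" using v by (intro mult_right_mono) auto
    have "real n * real n * 1 \<le> real n * real n * real n" using rn by (intro mult_left_mono) auto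
    moreover have "real n / 648 * (real (99 * n))\<^sup>2 = 9801 / 648 * (real n * real n * real n)"
      by (simp add: power2_eq_square)
    moreover have "real n / 648 * real (99 * n) = 99 / 648 * (real n * real n)" by simp
    moreover have "real M = 20000 * (real n * real n * real n)" by (simp add: M_def power3_eq_cube)
    moreover have "0 \<le> real n * real n * real n" by simp
    ultimately show ?thesis using 1 2 by linarith
  qed
  \<comment> \<open>Here n \<ge> 4000000 is used: 99 * 40001 = 3960099 is at most n.\<close>
  have pow: "real (99 * n * (2 * M + 1)) \<le> real n ^ 5"
  proof -
    have n4: "n * n ^ 3 = n ^ 4" and n5: "n * n ^ 4 = n ^ 5" by (simp_all flip: power_Suc)
    have "99 * n * (2 * M + 1) \<le> 99 * n * (40001 * n ^ 3)"
      using n0 by (intro mult_le_mono2) (simp add: M_def)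
    also have "\<dots> = 3960099 * (n * n ^ 3)" by simp
    also have "\<dots> = 3960099 * n ^ 4" unfolding n4 ..
    also have "\<dots> \<le> n * n ^ 4" using n by (intro mult_le_mono1) simp
    also have "\<dots> = n ^ 5" by (rule n5)
    finally show ?thesis by (metis of_nat_le_iff of_nat_power)
  qed
  have F: "real (J * (2 * M + 1)) ^ k * (2 * 2 ^ card Q * exp (- (s\<^sup>2 / (32 * W))))
    \<le> 2 * failure_bound \<epsilon> n * 2 ^ card Q" if "J \<le> 99 * n" for J
  proof -
    have "real (J * (2 * M + 1)) \<le> real (99 * n * (2 * M + 1))" using that by (intro of_nat_mono mult_le_mono1)
    then have "real (J * (2 * M + 1)) ^ k \<le> (real n ^ 5) ^ k" using pow by (intro power_mono) auto
    then have "real (J * (2 * M + 1)) ^ k * (2 * 2 ^ card Q * exp (- (s\<^sup>2 / (32 * W))))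
      \<le> (real n ^ 5) ^ k * (2 * 2 ^ card Q * exp (- (s\<^sup>2 / (32 * W))))"
      by (intro mult_right_mono) auto
    then show ?thesis unfolding failure_bound_def expo k_def \<delta>_def v_def by (simp add: mult_ac)
  qed
  define A where "A = {E \<in> Pow Q. \<not> graph_good n k (s + 1) E}"
  define A' where "A' = {E \<in> Pow Q. \<not> graph_good n k (s + 1) (Q - E)}"
  define B where "B = {E \<in> Pow Q. \<not> pad_good n k (s + 1) E}"
  have finQ: "finite Q" unfolding Q_def by (rule finite_vertex_pairs)
  then have fin: "finite A" "finite A'" "finite B" unfolding A_def A'_def B_def by auto
  have cA: "real (card A) \<le> 2 * failure_bound \<epsilon> n * 2 ^ card Q"
    using card_not_graph_good[OF n0 s Wg[unfolded v_def] Mg[unfolded v_def] M0, of k] F[of n]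
    unfolding A_def Q_def by linarith
  have cB: "real (card B) \<le> 2 * failure_bound \<epsilon> n * 2 ^ card Q"
    using card_not_pad_good[OF n0 s Wp[unfolded v_def] Mp[unfolded v_def] M0, of k] F[of "99 * n"]
    unfolding B_def Q_def by linarith
  \<comment> \<open>Taking complements is an involution on \<open>Pow Q\<close>, so A' is no larger
    than A.\<close>
  have "A' \<subseteq> (\<lambda>E. Q - E) ` A"
  proof
    fix E assume "E \<in> A'"
    then have "Q - E \<in> A" "E = Q - (Q - E)" unfolding A_def A'_def by auto
    then show "E \<in> (\<lambda>E. Q - E) ` A" by blast
  qed
  then have cA': "card A' \<le> card A" using fin by (meson card_image_le card_mono finite_imageI order.trans)
  have "{E \<in> graphs n. \<not> rip_good \<epsilon> n E} \<subseteq> A \<union> A' \<union> B"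
  proof
    fix E assume "E \<in> {E \<in> graphs n. \<not> rip_good \<epsilon> n E}"
    then have E: "E \<in> Pow Q" "\<not> rip_good \<epsilon> n E" by (auto simp: graphs_eq Q_def)
    show "E \<in> A \<union> A' \<union> B"
    proof (rule ccontr)
      assume "E \<notin> A \<union> A' \<union> B"
      then have g: "graph_good n k (s + 1) (oriented n E 1)" "graph_good n k (s + 1) (oriented n E (- 1))"
        "pad_good n k (s + 1) E"
        using E(1) unfolding A_def A'_def B_def oriented_def Q_def by auto
      have s1: "s + 1 \<le> \<delta> * v\<^sup>2" using v\<delta> v1 unfolding s_def by (simp add: mult.commute)
      \<comment> \<open>The error of normalisation is at most 972 v \<le> 324 \<delta> v^2; together
        with s + 1 this stays below 900 \<delta> v^2.\<close>
      have c1: "(real (half n) - 324 * v\<^sup>2 + (s + 1)) / (900 * v\<^sup>2) \<le> \<delta>"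
      proof -
        have "real (half n) - 324 * v\<^sup>2 + (s + 1) \<le> \<delta> * (900 * v\<^sup>2)"
          using s1 vn v\<delta> v1 by (simp add: mult_ac)
        moreover have "0 < 900 * v\<^sup>2" using v2(2) by linarith
        ultimately show ?thesis by (simp only: pos_divide_le_eq)
      qed
      have "0 < v\<^sup>2" using v2(2) by linarith
      then have c2: "(s + 1) / v\<^sup>2 \<le> \<delta>" using s1 by (simp only: pos_divide_le_eq)
      have "0 \<le> s + 1" using s by simp
      then have "rip_good \<epsilon> n E"
        unfolding rip_good_def k_def[symmetric] \<delta>_def[symmetric]
        using rip_upper[OF vpos _ g(1) g(3) c1[unfolded v_def] c2[unfolded v_def]]
          rip_upper[OF vpos _ g(2) g(3) c1[unfolded v_def] c2[unfolded v_def]] by simp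
      then show False using E(2) by simp
    qed
  qed
  then have "card {E \<in> graphs n. \<not> rip_good \<epsilon> n E} \<le> card (A \<union> A' \<union> B)"
    using fin by (intro card_mono) auto
  also have "\<dots> \<le> card A + card A' + card B"
    using card_Un_le[of "A \<union> A'" B] card_Un_le[of A A'] by linarith
  finally have "card {E \<in> graphs n. \<not> rip_good \<epsilon> n E} \<le> 2 * card A + card B" using cA' by linarith
  then have "real (card {E \<in> graphs n. \<not> rip_good \<epsilon> n E}) \<le> 2 * real (card A) + real (card B)" by linarith
  then show ?thesis using cA cB unfolding Q_def by linarith
qed

text \<open>The number n0 from which on all estimates hold and the given program is correct is a
  constant of the new program; that it exists is enough.\<close>

lemma separates_imp_solves_hidden_clique:
  assumes \<epsilon>: "0 < \<epsilon>" "\<epsilon> < 1 / 2"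
    and sep: "separates_rip \<epsilon> (\<lambda>n. carrier_mat (2 * n) (100 * n)) c"
  shows "\<exists>p. solves_hidden_clique \<epsilon> p"
proof -
  define X where "X = {enc_mat n A | n A. A \<in> carrier_mat (2 * n) (100 * n)}"
  have det: "deterministic c" and pt: "polytime_on X c"
    using sep unfolding separates_rip_def X_def by auto
  from deterministic_polytime[OF det pt] obtain q :: "nat poly"
    where q: "\<And>x. x \<in> X \<Longrightarrow> \<exists>t s. exec c (init x) [] t s \<and> t \<le> poly q (input_size x)"
    by blast
  define ok where "ok n \<longleftrightarrow> (\<forall>A \<in> carrier_mat (2 * n) (100 * n).
        (rip_of (rip_order \<epsilon> n) A \<le> rip_small \<epsilon> n \<longrightarrow> always c (enc_mat n A) yes) \<and>
        (rip_of (rip_order \<epsilon> n) A \<ge> rip_large \<epsilon> n \<longrightarrow> always c (enc_mat n A) no)) \<and>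
      clique_size \<epsilon> n \<le> rip_order \<epsilon> n \<and>
      2 * rip_large \<epsilon> n \<le> 4 / 75 * (real (clique_size \<epsilon> n) - 2) / rscale n \<and>
      3 \<le> rscale n * rip_small \<epsilon> n \<and> 4000000 \<le> n" for n
  have "\<forall>\<^sub>F n in sequentially. ok n"
    using sep eventually_clique_size_le[OF \<epsilon>] eventually_clique_gap[OF \<epsilon>] eventually_scale_error[OF \<epsilon>]
      eventually_ge_at_top[of 4000000]
    unfolding separates_rip_def ok_def by (intro eventually_conj) auto
  then obtain n0 where "\<And>n. n0 \<le> n \<Longrightarrow> ok n" unfolding eventually_sequentially by blast
  note n0 = this[unfolded ok_def]
  define p where "p = clique_prog n0 c"
  define K where "K = pweight p"
  define eB :: "nat poly" where "eB = [:5, 1, 200:]"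
  \<comment> \<open>U bounds the size of the matrix input, so each copy runs in time q composed with
    U; T adds the cost of the reduction.\<close>
  define U :: "nat poly" where "U = [:3, 0, 400:] * (1 + eB)"
  define T :: "nat poly" where "T = [:K:] * (eB ^ 2 + (q \<circ>\<^sub>p U + q \<circ>\<^sub>p U)) + (q \<circ>\<^sub>p U + q \<circ>\<^sub>p U)"
  have eB: "poly eB n = entryB n" for n by (simp add: eB_def entryB_def power2_eq_square algebra_simps)
  have U: "poly U n = (3 + 400 * n\<^sup>2) * (1 + entryB n)" for n
    by (simp add: U_def eB power2_eq_square algebra_simps)
  have T: "poly T n = K * ((entryB n)\<^sup>2 + (poly q (poly U n) + poly q (poly U n))) + (poly q (poly U n) + poly q (poly U n))" for n
    by (simp add: T_def eB poly_pcompose)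
  have detp: "deterministic p" unfolding p_def by (rule deterministic_clique_prog[OF det])
  have mat_in: "rip_mat n E g \<in> carrier_mat (2 * n) (100 * n)" for n E g by (simp add: rip_mat_def)
  have copy: "\<exists>t s. exec c (init (enc_mat n (rip_mat n E g))) [] t s \<and> t \<le> poly q (poly U n)"
    if "0 < scale n" "g = 1 \<or> g = - 1" for n E g
  proof -
    have "enc_mat n (rip_mat n E g) \<in> X" unfolding X_def using mat_in by blast
    from q[OF this] obtain t s where "exec c (init (enc_mat n (rip_mat n E g))) [] t s"
      "t \<le> poly q (input_size (enc_mat n (rip_mat n E g)))" by blast
    moreover have "poly q (input_size (enc_mat n (rip_mat n E g))) \<le> poly q (poly U n)"
      unfolding U by (intro poly_nat_mono input_size_rip_mat that)
    ultimately show ?thesis by (meson order.trans)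
  qed
  have small: "runs p (init (enc_graph n E)) (poly T n) yes" if "n < n0" for n E
  proof -
    have "K * entryB n \<le> K * (entryB n)\<^sup>2" by (intro mult_le_mono2) (simp add: power2_eq_square)
    then have le: "K * entryB n \<le> poly T n" unfolding T distrib_left by linarith
    show ?thesis by (rule runs_mono[OF runs_clique_prog_small[OF that, of c E, folded p_def, folded K_def] le])
  qed
  \<comment> \<open>r1 and r2 are final memories of the given program on the two matrices: they
    inherit whatever \<open>always\<close> grants, and the verdict is a function of them.\<close>
  define run_pair where "run_pair n E r1 r2 \<longleftrightarrow>
      (\<forall>Z. always c (enc_mat n (rip_mat n E 1)) Z \<longrightarrow> Z r1) \<and>
      (\<forall>Z. always c (enc_mat n (rip_mat n E (- 1))) Z \<longrightarrow> Z r2) \<and>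
      runs p (init (enc_graph n E)) (poly T n) (\<lambda>s. s 1 0 = (if 0 < r1 1 0 \<and> 0 < r2 1 0 then 0 else 1))"
    for n E r1 r2
  have large: "\<exists>r1 r2. run_pair n E r1 r2"
    if n: "n0 \<le> n" for n E
  proof -
    have v: "0 < scale n" using n0[OF n] by (intro scale_pos) simp
    from copy[OF v, of 1 E] obtain t1 r1 where 1: "exec c (init (enc_mat n (rip_mat n E 1))) [] t1 r1"
      "t1 \<le> poly q (poly U n)" by blast
    from copy[OF v, of "- 1" E] obtain t2 r2 where 2: "exec c (init (enc_mat n (rip_mat n E (- 1)))) [] t2 r2"
      "t2 \<le> poly q (poly U n)" by blast
    have le: "K * ((entryB n)\<^sup>2 + (t1 + t2)) + (t1 + t2) \<le> poly T n"
      unfolding T using 1(2) 2(2) by (intro add_mono mult_le_mono) auto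
    have "runs p (init (enc_graph n E)) (poly T n) (\<lambda>s. s 1 0 = (if 0 < r1 1 0 \<and> 0 < r2 1 0 then 0 else 1))"
      by (rule runs_mono[OF runs_clique_prog[OF n v 1(1) 2(1), folded p_def, folded K_def] le])
    then show ?thesis unfolding run_pair_def using deterministic_always[OF det] 1(1) 2(1) by blast
  qed
  have "polytime_on {enc_graph n E | n E. E \<in> graphs n} p"
  proof (rule runs_polytime[of _ _ T])
    fix x assume "x \<in> {enc_graph n E | n E. E \<in> graphs n}"
    then obtain n E where x: "x = enc_graph n E" by blast
    have le: "poly T n \<le> poly T (input_size x)" unfolding x by (intro poly_nat_mono le_input_size_graph)
    show "\<exists>Z. runs p (init x) (poly T (input_size x)) Z"
    proof (cases "n < n0")
      case True
      then show ?thesis using runs_mono[OF small[OF True, of E] le] x by blast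
    next
      case False
      then have "n0 \<le> n" by simp
      from large[OF this, of E] show ?thesis unfolding run_pair_def using runs_mono[OF _ le] x by blast
    qed
  qed
  moreover have "always p (enc_graph n E) yes" if E: "E \<in> graphs n" and cl: "has_clique n E (clique_size \<epsilon> n)" for n E
  proof (cases "n < n0")
    case True
    then show ?thesis using runs_always[OF small] by blast
  next
    case False
    then have n: "n0 \<le> n" by simp
    have n4: "4000000 \<le> n" using n0[OF n] by blast
    then have v: "0 < scale n" by (intro scale_pos) simp
    from cl obtain C where C: "C \<subseteq> {..<n}" "card C = clique_size \<epsilon> n"
      "\<And>u w. u \<in> C \<Longrightarrow> w \<in> C \<Longrightarrow> u \<noteq> w \<Longrightarrow> {u, w} \<in> E" unfolding has_clique_def by blast
    have "0 < real n powr (1 / 2 - \<epsilon>)" using n4 by simp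
    then have "0 < clique_size \<epsilon> n" unfolding clique_size_def by simp
    then have ne: "C \<noteq> {}" using C(2) by auto
    have "2 * rip_large \<epsilon> n \<le> rip_of (rip_order \<epsilon> n) (rip_mat n E 1) + rip_of (rip_order \<epsilon> n) (rip_mat n E (- 1))"
      using rip_lower[OF v C(1) _ ne C(3), of "rip_order \<epsilon> n"] n0[OF n] unfolding C(2) by linarith
    \<comment> \<open>One of the two parameters reaches the upper threshold; the verdict does not
      have to know which.\<close>
    then consider "rip_large \<epsilon> n \<le> rip_of (rip_order \<epsilon> n) (rip_mat n E 1)"
      | "rip_large \<epsilon> n \<le> rip_of (rip_order \<epsilon> n) (rip_mat n E (- 1))" by linarith
    then have "always c (enc_mat n (rip_mat n E 1)) no \<or> always c (enc_mat n (rip_mat n E (- 1))) no"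
      using n0[OF n] mat_in by cases blast+
    moreover from large[OF n, of E] obtain r1 r2 where r: "run_pair n E r1 r2" by blast
    ultimately have "no r1 \<or> no r2" unfolding run_pair_def by blast
    then have "(if 0 < r1 1 0 \<and> 0 < r2 1 0 then 0 else 1) = (1 :: int)" by (auto simp: no_def)
    moreover have "runs p (init (enc_graph n E)) (poly T n) (\<lambda>s. s 1 0 = (if 0 < r1 1 0 \<and> 0 < r2 1 0 then 0 else 1))"
      using r unfolding run_pair_def by blast
    from runs_always[OF this] calculation show ?thesis by (simp only: yes_def[abs_def])
  qed
  moreover have "(\<lambda>n. measure_pmf.prob (random_graph n) {E. prob_output p (enc_graph n E) no \<ge> 3 / 4}) \<longlonglongrightarrow> 1"
  proof (rule tendsto_sandwich)
    show "(\<lambda>n. 1 - 6 * failure_bound \<epsilon> n) \<longlonglongrightarrow> 1"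
      using tendsto_diff[OF tendsto_const[of 1] tendsto_mult_left[OF failure_bound_tendsto[OF \<epsilon>], of 6]] by simp
    show "\<forall>\<^sub>F n in sequentially. measure_pmf.prob (random_graph n) {E. prob_output p (enc_graph n E) no \<ge> 3 / 4} \<le> 1"
      by simp
    show "\<forall>\<^sub>F n in sequentially. 1 - 6 * failure_bound \<epsilon> n
      \<le> measure_pmf.prob (random_graph n) {E. prob_output p (enc_graph n E) no \<ge> 3 / 4}"
      using eventually_ge_at_top[of n0]
    proof eventually_elim
      case (elim n)
      define Q where "Q = vertex_pairs n"
      define S where "S = {E. prob_output p (enc_graph n E) no \<ge> 3 / 4}"
      have finQ: "finite Q" unfolding Q_def by (rule finite_vertex_pairs)
      have good: "E \<in> S" if E: "rip_good \<epsilon> n E" for E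
      proof -
        have "always c (enc_mat n (rip_mat n E 1)) yes" "always c (enc_mat n (rip_mat n E (- 1))) yes"
          using n0[OF elim] mat_in E unfolding rip_good_def by blast+
        moreover from large[OF elim, of E] obtain r1 r2 where r: "run_pair n E r1 r2" by blast
        ultimately have "yes r1" "yes r2" unfolding run_pair_def by blast+
        then have "(if 0 < r1 1 0 \<and> 0 < r2 1 0 then 0 else 1) = (0 :: int)" by (simp add: yes_def)
        moreover have "runs p (init (enc_graph n E)) (poly T n) (\<lambda>s. s 1 0 = (if 0 < r1 1 0 \<and> 0 < r2 1 0 then 0 else 1))"
          using r unfolding run_pair_def by blast
        from runs_always[OF this] calculation have "always p (enc_graph n E) no" by (simp only: no_def[abs_def])
        then show ?thesis using prob_output_deterministic[OF detp] by (simp add: S_def)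
      qed
      \<comment> \<open>A graph that is not answered correctly is not \<open>rip_good\<close>, and
        such graphs are rare.\<close>
      have "Pow Q = {E \<in> Pow Q. E \<in> S} \<union> {E \<in> graphs n. \<not> rip_good \<epsilon> n E}"
        using good by (auto simp: graphs_eq Q_def)
      then have "card (Pow Q) \<le> card {E \<in> Pow Q. E \<in> S} + card {E \<in> graphs n. \<not> rip_good \<epsilon> n E}"
        by (metis card_Un_le)
      then have "real (card (Pow Q)) \<le> real (card {E \<in> Pow Q. E \<in> S}) + real (card {E \<in> graphs n. \<not> rip_good \<epsilon> n E})"
        by linarith
      moreover have "real (card (Pow Q)) = 2 ^ card Q" using finQ by (simp add: card_Pow)
      ultimately have "2 ^ card Q \<le> real (card {E \<in> Pow Q. E \<in> S}) + real (card {E \<in> graphs n. \<not> rip_good \<epsilon> n E})"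
        by (simp only:)
      also have "real (card {E \<in> graphs n. \<not> rip_good \<epsilon> n E}) \<le> 6 * failure_bound \<epsilon> n * 2 ^ card Q"
        unfolding Q_def using n0[OF elim] by (intro card_not_rip_good[OF \<epsilon>]) auto
      finally have "(1 - 6 * failure_bound \<epsilon> n) * 2 ^ card Q \<le> real (card {E \<in> Pow Q. E \<in> S})"
        by (simp add: algebra_simps)
      then have "1 - 6 * failure_bound \<epsilon> n \<le> real (card {E \<in> Pow Q. E \<in> S}) / 2 ^ card Q"
        by (simp add: pos_le_divide_eq)
      also have "\<dots> = measure_pmf.prob (random_graph n) S"
      proof -
        have "Pow Q \<inter> S = {E \<in> Pow Q. E \<in> S}" by auto
        then show ?thesis unfolding random_graph_def graphs_eq Q_def[symmetric]
          using finQ by (subst measure_pmf_of_set) (auto simp: card_Pow)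
      qed
      finally show ?case unfolding S_def .
    qed
  qed simp
  ultimately have "solves_hidden_clique \<epsilon> p" unfolding solves_hidden_clique_def by blast
  then show ?thesis ..
qed

subsection \<open>Hardness of approximation\<close>

fun powE :: "expr \<Rightarrow> nat \<Rightarrow> expr" where
  "powE e 0 = Const 1"
| "powE e (Suc k) = Mul e (powE e k)"

lemma val_powE: "val (powE e k) s = val e s ^ k"
  by (induction k) auto

text \<open>Array 0 stays in place so that the input need not be copied; the output of the given
  program moves to array 2.\<close>

definition spare :: "nat \<Rightarrow> nat" where
  "spare a = (if a = 0 then 0 else a + 1)"

text \<open>For an approximation x / y \<ge> 0 and even b, the test x^b n^a \<le> y^b decides in
  integer arithmetic whether x / y \<le> n powr (- a / b).\<close>

definition threshold :: "nat \<Rightarrow> nat \<Rightarrow> prog" where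
  "threshold a b =
    If (Sub (Add (powE (Read 2 (Const 1)) b) (Const 1)) (Mul (powE (Read 2 (Const 0)) b) (powE (Read 1 (Const 0)) a)))
      (Write 1 (Const 0) (Const 1)) (Write 1 (Const 0) (Const 0))"

text \<open>Array 1 is left unused by the renamed program and keeps the value of \<open>n\<close>.\<close>

definition decision_prog :: "nat \<Rightarrow> nat \<Rightarrow> prog \<Rightarrow> prog" where
  "decision_prog a b c = Seq (Write 1 (Const 0) (Read 0 (Const 0))) (Seq (ren spare c) (threshold a b))"

lemma deterministic_decision_prog: "deterministic c \<Longrightarrow> deterministic (decision_prog a b c)"
  by (simp add: decision_prog_def threshold_def)

text \<open>The fraction under test can have about \<open>input_size x + t\<close> bits, which is
  why t occurs in the product as well.\<close>

lemma runs_decision_prog: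
  assumes c: "exec c (init x) [] t r"
  shows "runs (decision_prog a b c) (init x) (pweight (decision_prog a b c) * (1 + input_size x + t) + t)
    (\<lambda>s. s 1 0 = (if r 1 0 ^ b * init x 0 0 ^ a \<le> r 1 1 ^ b then 1 else 0))"
proof -
  define B where "B = 1 + input_size x"
  define n where "n = init x 0 0"
  define s1 where "s1 = store (init x) 1 0 n"
  define Z where "Z s \<longleftrightarrow> s 1 0 = (if r 1 0 ^ b * n ^ a \<le> r 1 1 ^ b then 1 else 0)" for s :: mem
  have bit: "bits (init x i j) \<le> B" for i j
  proof -
    have "init x i j \<in> insert 0 (set x)" unfolding init_def by (auto simp del: nth_mem intro!: nth_mem)
    moreover have "bits 0 \<le> B" by (simp add: bits_le_iff)
    ultimately show ?thesis using bits_le_input_size[of "init x i j" x] unfolding B_def by auto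
  qed
  have cw: "cells_within B (init x)" using bit by (simp add: cells_within_def B_def)
  then have cw1: "cells_within B s1" unfolding s1_def n_def using bit by (intro cells_within_store)
  have inj: "inj spare" by (auto simp: inj_def spare_def split: if_splits)
  have r1: "1 \<notin> range spare" by (auto simp: spare_def)
  have "s1 \<circ> spare = init x"
  proof
    fix i
    show "(s1 \<circ> spare) i = init x i"
      by (cases "i = 0") (auto simp: spare_def s1_def store_def init_def)
  qed
  from exec_ren[OF c inj this] obtain u where u: "exec (ren spare c) s1 [] t u" "u \<circ> spare = r"
    "\<And>d. d \<notin> range spare \<Longrightarrow> u d = s1 d" by blast
  have "spare 1 = 2" by (simp add: spare_def)
  then have u2: "u 2 = r 1" using u(2) by (metis comp_apply)
  have u1: "u 1 0 = n" using u(3)[OF r1] by (simp add: s1_def store_def)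
  have cw2: "cells_within (B + t) u"
    unfolding cells_within_def
  proof (intro conjI allI)
    fix i j
    have "bits (s1 i j) \<le> B" using cw1 by (simp add: cells_within_def)
    then show "bits (u i j) \<le> B + t" using exec_bits[OF u(1), of i j] by linarith
  qed (simp add: B_def)
  have "runs (threshold a b) u (pweight (threshold a b) * (B + t)) Z"
    unfolding threshold_def
  proof (rule runs_If_weight[OF cw2]; rule runs_Write_weight[OF cw2])
    define g where "g = Sub (Add (powE (Read 2 (Const 1)) b) (Const 1)) (Mul (powE (Read 2 (Const 0)) b) (powE (Read 1 (Const 0)) a))"
    have g: "0 < val g u \<longleftrightarrow> r 1 0 ^ b * n ^ a \<le> r 1 1 ^ b"
      unfolding g_def by (simp add: val_powE u2 u1[unfolded One_nat_def] u1)
    show "Z (store u 1 (val (Const 0) u) (val (Const 1) u))" if "0 < val g u"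
      using that unfolding g by (simp add: Z_def store_def)
    show "Z (store u 1 (val (Const 0) u) (val (Const 0) u))" if "\<not> 0 < val g u"
      using that unfolding g by (simp add: Z_def store_def)
  qed
  then have rest: "runs (Seq (ren spare c) (threshold a b)) s1 (t + pweight (threshold a b) * (B + t)) Z"
    using u(1) by (intro runs_Seq) (auto simp: runs_def)
  have "runs (decision_prog a b c) (init x)
      (pweight (Write 1 (Const 0) (Read 0 (Const 0))) * B + (t + pweight (threshold a b) * (B + t))) Z"
    unfolding decision_prog_def
    by (rule runs_Seq, rule runs_Write_weight[OF cw]) (use rest in \<open>simp add: s1_def n_def\<close>)
  then show ?thesis unfolding n_def[symmetric] Z_def[symmetric]
  proof (rule runs_mono)
    define w where "w = pweight (Write 1 (Const 0) (Read 0 (Const 0)))"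
    have "w * B \<le> w * (B + t)" by simp
    then have "w * B + (t + pweight (threshold a b) * (B + t)) \<le> (w + pweight (threshold a b)) * (B + t) + t"
      unfolding distrib_right by linarith
    also have "\<dots> \<le> pweight (decision_prog a b c) * (B + t) + t"
      unfolding decision_prog_def w_def by (intro add_mono mult_le_mono1) simp_all
    finally show "pweight (Write 1 (Const 0) (Read 0 (Const 0))) * B + (t + pweight (threshold a b) * (B + t))
      \<le> pweight (decision_prog a b c) * (1 + input_size x + t) + t"
      by (simp only: w_def B_def)
  qed
qed

lemma rational_between:
  fixes x y :: real
  assumes "0 < x" "x < y"
  obtains a b :: nat where "0 < b" "x * real b < real a" "real a < y * real b"
proof -
  obtain r where r: "r \<in> \<rat>" "x < r" "r < y" using Rats_dense_in_real[OF assms(2)] by blast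
  then obtain m n :: nat where mn: "n \<noteq> 0" "\<bar>r\<bar> = real m / real n"
    using Rats_abs_nat_div_natE[OF r(1)] by metis
  then have "r * real n = real m" using r assms by simp
  moreover have "x * real n < r * real n" "r * real n < y * real n" using r mn(1) by simp_all
  ultimately show ?thesis using mn(1) by (intro that[of n m]) simp_all
qed

text \<open>For a / b strictly between the two exponents, n powr (- a / b) eventually exceeds \<rho>
  times the lower threshold and falls below the upper one.\<close>

lemma approximates_imp_separates:
  assumes \<epsilon>: "0 < \<epsilon>" "\<epsilon> < 1 / 2" and \<rho>: "1 \<le> \<rho>" and app: "approximates_rip \<epsilon> \<rho> D c"
  shows "\<exists>c'. separates_rip \<epsilon> D c'"
proof -
  define f where "f = 5 * \<epsilon> / 4 - \<epsilon>\<^sup>2 / 2"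
  from rational_between[OF \<epsilon>(1) rip_exponents(2)[OF \<epsilon>]] obtain a' b' :: nat where
    ab': "0 < b'" "\<epsilon> * real b' < real a'" "real a' < f * real b'" unfolding f_def by blast
  \<comment> \<open>Doubling makes b even, so that the power of the denominator is positive whatever
    its sign.\<close>
  define a b where "a = 2 * a'" and "b = 2 * b'"
  have ab: "\<epsilon> * real b < real a" "real a < f * real b" "even b" "0 < b" using ab' by (auto simp: a_def b_def)
  define p where "p = decision_prog a b c"
  define X where "X = {enc_mat n A | n A. A \<in> D n}"
  have det: "deterministic c" and pt: "polytime_on X c"
    using app unfolding approximates_rip_def X_def by auto
  have detp: "deterministic p" unfolding p_def by (rule deterministic_decision_prog[OF det])
  from deterministic_polytime[OF det pt] obtain q :: "nat poly"
    where q: "\<And>x. x \<in> X \<Longrightarrow> \<exists>t s. exec c (init x) [] t s \<and> t \<le> poly q (input_size x)"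
    by blast
  have run: "\<exists>t r. exec c (init x) [] t r \<and> t \<le> poly q (input_size x) \<and>
      runs p (init x) (pweight p * (1 + input_size x + t) + t)
        (\<lambda>s. s 1 0 = (if r 1 0 ^ b * init x 0 0 ^ a \<le> r 1 1 ^ b then 1 else 0))" if "x \<in> X" for x
    using q[OF that] runs_decision_prog unfolding p_def by blast
  have "polytime_on X p"
  proof (rule runs_polytime[of _ _ "[:pweight p:] * ([:1, 1:] + q) + q"])
    fix x assume "x \<in> X"
    from run[OF this] obtain t Z where t: "t \<le> poly q (input_size x)"
      and r: "runs p (init x) (pweight p * (1 + input_size x + t) + t) Z" by blast
    have "pweight p * (1 + input_size x + t) + t \<le> pweight p * (1 + input_size x + poly q (input_size x)) + poly q (input_size x)"
      using t by (intro add_mono mult_le_mono) auto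
    also have "\<dots> = poly ([:pweight p:] * ([:1, 1:] + q) + q) (input_size x)" by simp
    finally show "\<exists>Z. runs p (init x) (poly ([:pweight p:] * ([:1, 1:] + q) + q) (input_size x)) Z"
      using runs_mono[OF r] by blast
  qed
  moreover have "\<forall>\<^sub>F n in sequentially. \<forall>A \<in> D n.
        (rip_of (rip_order \<epsilon> n) A \<le> rip_small \<epsilon> n \<longrightarrow> always p (enc_mat n A) yes) \<and>
        (rip_of (rip_order \<epsilon> n) A \<ge> rip_large \<epsilon> n \<longrightarrow> always p (enc_mat n A) no)"
  proof -
    have pos: "0 < f * real b - real a" "0 < real a - \<epsilon> * real b" using ab by auto
    have "\<forall>\<^sub>F n in sequentially. \<forall>A \<in> D n. always c (enc_mat n A) (\<lambda>s. \<exists>q. outputs_rational s q \<and>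
          of_rat q \<in> {rip_of (rip_order \<epsilon> n) A .. \<rho> * rip_of (rip_order \<epsilon> n) A})"
      using app by (simp add: approximates_rip_def)
    \<comment> \<open>The first estimate absorbs the factor \<rho>. In the second, 4^b stems from
      the 4 in \<open>rip_large\<close>, and the added 1 makes the inequality strict.\<close>
    from this eventually_le_powr[OF pos(1), of "\<rho> ^ b"] eventually_le_powr[OF pos(2), of "4 ^ b + 1"]
      eventually_gt_at_top[of 0]
    show ?thesis
    proof eventually_elim
      case (elim n)
      show ?case
      proof
        fix A assume A: "A \<in> D n"
        define x where "x = enc_mat n A"
        define \<delta> where "\<delta> = rip_of (rip_order \<epsilon> n) A"
        have "x \<in> X" unfolding x_def X_def using A by blast
        from run[OF this] obtain t r where r: "exec c (init x) [] t r"
          "\<exists>T. runs p (init x) T (\<lambda>s. s 1 0 = (if r 1 0 ^ b * init x 0 0 ^ a \<le> r 1 1 ^ b then 1 else 0))" by blast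
        have x0: "init x 0 0 = int n" by (simp add: x_def init_def enc_mat_def)
        from r(2) have out: "always p x (\<lambda>s. s 1 0 = (if r 1 0 ^ b * int n ^ a \<le> r 1 1 ^ b then 1 else 0))"
          unfolding x0 using runs_always by blast
        have "always c x (\<lambda>s. \<exists>q. outputs_rational s q \<and> of_rat q \<in> {\<delta> .. \<rho> * \<delta>})"
          using elim(1) A unfolding x_def \<delta>_def by blast
        from deterministic_always[OF det this r(1)] obtain y where
          y: "outputs_rational r y" "\<delta> \<le> of_rat y" "of_rat y \<le> \<rho> * \<delta>" by auto
        define z where "z = real_of_int (r 1 0) / real_of_int (r 1 1)"
        have d0: "r 1 1 \<noteq> 0" and yz: "of_rat y = z"
          using y(1) unfolding outputs_rational_def z_def by (auto simp: of_rat_divide)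
        have \<delta>0: "0 \<le> \<delta>" unfolding \<delta>_def rip_of_def by (rule rip_param_least(1))
        have z0: "0 \<le> z" "\<delta> \<le> z" "z \<le> \<rho> * \<delta>" using y \<delta>0 yz by auto
        have den: "0 < real_of_int (r 1 1) ^ b" using d0 ab(3) by (simp add: zero_less_power_eq)
        have n: "0 < real n" using elim by simp
        have iff: "r 1 0 ^ b * int n ^ a \<le> r 1 1 ^ b \<longleftrightarrow> z ^ b * real n powr real a \<le> 1"
        proof -
          have "r 1 0 ^ b * int n ^ a \<le> r 1 1 ^ b \<longleftrightarrow>
            real_of_int (r 1 0) ^ b * real n ^ a \<le> real_of_int (r 1 1) ^ b"
            by (metis (mono_tags) of_int_le_iff of_int_mult of_int_of_nat_eq of_int_power)
          also have "\<dots> \<longleftrightarrow> z ^ b * real n ^ a \<le> 1"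
            using den unfolding z_def power_divide by (simp add: field_simps)
          finally show ?thesis using n by (simp add: powr_realpow)
        qed
        have "always p x yes" if "\<delta> \<le> rip_small \<epsilon> n"
        proof -
          have "z \<le> \<rho> * real n powr (- f)"
          proof -
            have "\<rho> * \<delta> \<le> \<rho> * rip_small \<epsilon> n" using that \<rho> by (intro mult_left_mono) auto
            moreover have "rip_small \<epsilon> n = real n powr (- f)" by (simp add: rip_small_def f_def)
            ultimately show ?thesis using z0 by simp
          qed
          then have "z ^ b \<le> (\<rho> * real n powr (- f)) ^ b" using z0 by (intro power_mono)
          also have "\<dots> = \<rho> ^ b * real n powr (- f * real b)" using n by (simp add: power_mult_distrib powr_power mult.commute)
          finally have "z ^ b * real n powr real a \<le> \<rho> ^ b * real n powr (- f * real b) * real n powr real a"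
            by (intro mult_right_mono) auto
          also have "\<dots> = \<rho> ^ b * real n powr (- (f * real b - real a))" by (simp flip: powr_add)
          also have "\<dots> \<le> real n powr (f * real b - real a) * real n powr (- (f * real b - real a))"
            using elim(2) by (intro mult_right_mono) auto
          also have "\<dots> = 1" using n by (simp flip: powr_add)
          finally have "r 1 0 ^ b * int n ^ a \<le> r 1 1 ^ b" using iff by blast
          then show ?thesis using out by (simp add: yes_def[abs_def])
        qed
        moreover have "always p x no" if "rip_large \<epsilon> n \<le> \<delta>"
        proof -
          have "real n powr (- \<epsilon>) / 4 \<le> z" using that z0 by (simp add: rip_large_def)
          then have "(real n powr (- \<epsilon>) / 4) ^ b \<le> z ^ b" by (intro power_mono) auto
          moreover have "(real n powr (- \<epsilon>) / 4) ^ b = real n powr (- \<epsilon> * real b) / 4 ^ b"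
            using n by (simp add: power_divide powr_power mult.commute)
          ultimately have "real n powr (- \<epsilon> * real b) / 4 ^ b * real n powr real a \<le> z ^ b * real n powr real a"
            by (intro mult_right_mono) auto
          moreover have "real n powr (- \<epsilon> * real b) / 4 ^ b * real n powr real a = real n powr (real a - \<epsilon> * real b) / 4 ^ b"
            by (simp add: add.commute flip: powr_add)
          moreover have "1 < real n powr (real a - \<epsilon> * real b) / 4 ^ b" using elim(3) by (simp add: field_simps)
          ultimately have "\<not> r 1 0 ^ b * int n ^ a \<le> r 1 1 ^ b" unfolding iff by linarith
          then show ?thesis using out by (simp add: no_def[abs_def])
        qed
        ultimately show "(rip_of (rip_order \<epsilon> n) A \<le> rip_small \<epsilon> n \<longrightarrow> always p (enc_mat n A) yes) \<and>
          (rip_of (rip_order \<epsilon> n) A \<ge> rip_large \<epsilon> n \<longrightarrow> always p (enc_mat n A) no)"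
          unfolding \<delta>_def x_def by blast
      qed
    qed
  qed
  ultimately have "separates_rip \<epsilon> D p" using detp unfolding separates_rip_def X_def by blast
  then show ?thesis ..
qed

text \<open>Fewer inputs make the task easier, so hardness passes from the restricted sizes to all
  matrices.\<close>

lemma separates_mono:
  assumes "separates_rip \<epsilon> D c" "\<And>n. D' n \<subseteq> D n"
  shows "separates_rip \<epsilon> D' c"
proof -
  have "polytime_on {enc_mat n A | n A. A \<in> D' n} c"
  proof -
    have "{enc_mat n A | n A. A \<in> D' n} \<subseteq> {enc_mat n A | n A. A \<in> D n}" using assms(2) by blast
    then show ?thesis using assms(1) unfolding separates_rip_def polytime_on_def by (meson subsetD)
  qed
  then show ?thesis using assms unfolding separates_rip_def
    by (auto elim!: eventually_mono dest: subsetD)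
qed

theorem theorem7:
  fixes \<epsilon> :: real
  assumes "0 < \<epsilon>" and "\<epsilon> < 1 / 2"
    and "hidden_clique_hypothesis \<epsilon>"
  shows "\<not> (\<exists>c. separates_rip \<epsilon> (\<lambda>n. UNIV) c) \<and>
    \<not> (\<exists>c. separates_rip \<epsilon> (\<lambda>n. carrier_mat (2 * n) (100 * n)) c) \<and>
    rip_small \<epsilon> \<in> o(rip_large \<epsilon>) \<and>
    (\<forall>\<rho>\<ge>1. \<not> (\<exists>c. approximates_rip \<epsilon> \<rho> (\<lambda>n. carrier_mat (2 * n) (100 * n)) c))"
proof -
  have hard: "\<not> separates_rip \<epsilon> (\<lambda>n. carrier_mat (2 * n) (100 * n)) c" for c
    using separates_imp_solves_hidden_clique[OF assms(1,2)] assms(3) unfolding hidden_clique_hypothesis_def by blast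
  moreover have "\<not> separates_rip \<epsilon> (\<lambda>n. UNIV) c" for c
    using hard separates_mono[of \<epsilon> "\<lambda>n. UNIV" c "\<lambda>n. carrier_mat (2 * n) (100 * n)"] by blast
  moreover have "\<not> approximates_rip \<epsilon> \<rho> (\<lambda>n. carrier_mat (2 * n) (100 * n)) c" if "1 \<le> \<rho>" for \<rho> c
    using hard approximates_imp_separates[OF assms(1,2) that] by blast
  ultimately show ?thesis using rip_small_smallo[OF assms(1,2)] by blast
qed

end
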